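(* Fix $\alpha\in(0,2)$. Let $Y(z)$ be the unique analytic solution on $\mathbb C^+$ of $$z^\alpha Y(z)=C_\alpha g_\alpha(Y(z))$$ tending to zero at infinity, and let $\mu_\alpha$ be the probability measure on $\mathbb R$ with Cauchy–Stieltjes transform $\int\frac{1}{z-x}d\mu_\alpha(x)=\frac1z h_\alpha(Y(z))$, $z\in\mathbb C^+$. Then: (i) $Y(z)$ takes values in the set $\mathcal K_\alpha=\{Re^{i\theta}:|\theta|\le\frac{\alpha\pi}{2},\ R\ge 0\}$, on which $g_\alpha$ is uniformly bounded. (ii) $Y$ has a continuous extension to $\mathbb R\setminus\{0\}$, which is analytic except possibly at the set $$\mathcal D_\alpha=\{0\}\cup\{\pm t:\ t>0,\ t^\alpha=C_\alpha g_\alpha'(y)>0 \text{ for some } y\in\mathcal K_\alpha \text{ with } g_\alpha(y)=y\,g_\alpha'(y)\},$$ and $\mathcal D_\alpha$ is finite. (iii) $\mu_\alpha$ has a symmetric, uniformly bounded density given, for $t\neq0$, by $$\rho_\alpha(t)=-\frac{1}{\pi t}\,\Im\big(h_\alpha(Y(t))\big)=\frac{\alpha|t|^{\alpha-1}}{2|C_\alpha|\pi}\,\Im\big(i^{-\alpha}Y(|t|)^2\big),$$ which is continuous at every $t\ne0$, real-analytic outside $\mathcal D_\alpha$, and non-vanishing on any open interval (i.e. it is not identically zero on any non-empty open interval).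
   Context: $\mathbb C^+=\{z\in\mathbb C:\Im z>0\}$. For $\alpha\in(0,2)$, $x\mapsto x^\alpha$ is the branch on $\mathbb C\setminus\mathbb R^-$ given by $x^\alpha=r^\alpha e^{i\alpha\theta}$ for $x=re^{i\theta}$, $\theta\in(-\pi,\pi)$ (so $i^\alpha=e^{i\pi\alpha/2}$), and $x^{-\alpha}:=(x^{-1})^\alpha$. The entire functions $g_\alpha,h_\alpha$ are $$g_\alpha(y)=\int_0^\infty t^{\frac\alpha2-1}e^{-t}\exp\{-t^{\alpha/2}y\}\,dt,\qquad h_\alpha(y)=\int_0^\infty e^{-t}\exp\{-t^{\alpha/2}y\}\,dt=1-\frac\alpha2\,y\,g_\alpha(y),$$ and $C_\alpha=i^\alpha\,\Gamma(1-\frac\alpha2)/\Gamma(\frac\alpha2)$. It is known (previous work of Ben Arous and Guionnet) that the analytic solution $Y$ on $\mathbb C^+$ tending to zero at infinity exists and is unique, and that $\frac1z h_\alpha(Y(z))$ is the Cauchy–Stieltjes transform of a probability measure $\mu_\alpha$ (the limiting spectral measure of Wigner matrices with entries in the domain of attraction of an $\alpha$-stable law). *)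

theory Defs
  imports "HOL-Probability.Probability" "HOL-Complex_Analysis.Complex_Analysis"
begin

definition upper_half_plane :: "complex set" where
  "upper_half_plane = {z. Im z > 0}"

text \<open>
  The branch of \<open>x\<^sup>\<alpha>\<close> on the plane slit along the negative reals is
  \<open>x powr complex_of_real \<alpha>\<close>, since \<^const>\<open>Ln\<close> is the principal logarithm.
\<close>

definition g_stable :: "real \<Rightarrow> complex \<Rightarrow> complex" where
  "g_stable \<alpha> y = (LINT t:{0<..}|lborel.
     complex_of_real (t powr (\<alpha> / 2 - 1) * exp (- t)) * exp (- (complex_of_real (t powr (\<alpha> / 2)) * y)))"

definition h_stable :: "real \<Rightarrow> complex \<Rightarrow> complex" where
  "h_stable \<alpha> y = (LINT t:{0<..}|lborel.
     complex_of_real (exp (- t)) * exp (- (complex_of_real (t powr (\<alpha> / 2)) * y)))"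

definition C_stable :: "real \<Rightarrow> complex" where
  "C_stable \<alpha> = \<i> powr complex_of_real \<alpha> * complex_of_real (Gamma (1 - \<alpha> / 2) / Gamma (\<alpha> / 2))"

definition K_stable :: "real \<Rightarrow> complex set" where
  "K_stable \<alpha> = {rcis R \<theta> | R \<theta>. \<bar>\<theta>\<bar> \<le> \<alpha> * pi / 2 \<and> R \<ge> 0}"

text \<open>The positivity of \<open>C\<^sub>\<alpha> g\<^sub>\<alpha>'(y)\<close> is implied by its being equal to \<open>t\<^sup>\<alpha>\<close> with \<open>t > 0\<close>.\<close>

definition D_stable :: "real \<Rightarrow> real set" where
  "D_stable \<alpha> = {0} \<union> {s. \<exists>t > 0. (s = t \<or> s = - t) \<and>
     (\<exists>y \<in> K_stable \<alpha>. g_stable \<alpha> y = y * deriv (g_stable \<alpha>) y \<and>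
        complex_of_real (t powr \<alpha>) = C_stable \<alpha> * deriv (g_stable \<alpha>) y)}"

text \<open>
  Analyticity, at a possibly non-interior point \<open>x\<close> of \<open>S\<close>, of a function given on \<open>S\<close> only:
  near \<open>x\<close> it is the restriction to \<open>S\<close> of a function holomorphic on a full neighbourhood of \<open>x\<close>.
\<close>

definition analytic_at_within :: "(complex \<Rightarrow> complex) \<Rightarrow> complex \<Rightarrow> complex set \<Rightarrow> bool" where
  "analytic_at_within f x S \<longleftrightarrow>
     (\<exists>F r. r > 0 \<and> F holomorphic_on ball x r \<and> (\<forall>z \<in> ball x r \<inter> S. F z = f z))"

definition real_analytic_at :: "(real \<Rightarrow> real) \<Rightarrow> real \<Rightarrow> bool" where
  "real_analytic_at f t \<longleftrightarrow>
     (\<exists>a r. r > 0 \<and> (\<forall>x. \<bar>x - t\<bar> < r \<longrightarrow> (\<lambda>n. a n * (x - t) ^ n) sums f x))"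

end

theory Submission
  imports Defs
begin

text \<open>
  Write \<open>b = \<alpha>/2\<close>, and let \<open>K\<close> be the sector \<open>|arg y| \<le> b \<pi>\<close>. If \<open>S\<close> is a positive stable variable
  of index \<open>b\<close>, then \<open>g(y) = \<Gamma>(b) E (1 + y\<^sup>1\<^sup>/\<^sup>b S)\<^sup>-\<^sup>b\<close>, so \<open>arg g(y)\<close> lies in \<open>[-b \<pi>, 0]\<close> for
  \<open>0 \<le> arg y \<le> b \<pi>\<close>. The arguments in the equation for \<open>Y\<close> satisfy
  \<open>\<alpha> arg z + arg Y = b \<pi> + arg g(Y)\<close> near infinity, and this relation forbids \<open>Y\<close> to cross the
  boundary of \<open>K\<close>; hence \<open>Y\<close> stays in \<open>K\<close>. Near a real \<open>t \<noteq> 0\<close> the values of \<open>Y\<close> accumulate only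
  at the isolated zeros of \<open>C g(y) - t\<^sup>\<alpha> y\<close>, and by connectedness they converge to one of them; the
  inverse function theorem for \<open>y \<mapsto> C g(y)/y\<close> gives analyticity off the critical points, which are
  finite in number since \<open>b y g(y) = 1 - h(y) \<rightarrow> 1\<close> and \<open>y h'(y) \<rightarrow> 0\<close> at infinity in \<open>K\<close>. As \<open>z \<rightarrow> 0\<close>,
  \<open>Y\<close> tends to infinity and \<open>|h(Y)| \<le> c |Y|\<^sup>-\<^sup>1\<^sup>/\<^sup>b \<le> c' |z|\<close>, so the Stieltjes transform is bounded and
  can be inverted. If the density vanished on an interval, then both \<open>i\<^sup>-\<^sup>\<alpha> Y\<^sup>2\<close> and \<open>h(Y)\<close> would be
  real there, which forces \<open>h(e\<^sup>i\<^sup>\<phi> w) = h(\<plusminus>e\<^sup>-\<^sup>i\<^sup>\<phi> w)\<close> with \<open>\<phi> = b \<pi>/2\<close>, contradicting \<open>h'(0) \<noteq> 0\<close>.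
\<close>

section \<open>Integrals over the positive half-line\<close>

text \<open>The obstacle in locating \<open>g(y)\<close> is that \<open>w = y^(1/b)\<close> may have
  negative real part, where \<open>exp(-t w s)\<close> is unbounded in \<open>s\<close>; moreover
  the sector leaves the right half-plane when \<open>b > 1/2\<close>, so crude bounds fail on it.
  One device meets both: the kernel carries a complex rate \<open>l\<close> in
  \<open>exp(-l t)\<close>, and turning the ray multiplies \<open>y\<close> by \<open>l^b\<close>,
  trading decay in \<open>t\<close> for decay in \<open>t^b\<close>. The stable variable enters only
  through generating functions with nonnegative coefficients: the target cone is convex and closed,
  so positive combinations and limits cannot leave it. The equation for \<open>Y\<close> fixes
  arguments only modulo \<open>2 pi\<close>; the argument relation becomes exact because the sector
  keeps \<open>Y\<close> and \<open>g(Y)\<close> off the cut of \<open>Arg\<close>, so that the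
  defect is continuous with values in the multiples of \<open>2 pi\<close>. The constant
  \<open>C\<close> enters through its argument \<open>b pi\<close> and its positive modulus, called
  \<open>\<gamma>\<close>. Negative reals lie on the cut of the power and are reached by the
  symmetry \<open>Y(-cnj z) = cnj (Y z)\<close>, a consequence of local uniqueness at
  infinity.\<close>

text \<open>Cauchy's estimate on discs of radius \<open>r/3\<close> centred in
  \<open>ball z0 (r/3)\<close> bounds the derivative by \<open>3 * B / r\<close>. A bound on the
  function thus dominates its difference quotients.\<close>

lemma norm_diff_quotient_le:
  fixes f :: "complex \<Rightarrow> complex"
  assumes hol: "f holomorphic_on ball z0 r" and r: "r > 0"
    and bnd: "\<And>z. z \<in> ball z0 r \<Longrightarrow> norm (f z) \<le> B"
    and z: "z \<in> ball z0 (r/3)"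
  shows "norm (f z - f z0) \<le> 3 * B / r * norm (z - z0)"
proof -
  have der: "norm (deriv f w) \<le> 3 * B / r" if w: "w \<in> ball z0 (r/3)" for w
  proof -
    have sub: "cball w (r/3) \<subseteq> ball z0 r"
    proof
      fix x assume "x \<in> cball w (r/3)"
      then have "dist w x \<le> r/3" by simp
      moreover have "dist z0 w < r/3" using w by simp
      ultimately have "dist z0 x < r" using dist_triangle[of z0 x w] r by linarith
      then show "x \<in> ball z0 r" by simp
    qed
    have "norm ((deriv ^^ 1) f w) \<le> fact 1 * B / (r/3)^1"
    proof (rule Cauchy_inequality)
      show "f holomorphic_on ball w (r/3)" using hol by (rule holomorphic_on_subset) (use sub in auto)
      show "continuous_on (cball w (r/3)) f"
        using holomorphic_on_imp_continuous_on[OF holomorphic_on_subset[OF hol sub]] .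
      show "norm (f x) \<le> B" if "norm (w - x) = r/3" for x
        using that sub by (intro bnd) (auto simp: subset_iff dist_norm)
    qed (use r in auto)
    then show ?thesis by (simp add: mult.commute)
  qed
  show ?thesis
  proof (rule field_differentiable_bound[of "ball z0 (r/3)" f "deriv f"])
    show "(f has_field_derivative deriv f w) (at w within ball z0 (r/3))" if "w \<in> ball z0 (r/3)" for w
      by (rule has_field_derivative_at_within, rule holomorphic_derivI[OF hol]) (use that r in auto)
  qed (use der z r in auto)
qed

text \<open>Domination of the integrand on a disc suffices, with no separate bound on its
  derivative: holomorphy converts the former into a bound on difference quotients.\<close>

lemma has_field_derivative_lebesgue_integral:
  fixes f :: "complex \<Rightarrow> 'a \<Rightarrow> complex"
  assumes r: "r > 0"
    and meas: "\<And>z. z \<in> ball z0 r \<Longrightarrow> f z \<in> borel_measurable M"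
    and hol: "\<And>t. t \<in> space M \<Longrightarrow> (\<lambda>z. f z t) holomorphic_on ball z0 r"
    and B: "integrable M B" "\<And>z t. z \<in> ball z0 r \<Longrightarrow> t \<in> space M \<Longrightarrow> norm (f z t) \<le> B t"
  shows "((\<lambda>z. \<integral>t. f z t \<partial>M) has_field_derivative (\<integral>t. deriv (\<lambda>z. f z t) z0 \<partial>M)) (at z0)"
  unfolding has_field_derivative_iff tendsto_at_iff_sequentially
proof (intro allI impI)
  fix X :: "nat \<Rightarrow> complex"
  assume X1: "\<forall>i. X i \<in> UNIV - {z0}" and X2: "X \<longlonglongrightarrow> z0"
  have "eventually (\<lambda>n. dist (X n) z0 < r/3) sequentially"
    using X2 r by (intro tendstoD) auto
  then obtain N where N: "\<And>n. n \<ge> N \<Longrightarrow> dist (X n) z0 < r/3"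
    by (auto simp: eventually_sequentially)
  have Xb: "X (n + N) \<in> ball z0 (r/3)" for n using N[of "n+N"] by (auto simp: dist_commute)
  have Xb': "X (n + N) \<in> ball z0 r" for n using Xb[of n] r by auto
  have z0b: "z0 \<in> ball z0 r" using r by auto
  have int: "integrable M (f z)" if "z \<in> ball z0 r" for z
    by (rule Bochner_Integration.integrable_bound[OF B(1) meas[OF that]])
       (use B(2)[OF that] in \<open>auto intro!: AE_I2 intro: order_trans[OF _ abs_ge_self]\<close>)
  \<comment> \<open>Shifting by \<open>N\<close> keeps every point in the disc of radius
    \<open>r/3\<close>, where the quotient bound holds.\<close>
  define q where "q n t = (f (X (n+N)) t - f z0 t) / (X (n+N) - z0)" for n t
  have qlim: "(\<lambda>n. q n t) \<longlonglongrightarrow> deriv (\<lambda>z. f z t) z0" if "t \<in> space M" for t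
  proof -
    have "((\<lambda>z. f z t) has_field_derivative deriv (\<lambda>z. f z t) z0) (at z0)"
      by (rule holomorphic_derivI[OF hol[OF that]]) (use r in auto)
    then have "(\<lambda>n. ((\<lambda>z. (f z t - f z0 t) / (z - z0)) \<circ> X) n) \<longlonglongrightarrow> deriv (\<lambda>z. f z t) z0"
      unfolding has_field_derivative_iff tendsto_at_iff_sequentially using X1 X2 by blast
    from LIMSEQ_ignore_initial_segment[OF this, of N] show ?thesis by (simp add: q_def o_def)
  qed
  have qm: "q n \<in> borel_measurable M" for n
    unfolding q_def[abs_def] using meas[OF Xb'] meas[OF z0b] by measurable
  have "(\<lambda>n. \<integral>t. q n t \<partial>M) \<longlonglongrightarrow> (\<integral>t. deriv (\<lambda>z. f z t) z0 \<partial>M)"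
  proof (rule integral_dominated_convergence[where w = "\<lambda>t. 3 * B t / r"])
    show "(\<lambda>t. deriv (\<lambda>z. f z t) z0) \<in> borel_measurable M"
      by (rule borel_measurable_LIMSEQ_metric[OF qm qlim])
    show "integrable M (\<lambda>t. 3 * B t / r)" using B(1) by auto
    show "AE t in M. (\<lambda>n. q n t) \<longlonglongrightarrow> deriv (\<lambda>z. f z t) z0" using qlim by auto
    show "AE t in M. norm (q n t) \<le> 3 * B t / r" for n
    proof (rule AE_I2)
      fix t assume t: "t \<in> space M"
      have "norm (f (X (n+N)) t - f z0 t) \<le> 3 * B t / r * norm (X (n+N) - z0)"
        by (rule norm_diff_quotient_le[OF hol[OF t] r _ Xb]) (use B(2) t in auto)
      moreover have "norm (X (n+N) - z0) > 0" using X1 by auto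
      ultimately show "norm (q n t) \<le> 3 * B t / r"
        by (simp add: q_def norm_divide divide_le_eq)
    qed
  qed (use qm in auto)
  moreover have "(\<integral>t. q n t \<partial>M) = ((\<integral>t. f (X (n+N)) t \<partial>M) - (\<integral>t. f z0 t \<partial>M)) / (X (n+N) - z0)" for n
    unfolding q_def using int[OF Xb'] int[OF z0b] by simp
  ultimately have "(\<lambda>n. ((\<lambda>z. ((\<integral>t. f z t \<partial>M) - (\<integral>t. f z0 t \<partial>M)) / (z - z0)) \<circ> X) (n + N))
      \<longlonglongrightarrow> (\<integral>t. deriv (\<lambda>z. f z t) z0 \<partial>M)"
    by (simp add: o_def)
  then show "((\<lambda>z. ((\<integral>t. f z t \<partial>M) - (\<integral>t. f z0 t \<partial>M)) / (z - z0)) \<circ> X)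
      \<longlonglongrightarrow> (\<integral>t. deriv (\<lambda>z. f z t) z0 \<partial>M)"
    by (rule LIMSEQ_offset)
qed

section \<open>Lebesgue measure on the positive half-line\<close>

abbreviation Pos :: "real measure" where
  "Pos \<equiv> restrict_space lborel {0<..}"

lemma integral_Pos: "(LINT t:{0<..}|lborel. f t) = integral\<^sup>L Pos (f :: real \<Rightarrow> 'a :: {banach, second_countable_topology})"
  by (simp add: integral_restrict_space set_lebesgue_integral_def)

lemma integrable_Pos: "set_integrable lborel {0<..} f \<longleftrightarrow> integrable Pos (f :: real \<Rightarrow> 'a :: {banach, second_countable_topology})"
  by (simp add: integrable_restrict_space set_integrable_def)

lemma measurable_PosI: "f \<in> borel_measurable borel \<Longrightarrow> f \<in> borel_measurable Pos"
  by (intro measurable_restrict_space1) simp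

lemma space_Pos [simp]: "space Pos = {0<..}"
  by (simp add: space_restrict_space)

lemma AE_PosI: "(\<And>t. t > 0 \<Longrightarrow> P t) \<Longrightarrow> AE t in Pos. P t"
  by (intro AE_I2) auto

lemma integrable_Pos_bound:
  assumes "integrable Pos g" "f \<in> borel_measurable borel" "\<And>t. t > 0 \<Longrightarrow> norm (f t) \<le> g t"
  shows "integrable Pos (f :: real \<Rightarrow> 'a :: {banach, second_countable_topology})"
  by (rule Bochner_Integration.integrable_bound[OF assms(1) measurable_PosI[OF assms(2)]])
     (use assms(3) in \<open>auto intro!: AE_PosI intro: order_trans[OF _ abs_ge_self]\<close>)

lemma integral_Pos_scale:
  fixes f :: "real \<Rightarrow> 'a :: {banach, second_countable_topology}"
  assumes "l > 0"
  shows "integral\<^sup>L Pos (\<lambda>t. f (l * t)) = (1 / l) *\<^sub>R integral\<^sup>L Pos f"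
proof -
  have ind: "indicator {0<..} (l * t) = (indicator {0<..} t :: real)" for t
    using assms by (auto simp: indicator_def zero_less_mult_iff)
  have "integral\<^sup>L Pos f = (\<integral>t. indicator {0<..} t *\<^sub>R f t \<partial>lborel)"
    by (simp add: integral_Pos[symmetric] set_lebesgue_integral_def)
  also have "\<dots> = l *\<^sub>R (\<integral>t. indicator {0<..} (l * t) *\<^sub>R f (l * t) \<partial>lborel)"
    using assms by (subst lborel_integral_real_affine[of l _ 0]) auto
  also have "\<dots> = l *\<^sub>R integral\<^sup>L Pos (\<lambda>t. f (l * t))"
    unfolding ind by (simp add: integral_Pos[symmetric] set_lebesgue_integral_def)
  finally show ?thesis using assms by simp
qed

lemma integrable_Pos_scale:
  fixes f :: "real \<Rightarrow> 'a :: {banach, second_countable_topology}"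
  assumes "l > 0" "integrable Pos f"
  shows "integrable Pos (\<lambda>t. f (l * t))"
proof -
  have ind: "indicator {0<..} (l * t) = (indicator {0<..} t :: real)" for t
    using assms by (auto simp: indicator_def zero_less_mult_iff)
  have "integrable lborel (\<lambda>t. indicator {0<..} t *\<^sub>R f t)"
    using assms(2) by (simp add: integrable_Pos[symmetric] set_integrable_def)
  from lborel_integrable_real_affine[OF this, of l 0] assms(1) show ?thesis
    by (simp add: integrable_Pos[symmetric] set_integrable_def ind)
qed

lemma integrable_Pos_powr_exp:
  assumes "c > -1" "d > 0"
  shows "integrable Pos (\<lambda>t. t powr c * exp (- (d * t)))"
proof -
  have "set_integrable lebesgue {0<..} (\<lambda>t. complex_of_real t powr (of_real (c+1) - 1) / of_real (exp (d * t)))"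
    using absolutely_integrable_Gamma_integral[of "of_real (c+1)" d] assms by simp
  then have "set_integrable lebesgue {0<..} (\<lambda>t. norm (complex_of_real t powr (of_real (c+1) - 1) / of_real (exp (d * t))))"
    by (rule set_integrable_norm)
  also have "?this \<longleftrightarrow> set_integrable lebesgue {0<..} (\<lambda>t. t powr c * exp (- (d * t)))"
    by (rule set_integrable_cong) (auto simp: norm_divide norm_powr_real_powr exp_minus field_simps)
  finally have "integrable lebesgue (\<lambda>t. indicator {0<..} t *\<^sub>R (t powr c * exp (- (d * t))))"
    by (simp add: set_integrable_def)
  then have "integrable lborel (\<lambda>t. indicator {0<..} t *\<^sub>R (t powr c * exp (- (d * t))))"
    by (subst (asm) integrable_completion) auto
  then show ?thesis by (simp add: integrable_Pos[symmetric] set_integrable_def)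
qed

text \<open>As \<open>b < 1\<close>, any multiple of \<open>t powr b\<close> is eventually below a
  small multiple of \<open>t\<close>. Hence \<open>exp(-t)\<close> absorbs
  \<open>exp(t powr b * norm y)\<close>, which makes the integrals entire in
  \<open>y\<close>.\<close>

lemma powr_le_linear_plus_const:
  fixes b :: real
  assumes "0 < b" "b < 1" "e > 0" "M \<ge> 0"
  shows "\<exists>C\<ge>0. \<forall>t>0. M * t powr b \<le> e * t + C"
proof -
  \<comment> \<open>Beyond \<open>T\<close>, \<open>t powr (1 - b)\<close> is at least
    \<open>(M + 1) / e\<close>; the added 1 keeps \<open>T\<close> positive when
    \<open>M = 0\<close>.\<close>
  define T where "T = ((M + 1) / e) powr (1 / (1 - b))"
  have T: "T > 0" using assms by (auto simp: T_def)
  have "M * t powr b \<le> e * t + M * T powr b" if t: "t > 0" for t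
  proof (cases "t \<le> T")
    case True
    then have "t powr b \<le> T powr b" using t assms by (intro powr_mono2) auto
    then have "M * t powr b \<le> M * T powr b" using assms by (intro mult_left_mono) auto
    then show ?thesis using t assms by (simp add: add_increasing)
  next
    case False
    have "T powr (1 - b) = (M + 1) / e" using assms by (simp add: T_def powr_powr)
    moreover have "T powr (1 - b) \<le> t powr (1 - b)" using False T assms by (intro powr_mono2) auto
    ultimately have "(M + 1) / e \<le> t powr (1 - b)" by simp
    then have "M + 1 \<le> e * t powr (1 - b)" using assms by (simp add: divide_le_eq mult.commute)
    then have "M \<le> e * t powr (1 - b)" by simp
    then have "M * t powr b \<le> e * t powr (1 - b) * t powr b" by (intro mult_right_mono) auto
    also have "\<dots> = e * t" using t by (simp add: mult.assoc powr_add[symmetric])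
    finally show ?thesis using mult_nonneg_nonneg[OF assms(4), of "T powr b"] by simp
  qed
  then show ?thesis using assms T by (intro exI[of _ "M * T powr b"]) auto
qed

lemma integrable_Pos_powr_exp_powr:
  assumes "c > -1" "d > 0" "b > 0"
  shows "integrable Pos (\<lambda>t. t powr c * exp (- (d * t powr b)))"
proof -
  have 1: "integrable Pos (\<lambda>t. exp 1 * (t powr c * exp (- (1 * t))) :: real)"
    using integrable_Pos_powr_exp[of c 1] assms by simp
  have Ioi: "einterval 0 \<infinity> = {0<..}" by (auto simp: einterval_def)
  have 2: "integrable Pos (\<lambda>t. inverse (1 + t\<^sup>2) :: real)"
    using integrable_I0i_1_div_plus_square Ioi
    by (simp add: integrable_Pos[symmetric] interval_lebesgue_integrable_def inverse_eq_divide)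
  \<comment> \<open>With this power \<open>(t powr b) powr k\<close> equals
    \<open>t powr (c + 2)\<close>, so that the integrable \<open>1 / t^2\<close> is left after
    multiplication by \<open>t powr c\<close>.\<close>
  define k where "k = (c + 2) / b"
  have k: "k > 0" using assms by (simp add: k_def)
  have "((\<lambda>x::real. x powr k * exp (- x)) \<longlongrightarrow> 0) at_top"
    by real_asymp
  then have "eventually (\<lambda>x::real. x powr k * exp (- x) < 1) at_top"
    by (rule order_tendstoD) simp
  then obtain x0 where x0: "\<And>x. x \<ge> x0 \<Longrightarrow> x powr k * exp (- x) < 1"
    by (auto simp: eventually_at_top_linorder)
  define C where "C = max 1 ((max x0 0) powr k)"
  have C: "x powr k * exp (- x) \<le> C" if "x > 0" for x
  proof (cases "x \<ge> x0")
    case True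
    then show ?thesis using x0[OF True] by (simp add: C_def)
  next
    case False
    have "x powr k * exp (- x) \<le> x powr k * 1" using that by (intro mult_left_mono) auto
    also have "\<dots> \<le> (max x0 0) powr k" using that k False by (simp, intro powr_mono2) auto
    finally show ?thesis by (simp add: C_def)
  qed
  have C1: "C \<ge> 1" by (simp add: C_def)
  define D where "D = 2 * C * d powr (- k)"
  have D: "D > 0" using assms C1 by (simp add: D_def)
  show ?thesis
  proof (rule integrable_Pos_bound)
    \<comment> \<open>The first summand dominates on \<open>t \<le> 1\<close>, where
      \<open>exp (1 - t) \<ge> 1\<close>; the second dominates beyond.\<close>
    show "integrable Pos (\<lambda>t. exp 1 * (t powr c * exp (- (1 * t))) + D * inverse (1 + t\<^sup>2))"
      using 1 2 by auto
    fix t :: real assume t: "t > 0"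
    show "norm (t powr c * exp (- (d * t powr b))) \<le> exp 1 * (t powr c * exp (- (1 * t))) + D * inverse (1 + t\<^sup>2)"
    proof (cases "t \<le> 1")
      case True
      have "t powr c * exp (- (d * t powr b)) \<le> t powr c * exp (1 - t)"
        using True t assms by (intro mult_left_mono) (auto intro: order_trans[of _ 0])
      also have "\<dots> = exp 1 * (t powr c * exp (- (1 * t)))" by (simp add: exp_diff exp_minus field_simps)
      finally show ?thesis using D by (simp add: add_increasing2)
    next
      case False
      have "(d * t powr b) powr k * exp (- (d * t powr b)) \<le> C"
        using t assms by (intro C) auto
      then have "exp (- (d * t powr b)) \<le> C / (d * t powr b) powr k"
        using t assms by (simp add: field_simps)
      also have "(d * t powr b) powr k = d powr k * t powr (c + 2)"
        using t assms by (simp add: powr_mult powr_powr k_def)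
      finally have "t powr c * exp (- (d * t powr b)) \<le> t powr c * (C / (d powr k * t powr (c + 2)))"
        by (intro mult_left_mono) auto
      also have "\<dots> = C * d powr (-k) / t\<^sup>2"
        using t by (simp add: powr_add powr_minus field_simps)
      also have "\<dots> \<le> 2 * C * d powr (-k) / (1 + t\<^sup>2)"
      proof -
        have "1 \<le> t\<^sup>2" using False by (simp add: one_le_power)
        then have "1 / t\<^sup>2 \<le> 2 / (1 + t\<^sup>2)" using t by (simp add: field_simps)
        then have "C * d powr (-k) * (1 / t\<^sup>2) \<le> C * d powr (-k) * (2 / (1 + t\<^sup>2))"
          using C1 by (intro mult_left_mono) auto
        then show ?thesis by (simp add: mult_ac)
      qed
      finally show ?thesis using t D by (simp add: D_def divide_inverse add_increasing)
    qed
  qed auto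
qed

section \<open>Stable-type Laplace integrals\<close>

lemma islimpt_of_real_image:
  assumes "x islimpt A"
  shows "complex_of_real x islimpt complex_of_real ` A"
  by (rule islimpt_isCont_image[OF assms]) (auto simp: eventually_at_filter intro!: isCont_of_real)

text \<open>With \<open>l = 1\<close> and \<open>b = \<alpha>/2\<close>, the choices
  \<open>c = b - 1\<close>, \<open>c = 0\<close> and \<open>c = b\<close> give \<open>g\<close>,
  \<open>h\<close> and \<open>- h'\<close>; differentiation in \<open>y\<close> moves
  \<open>c\<close> to \<open>c + b\<close>. The complex rate \<open>l\<close> is the parameter of
  the contour rotation.\<close>

definition stable_kernel :: "real \<Rightarrow> real \<Rightarrow> complex \<Rightarrow> complex \<Rightarrow> real \<Rightarrow> complex" where
  "stable_kernel b c l y t = of_real (t powr c) * exp (- (l * of_real t)) * exp (- (of_real (t powr b) * y))"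

definition stable_integral :: "real \<Rightarrow> real \<Rightarrow> complex \<Rightarrow> complex \<Rightarrow> complex" where
  "stable_integral b c l y = integral\<^sup>L Pos (stable_kernel b c l y)"

lemma g_stable_eq: "g_stable \<alpha> = stable_integral (\<alpha>/2) (\<alpha>/2 - 1) 1"
  unfolding g_stable_def stable_integral_def integral_Pos stable_kernel_def
  by (simp add: fun_eq_iff exp_of_real flip: of_real_minus)

lemma h_stable_eq: "h_stable \<alpha> = stable_integral (\<alpha>/2) 0 1"
proof
  fix y
  have "integral\<^sup>L Pos (stable_kernel (\<alpha>/2) 0 1 y) =
    integral\<^sup>L Pos (\<lambda>t. complex_of_real (exp (- t)) * exp (- (complex_of_real (t powr (\<alpha> / 2)) * y)))"
    by (rule Bochner_Integration.integral_cong) (auto simp: stable_kernel_def exp_of_real simp flip: of_real_minus)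
  then show "h_stable \<alpha> y = stable_integral (\<alpha>/2) 0 1 y"
    unfolding h_stable_def stable_integral_def integral_Pos by simp
qed

lemma norm_stable_kernel:
  "norm (stable_kernel b c l y t) = t powr c * exp (- (Re l * t)) * exp (- (t powr b * Re y))"
  by (simp add: stable_kernel_def norm_mult)

lemma measurable_stable_kernel [measurable]: "stable_kernel b c l y \<in> borel_measurable borel"
  unfolding stable_kernel_def[abs_def] by measurable

lemma measurable_stable_kernel_Pos: "stable_kernel b c l y \<in> borel_measurable Pos"
  by (rule measurable_PosI) measurable

text \<open>Half of the decay rate \<open>d\<close> pays for \<open>exp(t powr b * M)\<close>, the
  other half remains. The constant is uniform in \<open>l\<close> and \<open>y\<close>, as
  differentiation under the integral in either variable requires.\<close>

lemma stable_kernel_dominated: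
  assumes b: "0 < b" "b < 1" and d: "d > 0" and M: "M \<ge> 0"
  shows "\<exists>C\<ge>0. \<forall>l y t. Re l \<ge> d \<longrightarrow> norm y \<le> M \<longrightarrow> t > 0 \<longrightarrow>
    norm (stable_kernel b c l y t) \<le> C * (t powr c * exp (- (d/2 * t)))"
proof -
  obtain C where C: "C \<ge> 0" "\<And>t. t > 0 \<Longrightarrow> M * t powr b \<le> d/2 * t + C"
    using powr_le_linear_plus_const[OF b, of "d/2" M] d M by auto
  have "norm (stable_kernel b c l y t) \<le> exp C * (t powr c * exp (- (d/2 * t)))"
    if "Re l \<ge> d" "norm y \<le> M" "t > 0" for l y t
  proof -
    have "- Re y \<le> M" using that(2) abs_Re_le_cmod[of y] by linarith
    then have "t powr b * (- Re y) \<le> t powr b * M" by (intro mult_left_mono) auto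
    then have "- (t powr b * Re y) \<le> d/2 * t + C" using C(2)[OF that(3)] by (simp add: mult.commute)
    moreover have "- (Re l * t) \<le> - (d * t)" using that by simp
    ultimately have "- (Re l * t) + - (t powr b * Re y) \<le> C + - (d/2*t)" by simp
    then have "exp (- (Re l * t)) * exp (- (t powr b * Re y)) \<le> exp C * exp (- (d/2*t))"
      by (simp add: exp_add[symmetric])
    from mult_left_mono[OF this, of "t powr c"] show ?thesis
      unfolding norm_stable_kernel by (simp add: mult_ac)
  qed
  then show ?thesis by (intro exI[of _ "exp C"]) auto
qed

context
  fixes b c :: real
  assumes b: "0 < b" "b < 1" and c: "c > -1"
begin

lemma integrable_stable_kernel:
  assumes "Re l > 0"
  shows "integrable Pos (stable_kernel b c l y)"
proof -
  obtain C where C: "\<And>l' y' t. Re l' \<ge> Re l \<Longrightarrow> norm y' \<le> norm y \<Longrightarrow> t > 0 \<Longrightarrow>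
    norm (stable_kernel b c l' y' t) \<le> C * (t powr c * exp (- (Re l/2 * t)))"
    using stable_kernel_dominated[OF b assms, of "norm y" c] by auto
  show ?thesis
    by (rule integrable_Pos_bound[OF _ measurable_stable_kernel C])
       (use integrable_Pos_powr_exp[OF c, of "Re l/2"] assms in auto)
qed

lemma stable_integral_has_field_derivative:
  assumes l: "Re l > 0"
  shows "(stable_integral b c l has_field_derivative - stable_integral b (c + b) l y) (at y)"
proof -
  obtain C where C: "\<And>l' y' t. Re l' \<ge> Re l \<Longrightarrow> norm y' \<le> norm y + 1 \<Longrightarrow> t > 0 \<Longrightarrow>
    norm (stable_kernel b c l' y' t) \<le> C * (t powr c * exp (- (Re l/2 * t)))"
    using stable_kernel_dominated[OF b l, of "norm y + 1" c] by auto
  have hol: "((\<lambda>y. stable_kernel b c l y t) has_field_derivative - stable_kernel b (c+b) l y t) (at y)" for t y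
    unfolding stable_kernel_def by (auto intro!: derivative_eq_intros simp: powr_add)
  have "((\<lambda>y. integral\<^sup>L Pos (stable_kernel b c l y)) has_field_derivative
      (\<integral>t. deriv (\<lambda>y. stable_kernel b c l y t) y \<partial>Pos)) (at y)"
  proof (rule has_field_derivative_lebesgue_integral[where r = 1])
    show "integrable Pos (\<lambda>t. C * (t powr c * exp (- (Re l/2 * t))))"
      using integrable_Pos_powr_exp[OF c, of "Re l/2"] l by auto
    show "norm (stable_kernel b c l z t) \<le> C * (t powr c * exp (- (Re l/2 * t)))"
      if "z \<in> ball y 1" "t \<in> space Pos" for z t
    proof (rule C)
      show "norm z \<le> norm y + 1"
        using that(1) norm_triangle_ineq2[of z y] by (simp add: dist_norm norm_minus_commute)
    qed (use that in auto)
    show "(\<lambda>z. stable_kernel b c l z t) holomorphic_on ball y 1" for t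
      using hol by (intro holomorphic_onI) (meson field_differentiable_def field_differentiable_at_within)
  qed (use measurable_stable_kernel_Pos in auto)
  also have "(\<lambda>t. deriv (\<lambda>y. stable_kernel b c l y t) y) = (\<lambda>t. - stable_kernel b (c+b) l y t)"
    using hol by (intro ext DERIV_imp_deriv)
  finally show ?thesis unfolding stable_integral_def[abs_def] by simp
qed

lemma stable_integral_holomorphic: "Re l > 0 \<Longrightarrow> stable_integral b c l holomorphic_on A"
  using stable_integral_has_field_derivative
  by (intro holomorphic_onI) (meson field_differentiable_def field_differentiable_at_within)

lemma stable_integral_continuous: "Re l > 0 \<Longrightarrow> continuous_on A (stable_integral b c l)"
  by (intro holomorphic_on_imp_continuous_on stable_integral_holomorphic)

text \<open>
  Rotation of the contour \<open>(0,\<infinity>)\<close> to the ray through \<open>l\<close>: for \<open>l > 0\<close> this is a change of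
  variables, and both sides are analytic in \<open>l\<close>.
\<close>

lemma stable_integral_rotate:
  assumes l: "Re l > 0"
  shows "l powr of_real (c + 1) * stable_integral b c l (l powr of_real b * y) = stable_integral b c 1 y"
proof -
  define S where "S = {l. Re l > 0}"
  have S: "open S" "connected S"
    unfolding S_def by (auto simp: open_halfspace_Re_gt intro!: convex_connected convex_halfspace_Re_gt)
  have nonpos: "l \<notin> \<real>\<^sub>\<le>\<^sub>0" if "l \<in> S" for l
    using that by (auto simp: S_def complex_nonpos_Reals_iff)
  define F where "F l = stable_integral b c l (l powr of_real b * y)" for l
  have F: "F holomorphic_on S"
  proof (rule holomorphic_onI)
    fix l0 assume l0: "l0 \<in> S"
    define r where "r = Re l0 / 2"
    have r: "r > 0" using l0 by (simp add: r_def S_def)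
    have Re: "Re l \<ge> r" if "l \<in> cball l0 r" for l
    proof -
      have "\<bar>Re l0 - Re l\<bar> \<le> r" using abs_Re_le_cmod[of "l0 - l"] that by (simp add: dist_norm)
      then show ?thesis using r_def by linarith
    qed
    have sub: "cball l0 r \<subseteq> S" using Re r by (force simp: S_def)
    have "continuous_on (cball l0 r) (\<lambda>l. l powr of_real b * y)"
      using sub nonpos by (intro holomorphic_on_imp_continuous_on holomorphic_intros) blast
    from compact_imp_bounded[OF compact_continuous_image[OF this compact_cball]]
    obtain M where M: "M > 0" "\<And>l. l \<in> cball l0 r \<Longrightarrow> norm (l powr of_real b * y) \<le> M"
      by (auto simp: bounded_pos)
    obtain C where C: "\<And>l' y' t. Re l' \<ge> r \<Longrightarrow> norm y' \<le> M \<Longrightarrow> t > 0 \<Longrightarrow>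
      norm (stable_kernel b c l' y' t) \<le> C * (t powr c * exp (- (r/2 * t)))"
      using stable_kernel_dominated[OF b r less_imp_le[OF M(1)], of c] by blast
    have "((\<lambda>l. integral\<^sup>L Pos (stable_kernel b c l (l powr of_real b * y))) has_field_derivative
      (\<integral>t. deriv (\<lambda>l. stable_kernel b c l (l powr of_real b * y) t) l0 \<partial>Pos)) (at l0)"
    proof (rule has_field_derivative_lebesgue_integral[OF r])
      show "integrable Pos (\<lambda>t. C * (t powr c * exp (- (r/2 * t))))"
        using integrable_Pos_powr_exp[OF c, of "r/2"] r by auto
      show "norm (stable_kernel b c l (l powr of_real b * y) t) \<le> C * (t powr c * exp (- (r/2 * t)))"
        if "l \<in> ball l0 r" "t \<in> space Pos" for l t
        using that by (intro C Re M) auto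
      show "(\<lambda>l. stable_kernel b c l (l powr of_real b * y) t) holomorphic_on ball l0 r" for t
        unfolding stable_kernel_def using sub nonpos ball_subset_cball
        by (intro holomorphic_intros) blast
    qed (use measurable_stable_kernel_Pos in auto)
    then show "F field_differentiable at l0 within S"
      unfolding F_def[abs_def] stable_integral_def field_differentiable_def
      by (meson has_field_derivative_at_within)
  qed
  have G: "(\<lambda>l. l powr of_real (c+1) * F l - stable_integral b c 1 y) holomorphic_on S"
    using F nonpos by (intro holomorphic_intros) auto
  have pos: "of_real x powr of_real (c+1) * F (of_real x) = stable_integral b c 1 y" if x: "x > 0" for x :: real
  proof -
    have "integral\<^sup>L Pos (\<lambda>t. stable_kernel b c 1 y (x * t)) = (1/x) *\<^sub>R stable_integral b c 1 y"
      unfolding stable_integral_def by (rule integral_Pos_scale[OF x])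
    moreover have "integral\<^sup>L Pos (\<lambda>t. stable_kernel b c 1 y (x * t)) =
      integral\<^sup>L Pos (\<lambda>t. of_real (x powr c) * stable_kernel b c (of_real x) (of_real x powr of_real b * y) t)"
      by (rule Bochner_Integration.integral_cong)
         (use x in \<open>auto simp: stable_kernel_def powr_mult powr_of_real mult_ac\<close>)
    ultimately have "of_real (x powr c) * F (of_real x) = (1/x) *\<^sub>R stable_integral b c 1 y"
      by (simp add: F_def stable_integral_def)
    then have "of_real x * (of_real (x powr c) * F (of_real x)) = stable_integral b c 1 y"
      using x by (simp add: scaleR_conv_of_real)
    moreover have "of_real x * complex_of_real (x powr c) = of_real x powr of_real (c+1)"
      using x by (simp only: powr_of_real[OF less_imp_le[OF x]] of_real_mult[symmetric])
         (simp add: powr_add)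
    ultimately show ?thesis by (simp add: mult.assoc[symmetric])
  qed
  have "l powr of_real (c+1) * F l - stable_integral b c 1 y = 0"
  proof (rule analytic_continuation[OF G S, of "of_real ` {0<..<2}" 1])
    show "1 islimpt complex_of_real ` {0<..<2}"
      using islimpt_of_real_image[of 1 "{0<..<2::real}"] by (simp add: open_imp_islimpt)
  qed (use l pos in \<open>auto simp: S_def\<close>)
  then show ?thesis by (simp add: F_def)
qed

end

section \<open>Bounds on the sector\<close>

lemma stable_integral_cnj: "stable_integral b c 1 (cnj y) = cnj (stable_integral b c 1 y)"
proof -
  have "stable_kernel b c 1 (cnj y) = (\<lambda>t. cnj (stable_kernel b c 1 y t))"
    by (simp add: stable_kernel_def fun_eq_iff exp_cnj)
  then show ?thesis by (simp add: stable_integral_def)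
qed

definition sector :: "real \<Rightarrow> complex set" where
  "sector b = {y. y = 0 \<or> \<bar>Arg y\<bar> \<le> b * pi}"

lemma K_stable_eq_sector:
  assumes "0 < \<alpha>" "\<alpha> < 2"
  shows "K_stable \<alpha> = sector (\<alpha> / 2)"
proof (intro set_eqI iffI)
  fix y assume "y \<in> K_stable \<alpha>"
  then obtain R \<theta> where R: "y = rcis R \<theta>" "\<bar>\<theta>\<bar> \<le> \<alpha> * pi / 2" "R \<ge> 0"
    by (auto simp: K_stable_def)
  show "y \<in> sector (\<alpha>/2)"
  proof (cases "R = 0")
    case False
    have "\<alpha> * pi / 2 < pi" using assms by simp
    then have "\<theta> \<in> {-pi<..pi}" using R(2) unfolding greaterThanAtMost_iff by linarith
    then have "Arg y = \<theta>" using R False unfolding R(1) by (intro Arg_rcis) auto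
    then show ?thesis using R by (simp add: sector_def)
  qed (use R in \<open>auto simp: sector_def\<close>)
next
  fix y assume "y \<in> sector (\<alpha>/2)"
  then consider "y = 0" | "\<bar>Arg y\<bar> \<le> \<alpha> / 2 * pi" by (auto simp: sector_def)
  then show "y \<in> K_stable \<alpha>"
  proof cases
    case 1
    then show ?thesis using assms by (auto simp: K_stable_def intro!: exI[of _ 0])
  next
    case 2
    then show ?thesis unfolding K_stable_def mem_Collect_eq
      by (rule_tac exI[of _ "cmod y"], rule_tac exI[of _ "Arg y"]) (auto simp: rcis_cmod_Arg)
  qed
qed

lemma sector_cnj: "b < 1 \<Longrightarrow> cnj y \<in> sector b \<longleftrightarrow> y \<in> sector b"
  by (auto simp: sector_def Arg_cnj)

lemma cis_powr: "\<bar>x\<bar> < pi \<Longrightarrow> cis x powr of_real a = cis (a * x)"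
  by (simp add: powr_def Ln_cis cis_conv_exp mult_ac)

lemma cos_ge_cos_of_abs_le: "\<bar>x\<bar> \<le> w \<Longrightarrow> w \<le> pi \<Longrightarrow> cos w \<le> cos x"
  using cos_monotone_0_pi_le[of "\<bar>x\<bar>" w] by simp

context
  fixes b c :: real
  assumes b: "0 < b" "b < 1" and c: "c > -1"
begin

text \<open>For \<open>b > 1/2\<close> the sector contains points of negative real part, so the ray
  is first turned by the angle \<open>-(pi/2 - e)\<close>. Then \<open>exp(-l t)\<close> still
  decays at rate \<open>d\<close>, while \<open>l^b y\<close> has argument at most
  \<open>w < pi/2\<close> in modulus and yields decay \<open>k R t^b\<close>. Keeping only the first
  gives the uniform bound; keeping only the second and rescaling gives the power of
  \<open>norm y\<close>. The lower half of the sector follows by conjugation.\<close>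

lemma stable_integral_sector_bound:
  "\<exists>C>0. \<forall>y\<in>sector b. norm (stable_integral b c 1 y) \<le> C \<and>
     (y \<noteq> 0 \<longrightarrow> norm (stable_integral b c 1 y) \<le> C * norm y powr (- ((c + 1) / b)))"
proof -
  \<comment> \<open>Small enough that \<open>w = b * (pi/2 + e)\<close> stays below
    \<open>pi/2\<close>: the gap is \<open>pi/4 * (1 - b) * (2 - b)\<close>.\<close>
  define e where "e = pi / 4 * (1 - b)"
  define w where "w = b * (pi / 2 + e)"
  have e: "0 < e" "e < pi / 4" using b by (auto simp: e_def)
  have w: "0 < w" "w < pi / 2"
  proof -
    have "pi / 2 - w = pi / 4 * ((1 - b) * (2 - b))" by (simp add: w_def e_def field_simps)
    also have "\<dots> > 0" using b by simp
    finally show "w < pi / 2" by simp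
  qed (use b e in \<open>simp add: w_def add_pos_pos\<close>)
  define k where "k = cos w"
  have k: "k > 0" using w by (simp add: k_def cos_gt_zero)
  define d where "d = cos (pi / 2 - e)"
  have d: "d > 0" unfolding d_def using e by (intro cos_gt_zero) auto
  define C1 where "C1 = integral\<^sup>L Pos (\<lambda>t. t powr c * exp (- (d * t)))"
  define C2 where "C2 = integral\<^sup>L Pos (\<lambda>t. t powr c * exp (- (k * t powr b)))"
  have i1: "integrable Pos (\<lambda>t. t powr c * exp (- (d * t)))" by (rule integrable_Pos_powr_exp[OF c d])
  have i2: "integrable Pos (\<lambda>t. t powr c * exp (- (k * t powr b)))"
    by (rule integrable_Pos_powr_exp_powr[OF c k b(1)])
  have upper: "norm (stable_integral b c 1 y) \<le> C1 \<and>
     (y \<noteq> 0 \<longrightarrow> norm (stable_integral b c 1 y) \<le> C2 * norm y powr (- ((c + 1) / b)))"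
    if y: "y = rcis R \<theta>" "0 \<le> \<theta>" "\<theta> \<le> b * pi" "R \<ge> 0" for y R \<theta>
  proof -
    define l where "l = cis (- (pi / 2 - e))"
    have Rel: "Re l = d" unfolding l_def d_def cis.sel cos_minus ..
    have lb: "l powr of_real b = cis (- (b * (pi / 2 - e)))"
    proof -
      have "\<bar>- (pi / 2 - e)\<bar> < pi" using e by linarith
      then show ?thesis unfolding l_def by (simp only: cis_powr mult_minus_right)
    qed
    have "l powr of_real b * y = rcis R (\<theta> - b * (pi / 2 - e))"
      unfolding lb y(1) by (simp add: rcis_def cis_mult)
    moreover have "cos (\<theta> - b * (pi / 2 - e)) \<ge> k"
      unfolding k_def
    proof (rule cos_ge_cos_of_abs_le)
      have "\<theta> - b * (pi / 2 - e) \<le> w" using y(3) by (simp add: w_def algebra_simps)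
      moreover have "- w \<le> \<theta> - b * (pi / 2 - e)"
        using y(2) b e by (simp add: w_def algebra_simps)
      ultimately show "\<bar>\<theta> - b * (pi / 2 - e)\<bar> \<le> w" by simp
    qed (use w in auto)
    ultimately have Re: "Re (l powr of_real b * y) \<ge> k * R"
      using y(4) by (simp add: mult.commute mult_left_mono)
    have nl: "norm (l powr of_real (c+1)) = 1"
      using e by (simp add: l_def norm_powr_real_powr' cis_powr)
    have eq: "norm (stable_integral b c 1 y) = norm (stable_integral b c l (l powr of_real b * y))"
      using stable_integral_rotate[OF b c, of l y] d nl
      by (metis Rel mult_1 norm_mult)
    let ?I = "\<lambda>t. norm (stable_kernel b c l (l powr of_real b * y) t)"
    have int: "integrable Pos ?I"
      using integrable_stable_kernel[OF b c, of l] d Rel by simp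
    have le: "norm (stable_integral b c 1 y) \<le> integral\<^sup>L Pos ?I"
      unfolding eq unfolding stable_integral_def by (rule integral_norm_bound)
    have kr: "?I t \<le> t powr c * (exp (- (d * t)) * exp (- (k * R * t powr b)))" if "t > 0" for t
    proof -
      have "t powr b * (k * R) \<le> t powr b * Re (l powr of_real b * y)"
        using Re by (intro mult_left_mono) auto
      then have "exp (- (t powr b * Re (l powr of_real b * y))) \<le> exp (- (k * R * t powr b))"
        by (simp add: mult_ac)
      then show ?thesis unfolding norm_stable_kernel Rel
        by (simp add: mult.assoc mult_left_mono)
    qed
    have "integral\<^sup>L Pos ?I \<le> C1"
      unfolding C1_def
    proof (rule integral_mono[OF int i1])
      fix t assume "t \<in> space Pos"
      then have t: "t > 0" by simp
      have "exp (- (d * t)) * exp (- (k * R * t powr b)) \<le> exp (- (d * t)) * 1"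
        using k y(4) by (intro mult_left_mono) auto
      then show "?I t \<le> t powr c * exp (- (d * t))"
        using kr[OF t] by (smt (verit) mult_left_mono powr_ge_zero mult_1_right)
    qed
    moreover have "integral\<^sup>L Pos ?I \<le> C2 * norm y powr (- ((c + 1) / b))" if "y \<noteq> 0"
    proof -
      have R: "R > 0" "norm y = R" using that y by auto
      \<comment> \<open>The scale that turns \<open>R * t powr b\<close> into
        \<open>(r * t) powr b\<close>.\<close>
      define r where "r = R powr (1 / b)"
      have r: "r > 0" using R by (simp add: r_def)
      have "integral\<^sup>L Pos ?I \<le> integral\<^sup>L Pos (\<lambda>t. r powr (-c) * ((r * t) powr c * exp (- (k * (r * t) powr b))))"
      proof (rule integral_mono[OF int])
        show "integrable Pos (\<lambda>t. r powr (-c) * ((r * t) powr c * exp (- (k * (r * t) powr b))))"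
          using integrable_Pos_scale[OF r i2] by simp
        fix t assume "t \<in> space Pos"
        then have t: "t > 0" by simp
        have "exp (- (d * t)) * exp (- (k * R * t powr b)) \<le> 1 * exp (- (k * R * t powr b))"
          using t d by (intro mult_right_mono) auto
        then have "?I t \<le> t powr c * exp (- (k * R * t powr b))"
          using kr[OF t] by (smt (verit) mult_left_mono powr_ge_zero mult_1_left)
        also have "R * t powr b = (r * t) powr b"
          using R t b by (simp add: r_def powr_mult powr_powr)
        then have "t powr c * exp (- (k * R * t powr b)) = r powr (-c) * ((r * t) powr c * exp (- (k * (r * t) powr b)))"
          using r t by (simp add: powr_mult powr_minus mult.assoc)
        finally show "?I t \<le> r powr (-c) * ((r * t) powr c * exp (- (k * (r * t) powr b)))" .
      qed
      also have "\<dots> = r powr (-c) * ((1/r) * C2)"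
        using integral_Pos_scale[OF r, of "\<lambda>t. t powr c * exp (- (k * t powr b))"] by (simp add: C2_def)
      also have "\<dots> = C2 * r powr (- (c + 1))"
        using r by (simp add: powr_diff powr_minus field_simps powr_add)
      also have "r powr (- (c + 1)) = norm y powr (- ((c + 1) / b))"
        by (simp only: R(2) r_def powr_powr times_divide_eq_left mult_1 minus_divide_left)
      finally show ?thesis .
    qed
    ultimately show ?thesis using le by auto
  qed
  define C where "C = max 1 (max C1 C2)"
  have fin: "norm (stable_integral b c 1 y) \<le> C \<and>
     (y \<noteq> 0 \<longrightarrow> norm (stable_integral b c 1 y) \<le> C * norm y powr (- ((c + 1) / b)))"
    if "norm (stable_integral b c 1 y) \<le> C1 \<and>
     (y \<noteq> 0 \<longrightarrow> norm (stable_integral b c 1 y) \<le> C2 * norm y powr (- ((c + 1) / b)))" for y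
  proof -
    have "C2 * norm y powr (- ((c + 1) / b)) \<le> C * norm y powr (- ((c + 1) / b))"
      by (intro mult_right_mono) (auto simp: C_def)
    moreover have "C1 \<le> C" by (simp add: C_def)
    ultimately show ?thesis using that by (meson order_trans)
  qed
  have "norm (stable_integral b c 1 y) \<le> C \<and>
     (y \<noteq> 0 \<longrightarrow> norm (stable_integral b c 1 y) \<le> C * norm y powr (- ((c + 1) / b)))"
    if y: "y \<in> sector b" for y
  proof (cases "Arg y \<ge> 0")
    case True
    have "y = rcis (norm y) (Arg y)" by (simp add: rcis_cmod_Arg)
    moreover have "Arg y \<le> b * pi" using y b by (auto simp: sector_def Arg_zero)
    ultimately show ?thesis using True by (intro fin upper[of y "norm y" "Arg y"]) auto
  next
    case False
    have "cnj y = rcis (norm y) (- Arg y)"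
      by (metis rcis_cmod_Arg rcis_cnj)
    moreover have "- Arg y \<le> b * pi" using y b by (auto simp: sector_def Arg_zero)
    ultimately have "norm (stable_integral b c 1 (cnj y)) \<le> C \<and>
     (cnj y \<noteq> 0 \<longrightarrow> norm (stable_integral b c 1 (cnj y)) \<le> C * norm (cnj y) powr (- ((c + 1) / b)))"
      using False by (intro fin upper[of "cnj y" "norm y" "- Arg y"]) auto
    then show ?thesis by (simp add: stable_integral_cnj)
  qed
  then show ?thesis by (intro exI[of _ C]) (auto simp: C_def)
qed

text \<open>The integrand is strictly positive. This supplies \<open>g 0 \<noteq> 0\<close>,
  \<open>h'(0) \<noteq> 0\<close> and the positivity of \<open>g\<close> on the nonnegative
  reals.\<close>

lemma stable_integral_pos:
  assumes "y \<ge> 0"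
  shows "\<exists>x>0. stable_integral b c 1 (of_real y) = of_real x"
proof -
  let ?f = "\<lambda>t. t powr c * exp (- t) * exp (- (t powr b * y))"
  have eq: "stable_kernel b c 1 (of_real y) = (\<lambda>t. of_real (?f t))"
    by (simp add: stable_kernel_def fun_eq_iff exp_of_real flip: of_real_minus of_real_mult)
  have int: "integrable Pos ?f"
    using integrable_stable_kernel[OF b c, of 1 "of_real y"]
    unfolding eq complex_of_real_integrable_eq by simp
  have "integral\<^sup>L Pos ?f \<noteq> 0"
  proof
    assume "integral\<^sup>L Pos ?f = 0"
    then have "AE t in Pos. ?f t = 0"
      by (subst (asm) integral_nonneg_eq_0_iff_AE[OF int]) (auto intro!: AE_PosI)
    then have "AE t in lborel. t \<in> {0<..} \<longrightarrow> ?f t = 0"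
      by (subst (asm) AE_restrict_space_iff) auto
    then have "AE t in lborel. t \<notin> {0<..<1::real}" by (rule AE_mp) auto
    then have "emeasure lborel {0<..<1::real} = 0"
      by (subst (asm) AE_iff_measurable[of "{0<..<1::real}"]) auto
    then show False by simp
  qed
  moreover have "integral\<^sup>L Pos ?f \<ge> 0" by (rule Bochner_Integration.integral_nonneg) auto
  ultimately show ?thesis unfolding stable_integral_def eq integral_complex_of_real
    by (intro exI[of _ "integral\<^sup>L Pos ?f"]) (simp add: less_le)
qed

end

lemma isCont_stable_kernel: "t > 0 \<Longrightarrow> isCont (stable_kernel b c l y) t"
  unfolding stable_kernel_def[abs_def] by (intro continuous_intros) auto

text \<open>The function \<open>exp(-t - t^b y)\<close> goes from 1 at 0 to 0 at infinity, and its
  derivative is minus the sum of the kernel for \<open>c = 0\<close> and \<open>b y\<close> times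
  the kernel for \<open>c = b - 1\<close>.\<close>

lemma stable_integral_by_parts:
  assumes b: "0 < b" "b < 1"
  shows "stable_integral b 0 1 y = 1 - of_real b * y * stable_integral b (b - 1) 1 y"
proof -
  define F where "F t = exp (- (of_real t)) * exp (- (of_real (t powr b) * y))" for t :: real
  define f where "f t = - (stable_kernel b 0 1 y t + of_real b * y * stable_kernel b (b-1) 1 y t)" for t :: real
  have Ioi: "einterval 0 \<infinity> = {0<..}" by (auto simp: einterval_def)
  have der: "(F has_vector_derivative f t) (at t)" if "t > 0" for t
  proof -
    have "((\<lambda>t. t powr b) has_real_derivative b * t powr (b - 1)) (at t)"
      using that by (auto intro!: derivative_eq_intros)
    then have "((\<lambda>t. complex_of_real (t powr b)) has_vector_derivative of_real (b * t powr (b - 1))) (at t)"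
      by (intro bounded_linear.has_vector_derivative[OF bounded_linear_of_real])
         (simp add: has_real_derivative_iff_has_vector_derivative)
    then have "((\<lambda>t. - (of_real t + of_real (t powr b) * y)) has_vector_derivative
        - (1 + of_real (b * t powr (b - 1)) * y)) (at t)"
      using that by (auto intro!: derivative_eq_intros)
    then have "(exp \<circ> (\<lambda>t. - (of_real t + of_real (t powr b) * y)) has_vector_derivative
        - (1 + of_real (b * t powr (b - 1)) * y) * exp (- (of_real t + of_real (t powr b) * y))) (at t)"
      by (rule field_vector_diff_chain_at) (rule DERIV_exp)
    also have "exp \<circ> (\<lambda>t. - (of_real t + of_real (t powr b) * y)) = F"
      by (simp add: F_def fun_eq_iff exp_add[symmetric])
    also have "- (1 + of_real (b * t powr (b - 1)) * y) * exp (- (of_real t + of_real (t powr b) * y)) = f t"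
      using that by (simp add: f_def stable_kernel_def algebra_simps exp_add exp_diff exp_minus field_simps)
    finally show ?thesis .
  qed
  have int: "integrable Pos (stable_kernel b 0 1 y)" "integrable Pos (stable_kernel b (b-1) 1 y)"
    using b by (auto intro!: integrable_stable_kernel)
  have "(LBINT t=0..\<infinity>. f t) = 0 - 1"
  proof (rule interval_integral_FTC_integrable)
    show "isCont f t" if "0 < ereal t" for t
      unfolding f_def using that by (intro continuous_intros isCont_stable_kernel) auto
    show "set_integrable lborel (einterval 0 \<infinity>) f"
      unfolding Ioi integrable_Pos f_def using int by auto
    have "((\<lambda>t::real. t powr b) \<longlongrightarrow> 0) (at_right 0)"
      using b by real_asymp
    then have "(F \<longlongrightarrow> exp (- of_real 0) * exp (- (of_real 0 * y))) (at_right 0)"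
      unfolding F_def by (intro tendsto_intros)
    then show "((F \<circ> real_of_ereal) \<longlongrightarrow> 1) (at_right 0)"
      unfolding zero_ereal_def ereal_tendsto_simps by simp
    obtain C where C0: "\<And>l y' t. 1 \<le> Re l \<Longrightarrow> norm y' \<le> norm y \<Longrightarrow> 0 < t \<Longrightarrow>
        norm (stable_kernel b 0 l y' t) \<le> C * (t powr 0 * exp (- (1/2 * t)))"
      using stable_kernel_dominated[OF b zero_less_one norm_ge_zero[of y], of 0] by blast
    have C: "norm (stable_kernel b 0 1 y t) \<le> C * (t powr 0 * exp (- (1/2 * t)))" if "t > 0" for t
      using C0[of 1 y t] that by simp
    have "(F \<longlongrightarrow> 0) at_top"
    proof (rule Lim_null_comparison)
      show "eventually (\<lambda>t. norm (F t) \<le> C * exp (- (1/2 * t))) at_top"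
        using eventually_gt_at_top[of 0]
        by eventually_elim (use C in \<open>simp add: F_def stable_kernel_def\<close>)
      show "((\<lambda>t::real. C * exp (- (1/2 * t))) \<longlongrightarrow> 0) at_top"
        by real_asymp
    qed
    then show "((F \<circ> real_of_ereal) \<longlongrightarrow> 0) (at_left \<infinity>)"
      unfolding ereal_tendsto_simps .
  qed (use der in auto)
  moreover have "(LBINT t=0..\<infinity>. f t) = integral\<^sup>L Pos f"
    unfolding interval_lebesgue_integral_def Ioi by (simp add: integral_Pos)
  ultimately have "integral\<^sup>L Pos f = -1" by simp
  moreover have "integral\<^sup>L Pos f = - (stable_integral b 0 1 y + of_real b * y * stable_integral b (b - 1) 1 y)"
    unfolding f_def stable_integral_def using int by simp
  ultimately show ?thesis by (simp add: algebra_simps)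
qed

section \<open>Approximation of the positive stable law\<close>

text \<open>Taking logarithms, \<open>n * Ln (1 + a/n) = a * p (a/n)\<close> with \<open>p\<close>
  continuous at 0; the value \<open>p 0 = 1\<close> covers the indices where \<open>a n\<close>
  vanishes.\<close>

lemma tendsto_one_plus_over_n_power:
  fixes a :: "nat \<Rightarrow> complex"
  assumes a: "a \<longlonglongrightarrow> A"
  shows "(\<lambda>n. (1 + a n / of_nat n) ^ n) \<longlonglongrightarrow> exp A"
proof -
  define p where "p z = (if z = 0 then 1 else Ln (1 + z) / z)" for z :: complex
  have p: "Ln (1 + z) = z * p z" for z by (simp add: p_def)
  have z0: "(\<lambda>n. a n / of_nat n) \<longlonglongrightarrow> 0"
    using tendsto_mult[OF a lim_inverse_n] by (simp add: divide_inverse)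
  have "((\<lambda>z. Ln (1 + z)) has_field_derivative 1) (at 0)"
    by (auto intro!: derivative_eq_intros)
  then have "((\<lambda>z. Ln (1 + z) / z) \<longlongrightarrow> 1) (at 0)"
    by (simp add: has_field_derivative_iff)
  then have "(p \<longlongrightarrow> 1) (at 0)"
    by (rule Lim_transform_eventually) (auto simp: p_def eventually_at_filter)
  then have "isCont p 0" by (simp add: isCont_def p_def[of 0])
  from isCont_tendsto_compose[OF this z0] have "(\<lambda>n. p (a n / of_nat n)) \<longlonglongrightarrow> 1"
    by (simp add: p_def[of 0])
  from tendsto_mult[OF a this] have "(\<lambda>n. exp (a n * p (a n / of_nat n))) \<longlonglongrightarrow> exp A"
    by (intro tendsto_exp) simp
  moreover have "eventually (\<lambda>n. dist (a n / of_nat n) 0 < 1) sequentially"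
    by (rule tendstoD[OF z0]) simp
  then have "eventually (\<lambda>n. exp (a n * p (a n / of_nat n)) = (1 + a n / of_nat n) ^ n) sequentially"
    using eventually_gt_at_top[of 0]
  proof eventually_elim
    case (elim n)
    then have "1 + a n / of_nat n \<noteq> 0"
      by (auto simp: add_eq_0_iff dest: arg_cong[of _ _ norm])
    have "a n * p (a n / of_nat n) = of_nat n * Ln (1 + a n / of_nat n)"
      using elim by (simp add: p)
    then show ?case using \<open>1 + a n / of_nat n \<noteq> 0\<close> by (simp add: exp_of_nat_mult)
  qed
  ultimately show ?thesis by (rule Lim_transform_eventually)
qed

lemma gbinomial_of_real: "complex_of_real a gchoose n = of_real (a gchoose n)"
  by (induction n) (simp_all add: gbinomial_Suc_rec)

text \<open>Each factor \<open>b - k\<close> with \<open>k \<ge> 1\<close> is negative, so the signs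
  alternate from \<open>b gchoose 1\<close> on. Hence \<open>1 - (1 - q)^b\<close> has nonnegative
  Taylor coefficients.\<close>

lemma gbinomial_sign:
  fixes b :: real
  assumes "0 < b" "b < 1"
  shows "(-1) ^ n * (b gchoose Suc n) \<ge> 0"
proof (induction n)
  case (Suc n)
  have "(-1) ^ Suc n * (b gchoose Suc (Suc n)) =
      ((-1) ^ n * (b gchoose Suc n)) * ((real (Suc n) - b) / (real (Suc n) + 1))"
    by (subst gbinomial_Suc_rec) (simp add: field_simps)
  also have "\<dots> \<ge> 0" using assms by (intro mult_nonneg_nonneg[OF Suc] divide_nonneg_nonneg) auto
  finally show ?case .
qed (use assms in auto)

text \<open>
  Powers of the generating function \<open>q \<mapsto> 1 - (1 - q)\<^sup>b\<close> of the Sibuya distribution, which lies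
  in the domain of attraction of the positive stable law of index \<open>b\<close>.
\<close>

lemma sibuya_power_sums:
  fixes b :: real
  assumes b: "0 < b" "b < 1"
  shows "\<exists>c. (\<forall>j. c j \<ge> 0) \<and>
    (\<forall>q::complex. norm q < 1 \<longrightarrow> (\<lambda>j. of_real (c j) * q ^ j) sums (1 - (1 - q) powr of_real b) ^ N)"
proof (induction N)
  case 0
  have "(\<lambda>j. of_real (if j = 0 then 1 else 0) * q ^ j) sums 1" for q :: complex
    using sums_single[of 0 "\<lambda>_. 1::complex"] by (rule sums_cong[THEN iffD1, rotated]) auto
  then show ?case by (intro exI[of _ "\<lambda>j. if j = 0 then 1 else 0"]) auto
next
  case (Suc N)
  then obtain c where c: "\<And>j. c j \<ge> 0" "\<And>q::complex. norm q < 1 \<Longrightarrow>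
    (\<lambda>j. of_real (c j) * q ^ j) sums (1 - (1 - q) powr of_real b) ^ N" by auto
  define d where "d j = (if j = 0 then 0 else - ((-1) ^ j * (b gchoose j)))" for j
  have d: "d j \<ge> 0" for j
    using gbinomial_sign[OF b, of "j - 1"] by (cases j) (auto simp: d_def)
  have dsums: "(\<lambda>j. of_real (d j) * q ^ j) sums (1 - (1 - q) powr of_real b)"
    if "norm q < 1" for q :: complex
  proof -
    have "(\<lambda>j. (of_real b gchoose j) * (- q) ^ j) sums (1 + (- q)) powr of_real b"
      using that by (intro gen_binomial_complex) simp
    from sums_diff[OF sums_single[of 0 "\<lambda>_. 1::complex"] this]
    have "(\<lambda>j. (if j = 0 then 1 else 0) - (of_real b gchoose j) * (- q) ^ j) sums (1 - (1 - q) powr of_real b)"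
      by simp
    then show ?thesis
      by (rule sums_cong[THEN iffD1, rotated])
         (auto simp: d_def gbinomial_of_real power_minus[of q])
  qed
  define e where "e j = (\<Sum>i\<le>j. d i * c (j - i))" for j
  \<comment> \<open>Since the coefficients are nonnegative, convergence at the real point
    \<open>norm q\<close> is absolute convergence at \<open>q\<close>.\<close>
  have abs_summable: "summable (\<lambda>j. norm (of_real (x j) * q ^ j))"
    if x: "\<And>j. x j \<ge> 0" "\<And>q::complex. norm q < 1 \<Longrightarrow> (\<lambda>j. of_real (x j) * q ^ j) sums f q"
      and q: "norm q < 1" for x :: "nat \<Rightarrow> real" and q :: complex and f
  proof -
    have "summable (\<lambda>j. of_real (x j) * complex_of_real (norm q) ^ j)"
      using x(2)[of "of_real (norm q)"] q by (auto simp: sums_iff)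
    then have "summable (\<lambda>j. complex_of_real (x j * norm q ^ j))" by simp
    then have "summable (\<lambda>j. x j * norm q ^ j)" by (simp only: summable_of_real_iff)
    then show ?thesis using x(1) by (simp add: norm_mult norm_power)
  qed
  have "(\<lambda>j. of_real (e j) * q ^ j) sums (1 - (1 - q) powr of_real b) ^ Suc N"
    if q: "norm q < 1" for q :: complex
  proof -
    have "(\<lambda>j. \<Sum>i\<le>j. (of_real (d i) * q ^ i) * (of_real (c (j - i)) * q ^ (j - i))) sums
      ((\<Sum>j. of_real (d j) * q ^ j) * (\<Sum>j. of_real (c j) * q ^ j))"
      by (intro Cauchy_product_sums abs_summable[OF d dsums] abs_summable[OF c] q)
    also have "(\<Sum>j. of_real (d j) * q ^ j) * (\<Sum>j. of_real (c j) * q ^ j) = (1 - (1 - q) powr of_real b) ^ Suc N"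
      using dsums[OF q] c(2)[OF q] by (simp add: sums_iff)
    also have "(\<lambda>j. \<Sum>i\<le>j. (of_real (d i) * q ^ i) * (of_real (c (j - i)) * q ^ (j - i))) =
       (\<lambda>j. of_real (e j) * q ^ j)"
    proof
      fix j
      have "(of_real (d i) * q ^ i) * (of_real (c (j - i)) * q ^ (j - i)) = of_real (d i * c (j - i)) * q ^ j"
        if "i \<le> j" for i
        using that by (simp add: power_add[symmetric] mult_ac)
      then have "(\<Sum>i\<le>j. (of_real (d i) * q ^ i) * (of_real (c (j - i)) * q ^ (j - i))) =
          (\<Sum>i\<le>j. of_real (d i * c (j - i)) * q ^ j)"
        by (intro sum.cong) auto
      then show "(\<Sum>i\<le>j. (of_real (d i) * q ^ i) * (of_real (c (j - i)) * q ^ (j - i))) = of_real (e j) * q ^ j"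
        by (simp add: e_def sum_distrib_right)
    qed
    finally show ?thesis .
  qed
  moreover have "e j \<ge> 0" for j using c(1) d by (auto simp: e_def intro!: sum_nonneg)
  ultimately show ?case by blast
qed

text \<open>Nonnegative coefficients bound a partial sum by the full series at
  \<open>norm q\<close>, which is \<open>s^N\<close> with \<open>s\<close> in \<open>[0, 1]\<close>.
  This is the domination needed to pass from the partial sums to the series under the
  integral.\<close>

lemma norm_sibuya_partial_sum_le_1:
  fixes b :: real and c :: "nat \<Rightarrow> real"
  assumes b: "0 < b" "b < 1" and c: "\<And>j. c j \<ge> 0"
    "\<And>q::complex. norm q < 1 \<Longrightarrow> (\<lambda>j. of_real (c j) * q ^ j) sums (1 - (1 - q) powr of_real b) ^ N"
    and q: "norm (q::complex) < 1"
  shows "norm (\<Sum>j<n. of_real (c j) * q ^ j) \<le> 1"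
proof -
  define r where "r = norm q"
  have r: "0 \<le> r" "r < 1" using q by (auto simp: r_def)
  define s where "s = 1 - (1 - r) powr b"
  have s: "0 \<le> s" "s \<le> 1"
    using r b by (auto simp: s_def intro: powr_le1)
  have "(1 - complex_of_real r) powr of_real b = of_real ((1 - r) powr b)"
    using r powr_of_real[of "1 - r" b] by simp
  then have "(\<lambda>j. of_real (c j) * of_real r ^ j) sums (of_real s ^ N :: complex)"
    using c(2)[of "of_real r"] r by (simp add: s_def)
  then have "(\<lambda>j. complex_of_real (c j * r ^ j)) sums complex_of_real (s ^ N)" by simp
  then have sums: "(\<lambda>j. c j * r ^ j) sums (s ^ N)" by (simp only: sums_of_real_iff)
  have "norm (\<Sum>j<n. of_real (c j) * q ^ j) \<le> (\<Sum>j<n. c j * r ^ j)"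
    using c(1) by (intro order_trans[OF norm_sum] sum_mono) (simp add: norm_mult norm_power r_def)
  also have "\<dots> \<le> (\<Sum>j. c j * r ^ j)"
    using sums c(1) r by (intro sum_le_suminf) (auto simp: sums_iff)
  also have "\<dots> = s ^ N" using sums by (simp add: sums_iff)
  also have "\<dots> \<le> 1" using s by (simp add: power_le_one)
  finally show ?thesis .
qed

text \<open>The Laplace transforms of normalised Sibuya sums converge to that of the stable law: for
  \<open>x = N^(-1/b)\<close>, \<open>1 - exp(-u x)\<close> behaves like \<open>u x\<close>, whose
  \<open>b\<close>-th power is \<open>u^b / N\<close>, and \<open>(1 - u^b / N)^N\<close> tends to
  the exponential.\<close>

lemma sibuya_limit:
  fixes b :: real and u :: complex
  assumes b: "0 < b" "b < 1" and u: "Re u > 0"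
  shows "(\<lambda>N. (1 - (1 - exp (- (u * of_real (real N powr (- (1/b)))))) powr of_real b) ^ N)
    \<longlonglongrightarrow> exp (- (u powr of_real b))"
proof -
  define x where "x N = real N powr (- (1/b))" for N
  have x0: "x \<longlonglongrightarrow> 0" unfolding x_def[abs_def] using b by real_asymp
  have xpos: "x N > 0" if "N > 0" for N using that by (simp add: x_def)
  define v where "v N = (1 - exp (- (u * of_real (x N)))) / of_real (x N)" for N
  have "(exp has_field_derivative 1) (at (0::complex))" using DERIV_exp[of "0::complex"] by simp
  then have E: "((\<lambda>z::complex. (exp z - 1) / z) \<longlongrightarrow> 1) (at 0)" by (simp add: has_field_derivative_iff)
  have "filterlim (\<lambda>N. - (u * of_real (x N))) (at 0) sequentially"
    unfolding filterlim_at
  proof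
    have "(\<lambda>N. - (u * of_real (x N))) \<longlonglongrightarrow> - (u * of_real 0)" by (intro tendsto_intros x0)
    then show "(\<lambda>N. - (u * of_real (x N))) \<longlonglongrightarrow> 0" by simp
    show "eventually (\<lambda>N. - (u * of_real (x N)) \<in> UNIV \<and> - (u * of_real (x N)) \<noteq> 0) sequentially"
      using eventually_gt_at_top[of 0]
    proof eventually_elim
      case (elim N)
      have "u \<noteq> 0" using u by auto
      then show ?case using xpos[OF elim] by simp
    qed
  qed
  from filterlim_compose[OF E this]
  have "(\<lambda>N. u * ((exp (- (u * of_real (x N))) - 1) / (- (u * of_real (x N))))) \<longlonglongrightarrow> u * 1"
    by (intro tendsto_intros)
  moreover have "eventually (\<lambda>N. u * ((exp (- (u * of_real (x N))) - 1) / (- (u * of_real (x N)))) = v N) sequentially"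
    using eventually_gt_at_top[of 0]
  proof eventually_elim
    case (elim N)
    have "u \<noteq> 0" using u by auto
    then show ?case using xpos[OF elim] by (simp add: v_def divide_simps)
  qed
  ultimately have v: "v \<longlonglongrightarrow> u" by (auto intro: Lim_transform_eventually)
  have "u \<notin> \<real>\<^sub>\<le>\<^sub>0" using u by (auto simp: complex_nonpos_Reals_iff)
  then have "(\<lambda>N. v N powr of_real b) \<longlonglongrightarrow> u powr of_real b"
    by (intro tendsto_powr_complex v tendsto_const)
  from tendsto_one_plus_over_n_power[OF tendsto_minus[OF this]]
  have "(\<lambda>N. (1 + - (v N powr of_real b) / of_nat N) ^ N) \<longlonglongrightarrow> exp (- (u powr of_real b))" .
  moreover have "eventually (\<lambda>N. (1 + - (v N powr of_real b) / of_nat N) ^ N =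
      (1 - (1 - exp (- (u * of_real (x N)))) powr of_real b) ^ N) sequentially"
    using eventually_gt_at_top[of 0]
  proof eventually_elim
    case (elim N)
    have "1 - exp (- (u * of_real (x N))) = of_real (x N) * v N"
      using xpos[OF elim] by (simp add: v_def)
    then have "(1 - exp (- (u * of_real (x N)))) powr of_real b = of_real (x N) powr of_real b * v N powr of_real b"
      using xpos[OF elim] by (simp add: powr_times_real_left)
    also have "complex_of_real (x N) powr of_real b = of_real (x N powr b)"
      using xpos[OF elim] by (intro powr_of_real) auto
    also have "x N powr b = 1 / real N"
      using b elim unfolding x_def powr_powr by (simp add: powr_minus inverse_eq_divide)
    finally show ?case by simp
  qed
  ultimately show ?thesis unfolding x_def by (rule Lim_transform_eventually)
qed

text \<open>For \<open>0 < b < 1\<close> this is 0 together with the arguments in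
  \<open>[- b pi, 0]\<close>. Writing it as an intersection of two half-planes makes stability under
  sums and limits immediate and avoids the cut of \<open>Arg\<close>.\<close>

definition cone :: "real \<Rightarrow> complex set" where
  "cone b = {z. Im z \<le> 0 \<and> Im (cis (b * pi) * z) \<ge> 0}"

lemma closed_cone: "closed (cone b)"
  unfolding cone_def Collect_conj_eq
  by (intro closed_Int closed_Collect_le continuous_intros)

lemma cone_0: "0 \<in> cone b" by (simp add: cone_def)

lemma cone_scale: "z \<in> cone b \<Longrightarrow> x \<ge> 0 \<Longrightarrow> of_real x * z \<in> cone b"
  unfolding cone_def mem_Collect_eq mult.left_commute[of "cis (b * pi)"]
  by (auto simp: mult_nonneg_nonpos simp del: mult_nonneg_nonneg intro!: mult_nonneg_nonneg)

lemma cone_add: "z \<in> cone b \<Longrightarrow> w \<in> cone b \<Longrightarrow> z + w \<in> cone b"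
  by (auto simp: cone_def distrib_left)

lemma cone_sum: "(\<And>i. i \<in> A \<Longrightarrow> f i \<in> cone b) \<Longrightarrow> sum f A \<in> cone b"
  by (induction A rule: infinite_finite_induct) (auto simp: cone_0 cone_add)

text \<open>The argument of the power is \<open>- b * Arg z\<close> with \<open>Arg z\<close> in
  \<open>[0, pi]\<close>. These are the values that the mixture over the stable variable
  averages.\<close>

lemma powr_neg_in_cone:
  assumes b: "0 < b" "b < 1" and z: "0 \<le> Im z" "z \<noteq> 0"
  shows "z powr (- of_real b) \<in> cone b"
proof -
  have A: "0 \<le> Arg z" "Arg z \<le> pi" using z Arg_le_pi Arg_less_0[of z] by auto
  have E: "z powr (- of_real b) = rcis (norm z powr (- b)) (- b * Arg z)"
    using z(2) by (simp add: powr_def Ln_Arg rcis_def cis_conv_exp exp_add[symmetric] exp_of_real[symmetric] algebra_simps)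
  have 1: "sin (b * Arg z) \<ge> 0"
  proof (rule sin_ge_zero)
    have "b * Arg z \<le> 1 * pi" using A b by (intro mult_mono) auto
    then show "b * Arg z \<le> pi" by simp
  qed (use A b in auto)
  have 2: "sin (b * pi - b * Arg z) \<ge> 0"
  proof (rule sin_ge_zero)
    show "0 \<le> b * pi - b * Arg z" using A b by simp
    have "b * (pi - Arg z) \<le> 1 * pi" using A b by (intro mult_mono) auto
    then show "b * pi - b * Arg z \<le> pi" by (simp add: algebra_simps)
  qed
  have "cis (b * pi) * rcis r (- b * Arg z) = rcis r (b * pi - b * Arg z)" for r
    by (simp add: rcis_def cis_mult mult.left_commute[of "cis (b * pi)"])
  then have "Im (cis (b * pi) * z powr (- of_real b)) = norm z powr (- b) * sin (b * pi - b * Arg z)"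
    by (simp only: E Im_rcis)
  moreover have "Im (z powr (- of_real b)) = - (norm z powr (- b) * sin (b * Arg z))"
    unfolding E Im_rcis by simp
  ultimately show ?thesis unfolding cone_def mem_Collect_eq using 1 2 by simp
qed

section \<open>The range of \<open>g\<close> on the sector\<close>

lemma powr_mult_Arg:
  assumes "Arg z + Arg w \<in> {-pi<..pi}" "z \<noteq> 0" "w \<noteq> 0"
  shows "(z * w) powr a = z powr a * w powr a"
  using assms by (simp add: powr_def Ln_Arg Arg_times norm_mult ln_mult exp_add[symmetric] algebra_simps)

lemma Re_pos_of_Arg:
  assumes "z \<noteq> 0" "\<bar>Arg z\<bar> < pi / 2"
  shows "Re z > 0"
  using assms Arg_Re_pos by blast

text \<open>
  With \<open>S\<close> the positive stable variable of index \<open>b\<close>, this is the cone property of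
  \<open>\<Gamma>(b) E (1 + w S)\<^sup>-\<^sup>b\<close> at \<open>w = y\<^sup>1\<^sup>/\<^sup>b\<close>; the law of \<open>S\<close> is replaced by its approximation by
  normalised sums of Sibuya variables, and the contour is rotated so that the Laplace transforms
  of these are evaluated in the right half-plane only.
\<close>

lemma stable_integral_in_cone_open:
  assumes b: "0 < b" "b < 1" and y: "y \<noteq> 0" "0 \<le> Arg y" "Arg y < b * pi"
  shows "stable_integral b (b - 1) 1 y \<in> cone b"
proof -
  have c: "b - 1 > -1" using b by simp
  define \<theta> where "\<theta> = Arg y / b"
  have \<theta>: "0 \<le> \<theta>" "\<theta> < pi" using y b by (auto simp: \<theta>_def field_simps)
  define R where "R = norm y powr (1/b)"
  have R: "R > 0" using y by (simp add: R_def)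
  define w where "w = rcis R \<theta>"
  \<comment> \<open>Half of the angle: \<open>l\<close> and \<open>v = l * w\<close> get the
    arguments \<open>- \<theta>/2\<close> and \<open>\<theta>/2\<close>, both strictly inside the
    right half-plane since \<open>\<theta> < pi\<close>.\<close>
  define l where "l = cis (- \<theta> / 2)"
  define v where "v = l * w"
  have v_eq: "v = rcis R (\<theta> / 2)"
    by (simp add: v_def l_def w_def rcis_def cis_mult mult_ac)
  have Arg_l: "Arg l = - \<theta> / 2" unfolding l_def using \<theta> pi_gt_zero
    by (intro Arg_cis) (simp; linarith)
  have Arg_w: "Arg w = \<theta>" unfolding w_def using \<theta> pi_gt_zero R
    by (intro Arg_rcis) (simp_all; linarith)
  have Arg_v: "Arg v = \<theta> / 2" unfolding v_eq using \<theta> pi_gt_zero R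
    by (intro Arg_rcis) (simp_all; linarith)
  have nz: "l \<noteq> 0" "w \<noteq> 0" "v \<noteq> 0" using R by (auto simp: l_def w_def v_eq)
  have Re_l: "Re l > 0" by (rule Re_pos_of_Arg) (use nz Arg_l \<theta> in auto)
  have Re_v: "Re v > 0" by (rule Re_pos_of_Arg) (use nz Arg_v \<theta> in auto)
  have w_powr: "w powr of_real b = y"
  proof -
    have "w powr of_real b = rcis (R powr b) (b * \<theta>)"
      using nz R by (simp add: powr_def Ln_Arg Arg_w rcis_def cis_conv_exp exp_add[symmetric]
          exp_of_real[symmetric] algebra_simps w_def[symmetric]) (simp add: w_def norm_mult add.commute)
    also have "\<dots> = rcis (norm y) (Arg y)"
      using b y by (simp add: R_def powr_powr \<theta>_def)
    finally show ?thesis by (simp add: rcis_cmod_Arg)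
  qed
  have v_powr: "v powr of_real b = l powr of_real b * y"
    unfolding v_def w_powr[symmetric] using \<theta> nz
    by (intro powr_mult_Arg) (auto simp: Arg_l Arg_w)
  obtain G where G: "G > 0" "stable_integral b (b - 1) 1 0 = of_real G"
    using stable_integral_pos[OF b c, of 0] by auto
  \<comment> \<open>The contribution of a point mass at \<open>s\<close>. Rotation at
    \<open>l * z\<close> with \<open>z = 1 + s w\<close> produces \<open>(l z)^(-b)\<close>; the
    factor \<open>l^b\<close> cancels the turn and leaves \<open>G * z^(-b)\<close> with
    \<open>Im z \<ge> 0\<close>.\<close>
  have atom: "l powr of_real b * stable_integral b (b - 1) (l + of_real s * v) 0 \<in> cone b"
    if s: "s \<ge> 0" for s
  proof -
    define z where "z = 1 + of_real s * w"
    have Imz: "Im z \<ge> 0" using s R \<theta> by (simp add: z_def w_def sin_ge_zero)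
    have lz: "l * z = l + of_real s * v" by (simp add: z_def v_def algebra_simps)
    have Re_lz: "Re (l * z) > 0" unfolding lz using Re_l Re_v s by (simp add: add_pos_nonneg)
    then have z0: "z \<noteq> 0" by auto
    have "Arg z \<ge> 0" "Arg z \<le> pi" using Imz Arg_less_0 Arg_le_pi by auto
    then have lzp: "(l * z) powr of_real b = l powr of_real b * z powr of_real b"
      using \<theta> nz z0 pi_gt_zero by (intro powr_mult_Arg) (simp_all add: Arg_l; linarith)
    have "(l * z) powr of_real (b - 1 + 1) * stable_integral b (b - 1) (l * z) 0 = of_real G"
      using stable_integral_rotate[OF b c Re_lz, of 0] G by simp
    then have "z powr of_real b * (l powr of_real b * stable_integral b (b - 1) (l * z) 0) = of_real G"
      by (simp add: lzp mult_ac)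
    then have "l powr of_real b * stable_integral b (b - 1) (l * z) 0 = of_real G * z powr (- of_real b)"
      using z0 by (simp add: powr_minus field_simps)
    then show ?thesis unfolding lz[symmetric]
      using cone_scale[OF powr_neg_in_cone[OF b Imz z0], of G] G by simp
  qed
  \<comment> \<open>Here \<open>f\<close> stands for a Laplace transform evaluated at
    \<open>t * v\<close>; for \<open>f u = exp(-u^b)\<close> the rotated kernel of \<open>g\<close>
    results, since \<open>v^b = l^b y\<close>.\<close>
  define K where "K f t = complex_of_real (t powr (b - 1)) * exp (- (l * of_real t)) * f (of_real t * v)"
    for f and t :: real
  have K_bound: "norm (K f t) \<le> t powr (b - 1) * exp (- (Re l * t))"
    if "norm (f (of_real t * v)) \<le> 1" for f t
    using mult_left_mono[OF that, of "t powr (b - 1) * exp (- (Re l * t))"]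
    by (simp add: K_def norm_mult)
  have dom: "integrable Pos (\<lambda>t. t powr (b - 1) * exp (- (Re l * t)))"
    by (rule integrable_Pos_powr_exp[OF c Re_l])
  \<comment> \<open>Truncations of the power series are positive combinations of the point masses at
    \<open>j * x\<close>; the cone, being closed, keeps their limit.\<close>
  have approx: "l powr of_real b * integral\<^sup>L Pos (K (\<lambda>u. (1 - (1 - exp (- (u * of_real x))) powr of_real b) ^ N)) \<in> cone b"
    if x: "x > 0" for x :: real and N :: nat
  proof -
    obtain a where a: "\<And>j. a j \<ge> 0"
      "\<And>q::complex. norm q < 1 \<Longrightarrow> (\<lambda>j. of_real (a j) * q ^ j) sums (1 - (1 - q) powr of_real b) ^ N"
      using sibuya_power_sums[OF b, of N] by blast
    define P where "P n u = (\<Sum>j<n. of_real (a j) * exp (- (u * of_real x)) ^ j)" for n and u :: complex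
    have q: "norm (exp (- (u * of_real x))) < 1" if "Re u > 0" for u :: complex
      using that x by simp
    have Ret: "Re (of_real t * v) > 0" if "t > 0" for t using that Re_v by simp
    have "integral\<^sup>L Pos (K (P n)) = (\<Sum>j<n. of_real (a j) * stable_integral b (b - 1) (l + of_real (real j * x) * v) 0)" for n
    proof -
      have "K (P n) = (\<lambda>t. \<Sum>j<n. of_real (a j) * stable_kernel b (b - 1) (l + of_real (real j * x) * v) 0 t)"
        by (simp add: fun_eq_iff K_def P_def stable_kernel_def sum_distrib_left exp_of_nat_mult[symmetric]
            exp_add[symmetric] exp_minus algebra_simps flip: exp_minus)
      moreover have "integrable Pos (stable_kernel b (b - 1) (l + of_real (real j * x) * v) 0)" for j
        using Re_l Re_v x by (intro integrable_stable_kernel b c) (simp add: add_pos_nonneg)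
      ultimately show ?thesis by (simp add: stable_integral_def)
    qed
    then have "l powr of_real b * integral\<^sup>L Pos (K (P n)) =
        (\<Sum>j<n. of_real (a j) * (l powr of_real b * stable_integral b (b - 1) (l + of_real (real j * x) * v) 0))" for n
      by (simp add: sum_distrib_left mult.left_commute)
    then have in_cone: "l powr of_real b * integral\<^sup>L Pos (K (P n)) \<in> cone b" for n
      using a(1) x by (simp only:) (intro cone_sum cone_scale atom, auto)
    have "(\<lambda>n. integral\<^sup>L Pos (K (P n))) \<longlonglongrightarrow>
        integral\<^sup>L Pos (K (\<lambda>u. (1 - (1 - exp (- (u * of_real x))) powr of_real b) ^ N))"
    proof (rule integral_dominated_convergence[OF _ _ dom])
      show "K (P n) \<in> borel_measurable Pos" for n
        unfolding K_def P_def by (rule measurable_PosI) measurable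
      show "AE t in Pos. (\<lambda>n. K (P n) t) \<longlonglongrightarrow> K (\<lambda>u. (1 - (1 - exp (- (u * of_real x))) powr of_real b) ^ N) t"
        unfolding K_def P_def
        by (intro AE_PosI tendsto_intros a(2)[OF q[OF Ret], unfolded sums_def])
      show "AE t in Pos. norm (K (P n) t) \<le> t powr (b - 1) * exp (- (Re l * t))" for n
        by (intro AE_PosI K_bound) (unfold P_def, intro norm_sibuya_partial_sum_le_1[OF b a] q Ret)
      show "K (\<lambda>u. (1 - (1 - exp (- (u * of_real x))) powr of_real b) ^ N) \<in> borel_measurable Pos"
        unfolding K_def powr_def by (rule measurable_PosI) measurable
    qed
    from closed_sequentially[OF closed_cone in_cone tendsto_mult_left[OF this]]
    show ?thesis by blast
  qed
  define L where "L N = (\<lambda>u::complex. (1 - (1 - exp (- (u * of_real (real N powr (- (1/b)))))) powr of_real b) ^ N)" for N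
  have L_bound: "norm (L N u) \<le> 1" if u: "Re u > 0" and N: "N > 0" for N u
  proof -
    obtain a where a: "\<And>j. a j \<ge> 0"
      "\<And>q::complex. norm q < 1 \<Longrightarrow> (\<lambda>j. of_real (a j) * q ^ j) sums (1 - (1 - q) powr of_real b) ^ N"
      using sibuya_power_sums[OF b, of N] by blast
    define q where "q = exp (- (u * of_real (real N powr (- (1/b)))))"
    have q: "norm q < 1" using u N by (simp add: q_def)
    have "norm (L N u) \<le> 1"
      unfolding L_def q_def[symmetric]
      by (rule Lim_bounded[OF tendsto_norm[OF a(2)[OF q, unfolded sums_def]], of 0])
         (use norm_sibuya_partial_sum_le_1[OF b a q] in auto)
    then show ?thesis .
  qed
  \<comment> \<open>Indices start at 1, where the lattice step \<open>N^(-1/b)\<close> is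
    positive.\<close>
  have "(\<lambda>N. integral\<^sup>L Pos (K (L (Suc N)))) \<longlonglongrightarrow> integral\<^sup>L Pos (K (\<lambda>u. exp (- (u powr of_real b))))"
  proof (rule integral_dominated_convergence[OF _ _ dom])
    show "K (L (Suc N)) \<in> borel_measurable Pos" for N
      unfolding K_def L_def powr_def by (rule measurable_PosI) measurable
    show "K (\<lambda>u. exp (- (u powr of_real b))) \<in> borel_measurable Pos"
      unfolding K_def powr_def by (rule measurable_PosI) measurable
    show "AE t in Pos. (\<lambda>N. K (L (Suc N)) t) \<longlonglongrightarrow> K (\<lambda>u. exp (- (u powr of_real b))) t"
    proof (rule AE_PosI)
      fix t :: real assume "t > 0"
      then have "Re (of_real t * v) > 0" using Re_v by simp
      from sibuya_limit[OF b this]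
      show "(\<lambda>N. K (L (Suc N)) t) \<longlonglongrightarrow> K (\<lambda>u. exp (- (u powr of_real b))) t"
        unfolding K_def by (intro tendsto_intros) (unfold L_def, rule LIMSEQ_Suc)
    qed
    show "AE t in Pos. norm (K (L (Suc N)) t) \<le> t powr (b - 1) * exp (- (Re l * t))" for N
      using Re_v by (intro AE_PosI K_bound L_bound) auto
  qed
  then have "(\<lambda>N. l powr of_real b * integral\<^sup>L Pos (K (L (Suc N)))) \<longlonglongrightarrow>
     l powr of_real b * integral\<^sup>L Pos (K (\<lambda>u. exp (- (u powr of_real b))))"
    by (rule tendsto_mult_left)
  moreover have "l powr of_real b * integral\<^sup>L Pos (K (L (Suc N))) \<in> cone b" for N
    unfolding L_def by (rule approx) simp
  ultimately have "l powr of_real b * integral\<^sup>L Pos (K (\<lambda>u. exp (- (u powr of_real b)))) \<in> cone b"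
    by (rule closed_sequentially[OF closed_cone, rotated])
  also have "integral\<^sup>L Pos (K (\<lambda>u. exp (- (u powr of_real b)))) = stable_integral b (b - 1) l (l powr of_real b * y)"
    unfolding stable_integral_def
  proof (rule Bochner_Integration.integral_cong[OF refl])
    fix t assume "t \<in> space Pos"
    then have t: "t > 0" by simp
    have "(of_real t * v) powr of_real b = of_real (t powr b) * (l powr of_real b * y)"
      using t by (simp add: powr_times_real_left powr_of_real v_powr)
    then show "K (\<lambda>u. exp (- (u powr of_real b))) t = stable_kernel b (b - 1) l (l powr of_real b * y) t"
      by (simp add: K_def stable_kernel_def)
  qed
  finally show ?thesis using stable_integral_rotate[OF b c Re_l, of y] by simp
qed

text \<open>On the edge \<open>Arg y = b pi\<close> the angle \<open>\<theta>\<close> would be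
  \<open>pi\<close>, and its half would put the rotated rates on the imaginary axis. The edge is
  therefore reached as a limit from inside.\<close>

lemma stable_integral_in_cone:
  assumes b: "0 < b" "b < 1" and y: "y = 0 \<or> 0 \<le> Arg y \<and> Arg y \<le> b * pi"
  shows "stable_integral b (b - 1) 1 y \<in> cone b"
proof (cases "y \<noteq> 0 \<and> Arg y = b * pi")
  case False
  show ?thesis
  proof (cases "y = 0")
    case True
    obtain G where "G > 0" "stable_integral b (b - 1) 1 0 = of_real G"
      using stable_integral_pos[of b "b - 1" 0] b by auto
    then show ?thesis using True b by (simp add: cone_def sin_ge_zero)
  qed (use False y stable_integral_in_cone_open[OF b] in auto)
next
  case True
  have bp: "0 < b * pi" "b * pi < pi" using b by auto
  have y_eq: "y = rcis (norm y) (b * pi)" using True rcis_cmod_Arg[of y] by simp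
  define z where "z n = rcis (norm y) (b * pi * (1 - 1 / real (Suc n)))" for n
  have "(\<lambda>n. b * pi * (1 - 1 / real (Suc n))) \<longlonglongrightarrow> b * pi * (1 - 0)"
    by (intro tendsto_intros LIMSEQ_Suc[OF lim_const_over_n[of 1, simplified]])
  then have lim: "(\<lambda>n. b * pi * (1 - 1 / real (Suc n))) \<longlonglongrightarrow> b * pi" by simp
  have "z \<longlonglongrightarrow> rcis (norm y) (b * pi)"
    unfolding z_def[abs_def] rcis_def by (intro tendsto_mult tendsto_const tendsto_cis[OF lim])
  then have z: "z \<longlonglongrightarrow> y" using y_eq by simp
  have "stable_integral b (b - 1) 1 (z n) \<in> cone b" for n
  proof -
    define f where "f = 1 - 1 / real (Suc n)"
    have f: "0 \<le> f" "f < 1" by (auto simp: f_def)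
    have "b * pi * f \<ge> 0" "b * pi * f < b * pi * 1"
      using mult_nonneg_nonneg[OF less_imp_le[OF bp(1)] f(1)] mult_strict_left_mono[OF f(2) bp(1)] by auto
    moreover from this have "b * pi * f \<in> {-pi<..pi}"
      using bp pi_gt_zero unfolding greaterThanAtMost_iff by linarith
    then have "Arg (z n) = b * pi * f" using True
      unfolding z_def f_def[symmetric] by (intro Arg_rcis) auto
    ultimately show ?thesis using True f bp
      by (intro stable_integral_in_cone_open[OF b]) (auto simp: z_def f_def[symmetric])
  qed
  moreover have "continuous_on UNIV (stable_integral b (b - 1) 1)"
    by (rule stable_integral_continuous) (use b in auto)
  then have "isCont (stable_integral b (b - 1) 1) y" by (simp add: continuous_on_eq_continuous_at)
  from isCont_tendsto_compose[OF this z] 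
  have "(\<lambda>n. stable_integral b (b - 1) 1 (z n)) \<longlonglongrightarrow> stable_integral b (b - 1) 1 y" .
  ultimately show ?thesis by (rule closed_sequentially[OF closed_cone])
qed

lemma Arg_cone:
  assumes b: "0 < b" "b < 1" and z: "z \<in> cone b" "z \<noteq> 0"
  shows "- (b * pi) \<le> Arg z" "Arg z \<le> 0"
proof -
  define r where "r = norm z"
  have r: "r > 0" "z = rcis r (Arg z)" using z by (auto simp: r_def rcis_cmod_Arg)
  have bp: "0 < b * pi" "b * pi < pi" using b by auto
  have 1: "sin (b * pi + Arg z) \<ge> 0"
  proof -
    have "cis (b * pi) * z = rcis r (b * pi + Arg z)"
      by (subst r(2)) (simp add: rcis_def cis_mult ac_simps)
    then have "Im (cis (b * pi) * z) = r * sin (b * pi + Arg z)" by simp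
    then show ?thesis using z(1) r(1) by (simp add: cone_def zero_le_mult_iff)
  qed
  have A: "- pi < Arg z" "Arg z \<le> pi" using Arg_bounded by auto
  have "Im z \<le> 0" using z by (simp add: cone_def)
  \<comment> \<open>A nonpositive imaginary part also allows \<open>Arg z = pi\<close>; the second
    half-plane excludes it.\<close>
  then have A2: "Arg z \<le> 0 \<or> Arg z = pi"
    using Arg_lt_pi[of z] A by linarith
  show "Arg z \<le> 0"
  proof (rule ccontr)
    assume "\<not> Arg z \<le> 0"
    then have "sin (b * pi + Arg z) = - sin (b * pi)" using A2 by simp
    moreover have "sin (b * pi) > 0" using bp by (intro sin_gt_zero) auto
    ultimately show False using 1 by simp
  qed
  show "- (b * pi) \<le> Arg z"
  proof (rule ccontr)
    assume "\<not> - (b * pi) \<le> Arg z"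
    then have "sin (- (b * pi + Arg z)) > 0" using A bp by (intro sin_gt_zero) linarith+
    then show False using 1 unfolding sin_minus by simp
  qed
qed

section \<open>Finiteness of the critical set\<close>

text \<open>Continuity of \<open>Arg\<close> is available off the negative axis only. A limit on
  that axis is excluded by \<open>Re x \<ge> cos (b pi) * norm x\<close>, which passes to limits and
  fails at negative reals because \<open>cos (b pi) > -1\<close>.\<close>

lemma closed_sector:
  assumes b: "0 < b" "b < 1"
  shows "closed (sector b)"
  unfolding closed_sequential_limits
proof (intro allI impI, elim conjE)
  fix x l assume x: "\<forall>n. x n \<in> sector b" and l: "x \<longlonglongrightarrow> l"
  have bp: "b * pi < pi" using b by simp
  show "l \<in> sector b"
  proof (rule ccontr)
    assume "l \<notin> sector b"
    then have l0: "l \<noteq> 0" and Al: "\<bar>Arg l\<bar> > b * pi" by (auto simp: sector_def)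
    show False
    proof (cases "l \<in> \<real>\<^sub>\<le>\<^sub>0")
      case False
      then have "(\<lambda>n. Arg (x n)) \<longlonglongrightarrow> Arg l"
        using l continuous_at_Arg isCont_tendsto_compose by blast
      then have "(\<lambda>n. \<bar>Arg (x n)\<bar>) \<longlonglongrightarrow> \<bar>Arg l\<bar>" by (rule tendsto_rabs)
      from order_tendstoD(1)[OF this Al] tendsto_imp_eventually_ne[OF l l0]
      have "eventually (\<lambda>n. False) sequentially"
      proof eventually_elim
        case (elim n)
        have "x n \<in> sector b" using x by blast
        then show False using elim unfolding sector_def by simp
      qed
      then show False by simp
    next
      case True
      then have Re: "Re l < 0" "Im l = 0" using l0
        by (auto simp: complex_nonpos_Reals_iff complex_eq_iff less_le)
      define k where "k = cos (b * pi)"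
      have k: "k > -1" unfolding k_def using b cos_monotone_0_pi[of "b * pi" pi] by simp
      have "Re (x n) \<ge> k * norm (x n)" for n
      proof (cases "x n = 0")
        case False
        then have "\<bar>Arg (x n)\<bar> \<le> b * pi" using x by (auto simp: sector_def)
        then have "k \<le> cos (Arg (x n))" unfolding k_def using bp by (intro cos_ge_cos_of_abs_le) auto
        then have "k * norm (x n) \<le> norm (x n) * cos (Arg (x n))"
          using mult_right_mono[of k "cos (Arg (x n))" "norm (x n)"] by (simp add: mult.commute)
        also have "\<dots> = Re (x n)" using arg_cong[OF rcis_cmod_Arg[of "x n"], of Re] by simp
        finally show ?thesis .
      qed auto
      then have "Re l \<ge> k * norm l"
        by (intro LIMSEQ_le[OF tendsto_mult_left[OF tendsto_norm[OF l]] tendsto_Re[OF l]]) auto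
      moreover have "norm l = - Re l" using Re by (simp add: cmod_def)
      ultimately have "k * (- Re l) \<le> Re l" by simp
      moreover have "(k + 1) * (- Re l) > 0" using k Re by (intro mult_pos_pos) auto
      ultimately show False by (simp add: algebra_simps)
    qed
  qed
qed

locale stable_index =
  fixes b :: real
  assumes b: "0 < b" "b < 1"
begin

abbreviation "g \<equiv> stable_integral b (b - 1) 1"
abbreviation "h \<equiv> stable_integral b 0 1"

lemma g_holomorphic [holomorphic_intros]: "f holomorphic_on A \<Longrightarrow> (\<lambda>z. g (f z)) holomorphic_on A"
  using holomorphic_on_compose_gen[of f A g UNIV] stable_integral_holomorphic[of b "b - 1" 1 UNIV] b
  by (simp add: o_def)

lemma h_holomorphic [holomorphic_intros]: "f holomorphic_on A \<Longrightarrow> (\<lambda>z. h (f z)) holomorphic_on A"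
  using holomorphic_on_compose_gen[of f A h UNIV] stable_integral_holomorphic[of b 0 1 UNIV] b
  by (simp add: o_def)

lemma isCont_g: "isCont g y"
  using stable_integral_continuous[of b "b - 1" 1 UNIV] b by (simp add: continuous_on_eq_continuous_at)

lemma isCont_h: "isCont h y"
  using stable_integral_continuous[of b 0 1 UNIV] b by (simp add: continuous_on_eq_continuous_at)

lemma h_has_derivative: "(h has_field_derivative - stable_integral b b 1 y) (at y)"
  using stable_integral_has_field_derivative[of b 0 1 y] b by simp

lemma h_eq: "h y = 1 - of_real b * y * g y"
  by (rule stable_integral_by_parts[OF b])

lemma g_pos: "y \<ge> 0 \<Longrightarrow> \<exists>x>0. g (of_real y) = of_real x"
  using stable_integral_pos[of b "b - 1" y] b by simp

lemma g_0: "g 0 \<noteq> 0"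
  using g_pos[of 0] by auto

lemma g_cnj: "g (cnj y) = cnj (g y)" and h_cnj: "h (cnj y) = cnj (h y)"
  by (rule stable_integral_cnj)+

lemma g_bounded: "\<exists>C>0. \<forall>y\<in>sector b. norm (g y) \<le> C"
proof -
  have "b - 1 > -1" using b by simp
  from stable_integral_sector_bound[OF b this] show ?thesis by blast
qed

lemma h_bounded: "\<exists>C>0. \<forall>y\<in>sector b. norm (h y) \<le> C \<and> (y \<noteq> 0 \<longrightarrow> norm (h y) \<le> C * norm y powr (- (1 / b)))"
  using stable_integral_sector_bound[of b 0] b by simp

text \<open>\<open>stable_integral b b 1\<close> is \<open>- h'\<close>; its decay exponent
  \<open>(b + 1) / b\<close> becomes \<open>1 / b\<close> after multiplication by \<open>y\<close>,
  the same as for \<open>h\<close>.\<close>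

lemma tails_small:
  "\<exists>R>0. \<forall>y\<in>sector b. norm y \<ge> R \<longrightarrow> norm (h y) \<le> 1/2 \<and> norm (y * stable_integral b b 1 y) < 1"
proof -
  obtain C where C: "C > 0" "\<And>y. y \<in> sector b \<Longrightarrow> y \<noteq> 0 \<Longrightarrow> norm (h y) \<le> C * norm y powr (- (1 / b))"
    using h_bounded by auto
  obtain D where D: "D > 0" "\<And>y. y \<in> sector b \<Longrightarrow> y \<noteq> 0 \<Longrightarrow>
      norm (stable_integral b b 1 y) \<le> D * norm y powr (- ((b + 1) / b))"
  proof -
    have "b > -1" using b by simp
    from stable_integral_sector_bound[OF b this] show ?thesis using that by blast
  qed
  have "((\<lambda>r. r powr (- (1 / b))) \<longlongrightarrow> 0) at_top" using b by real_asymp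
  then have "((\<lambda>r. max C D * r powr (- (1 / b))) \<longlongrightarrow> max C D * 0) at_top"
    by (rule tendsto_mult_left)
  then have "eventually (\<lambda>r. max C D * r powr (- (1 / b)) < 1/2) at_top"
    by (rule order_tendstoD) simp
  then obtain R where R: "\<And>r. r \<ge> R \<Longrightarrow> max C D * r powr (- (1 / b)) < 1/2"
    by (auto simp: eventually_at_top_linorder)
  have "norm (h y) \<le> 1/2 \<and> norm (y * stable_integral b b 1 y) < 1"
    if y: "y \<in> sector b" "norm y \<ge> max 1 R" for y
  proof -
    have y0: "y \<noteq> 0" using y by auto
    have "C * norm y powr (- (1 / b)) \<le> max C D * norm y powr (- (1 / b))" by (intro mult_right_mono) auto
    moreover have "D * norm y powr (- (1 / b)) \<le> max C D * norm y powr (- (1 / b))" by (intro mult_right_mono) auto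
    moreover have "norm (y * stable_integral b b 1 y) \<le> norm y * (D * norm y powr (- ((b + 1) / b)))"
      unfolding norm_mult by (intro mult_left_mono D y y0) auto
    moreover have "norm y * (D * norm y powr (- ((b + 1) / b))) = D * (norm y powr 1 * norm y powr (- ((b + 1) / b)))"
      using y0 by simp
    moreover have "norm y powr 1 * norm y powr (- ((b + 1) / b)) = norm y powr (- (1 / b))"
      unfolding powr_add[symmetric] using b by (simp add: field_simps)
    ultimately show ?thesis using C(2)[OF y(1) y0] R[of "norm y"] y(2) by (intro conjI) auto
  qed
  then show ?thesis by (intro exI[of _ "max 1 R"]) auto
qed

lemma finite_critical: "finite {y \<in> sector b. g y = y * deriv g y}"
proof -
  obtain R where R: "\<And>y. y \<in> sector b \<Longrightarrow> norm y \<ge> R \<Longrightarrow> norm (h y) \<le> 1/2 \<and> norm (y * stable_integral b b 1 y) < 1"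
    using tails_small by auto
  define E where "E y = g y - y * deriv g y" for y
  have gd: "(g has_field_derivative deriv g y) (at y)" for y
    by (rule holomorphic_derivI[of _ UNIV]) (auto intro!: holomorphic_intros)
  have E_hol: "E holomorphic_on UNIV"
    unfolding E_def by (intro holomorphic_intros) auto
  have small: "norm y < R" if y: "y \<in> sector b" "E y = 0" for y
  proof (rule ccontr)
    assume "\<not> norm y < R"
    then have R: "norm (h y) \<le> 1/2" "norm (y * stable_integral b b 1 y) < 1" using R y by auto
    have "((\<lambda>y. 1 - of_real b * y * g y) has_field_derivative - (of_real b * (g y + y * deriv g y))) (at y)"
      by (auto intro!: derivative_eq_intros gd simp: algebra_simps)
    also have "(\<lambda>y. 1 - of_real b * y * g y) = h" using h_eq by auto
    finally have "stable_integral b b 1 y = of_real b * (g y + y * deriv g y)"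
      using DERIV_unique[OF h_has_derivative] by (metis neg_equal_iff_equal)
    \<comment> \<open>At a critical point \<open>y g' = g\<close>, hence
      \<open>- y h' = 2 b y g = 2 (1 - h)\<close>. Its norm is at least 1 where
      \<open>norm (h y) \<le> 1/2\<close>, against the bound below 1.\<close>
    also have "\<dots> = of_real b * (2 * g y)" using y(2) by (simp add: E_def)
    finally have "y * stable_integral b b 1 y = 2 * (1 - h y)" unfolding h_eq by simp
    then have "norm (y * stable_integral b b 1 y) = 2 * norm (1 - h y)" by (simp only: norm_mult) simp
    moreover have "norm (1 - h y) \<ge> norm (1::complex) - norm (h y)" by (rule norm_triangle_ineq2)
    ultimately show False using R by simp
  qed
  have "finite {y \<in> cball 0 R. E y = 0}"
  proof (cases "E constant_on UNIV")
    case True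
    have "E 0 \<noteq> 0" using g_0 by (simp add: E_def)
    then have "E y \<noteq> 0" for y using True unfolding constant_on_def by (metis UNIV_I)
    then show ?thesis by simp
  next
    case False
    then show ?thesis
      using holomorphic_compact_finite_zeros[OF E_hol open_UNIV connected_UNIV compact_cball[of 0 R]] by auto
  qed
  then show ?thesis
    by (rule rev_finite_subset) (use small in \<open>auto simp: E_def less_imp_le\<close>)
qed

end

text \<open>The relation \<open>t^\<alpha> = C g'(y)\<close> recovers \<open>t > 0\<close> from
  \<open>y\<close>, so each critical point contributes at most the two elements \<open>t\<close> and
  \<open>- t\<close>.\<close>

lemma (in stable_index) finite_D_stable: "finite (D_stable (2 * b))"
proof -
  define f where "f y = norm (C_stable (2 * b) * deriv g y) powr (1 / (2 * b))" for y
  have g: "g_stable (2 * b) = g" by (simp add: g_stable_eq)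
  have K: "K_stable (2 * b) = sector b" using K_stable_eq_sector[of "2 * b"] b by simp
  let ?Z = "{y \<in> sector b. g y = y * deriv g y}"
  have "D_stable (2 * b) \<subseteq> {0} \<union> f ` ?Z \<union> (\<lambda>y. - f y) ` ?Z"
  proof
    fix s assume s: "s \<in> D_stable (2 * b)"
    show "s \<in> {0} \<union> f ` ?Z \<union> (\<lambda>y. - f y) ` ?Z"
    proof (cases "s = 0")
      case False
      then obtain t y where t: "t > 0" "s = t \<or> s = - t" "y \<in> ?Z"
        "complex_of_real (t powr (2 * b)) = C_stable (2 * b) * deriv g y"
        using s unfolding D_stable_def g K by auto
      have "f y = norm (complex_of_real (t powr (2 * b))) powr (1 / (2 * b))" unfolding f_def t(4) ..
      also have "\<dots> = t" using t(1) b by (simp add: powr_powr)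
      finally show ?thesis using t by auto
    qed auto
  qed
  then show ?thesis by (rule finite_subset) (use finite_critical in auto)
qed

section \<open>The solution stays in the sector\<close>

text \<open>Phases are known only modulo \<open>2 pi\<close>; this makes a small one exactly
  zero.\<close>

lemma cis_eq_1_small: "cis x = 1 \<Longrightarrow> \<bar>x\<bar> < 2 * pi \<Longrightarrow> x = 0"
proof -
  assume x: "cis x = 1" "\<bar>x\<bar> < 2 * pi"
  have "cos x = 1" using arg_cong[OF x(1), of Re] by simp
  then obtain n :: int where n: "x = real_of_int n * 2 * pi" unfolding cos_one_2pi_int by blast
  then have "\<bar>real_of_int n\<bar> * (2 * pi) < 1 * (2 * pi)" using x(2) by (simp add: abs_mult)
  then have "\<bar>real_of_int n\<bar> < 1" using mult_less_cancel_right_pos[of "2 * pi"] pi_gt_zero by simp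
  then have "n = 0" by linarith
  then show "x = 0" using n by simp
qed

lemma Arg_cnj_minus: "Arg z \<noteq> pi \<Longrightarrow> Arg (cnj z) = - Arg z"
  by (auto simp: Arg_cnj Arg_real split: if_splits)

lemma isCont_tendsto_nhds: "isCont f x \<Longrightarrow> (f \<longlongrightarrow> f x) (nhds x)"
  unfolding isCont_def tendsto_at_iff_tendsto_nhds .

lemma powr_real_polar:
  "z \<noteq> 0 \<Longrightarrow> z powr of_real a = of_real (norm z powr a) * cis (a * Arg z)"
  by (simp add: powr_def Ln_Arg cis_conv_exp exp_add[symmetric] exp_of_real[symmetric] algebra_simps)

lemma sgn_powr_real: "z \<noteq> 0 \<Longrightarrow> sgn (z powr of_real a) = cis (a * Arg z)"
  unfolding powr_real_polar by (simp add: sgn_mult sgn_of_real)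

lemma upper_half_plane_simps: "z \<in> upper_half_plane \<longleftrightarrow> Im z > 0"
  by (simp add: upper_half_plane_def)

lemma open_upper_half_plane: "open upper_half_plane"
  unfolding upper_half_plane_def by (rule open_halfspace_Im_gt)

lemma convex_upper_half_plane: "convex upper_half_plane"
  unfolding upper_half_plane_def by (rule convex_halfspace_Im_gt)

lemma connected_upper_half_plane: "connected upper_half_plane"
  by (rule convex_connected[OF convex_upper_half_plane])

lemma Arg_upper: "z \<in> upper_half_plane \<Longrightarrow> 0 < Arg z \<and> Arg z < pi"
  using Arg_lt_pi by (simp add: upper_half_plane_simps)

lemma upper_nz: "z \<in> upper_half_plane \<Longrightarrow> z \<noteq> 0"
  by (auto simp: upper_half_plane_simps)

lemma upper_nonpos: "z \<in> upper_half_plane \<Longrightarrow> z \<notin> \<real>\<^sub>\<le>\<^sub>0"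
  by (auto simp: upper_half_plane_simps complex_nonpos_Reals_iff)

lemma neg_cnj_upper: "- cnj z \<in> upper_half_plane \<longleftrightarrow> z \<in> upper_half_plane"
  by (simp add: upper_half_plane_simps)

lemma holomorphic_on_reflect:
  assumes f: "f holomorphic_on S" and S: "open S"
  shows "(\<lambda>z. cnj (f (- cnj z))) holomorphic_on {z. - cnj z \<in> S}"
proof (rule holomorphic_onI)
  fix z assume "z \<in> {z. - cnj z \<in> S}"
  then have "- cnj z \<in> S" by simp
  from holomorphic_derivI[OF f S this]
  have "(f has_field_derivative deriv f (- cnj z)) (at (- cnj z))" .
  moreover have "(uminus has_field_derivative - 1) (at (cnj z))" by (auto intro!: derivative_eq_intros)
  ultimately have "((\<lambda>w. f (- w)) has_field_derivative - deriv f (- cnj z)) (at (cnj z))"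
    using DERIV_chain2[of f _ uminus "cnj z" "-1"] by simp
  from has_field_derivative_cnj_cnj[OF this]
  have "((\<lambda>z. cnj (f (- cnj z))) has_field_derivative cnj (- deriv f (- cnj z))) (at z)" by (simp add: o_def)
  then show "(\<lambda>z. cnj (f (- cnj z))) field_differentiable at z within {z. - cnj z \<in> S}"
    unfolding field_differentiable_def using has_field_derivative_at_within by blast
qed

context stable_index begin

lemma bpi: "0 < b * pi" "b * pi < pi"
  using b by auto

lemma Arg_g_upper:
  assumes "y = 0 \<or> 0 \<le> Arg y \<and> Arg y \<le> b * pi" "g y \<noteq> 0"
  shows "- (b * pi) \<le> Arg (g y)" "Arg (g y) \<le> 0"
  using Arg_cone[OF b stable_integral_in_cone[OF b assms(1)] assms(2)] .

lemma Arg_g_lower: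
  assumes "y = 0 \<or> Arg y \<le> 0 \<and> - (b * pi) \<le> Arg y" "g y \<noteq> 0"
  shows "0 \<le> Arg (g y)" "Arg (g y) \<le> b * pi"
proof -
  have "Arg y \<noteq> pi" if "y \<noteq> 0" using assms(1) that pi_gt_zero by linarith
  then have 1: "cnj y = 0 \<or> 0 \<le> Arg (cnj y) \<and> Arg (cnj y) \<le> b * pi"
    using assms(1) by (auto simp: Arg_cnj_minus)
  have 2: "g (cnj y) \<noteq> 0" using assms(2) by (simp add: g_cnj)
  have 3: "Arg (cnj (g y)) \<le> 0" "- (b * pi) \<le> Arg (cnj (g y))"
    using Arg_g_upper[OF 1 2] by (simp_all add: g_cnj)
  then show "0 \<le> Arg (g y)" "Arg (g y) \<le> b * pi"
  proof -
    have "Arg (g y) \<noteq> pi"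
    proof
      assume "Arg (g y) = pi"
      then have "Arg (cnj (g y)) = pi" by (simp add: Arg_cnj Arg_eq_pi_iff)
      then show False using 3 pi_gt_zero by linarith
    qed
    then show "0 \<le> Arg (g y)" "Arg (g y) \<le> b * pi" using 3 by (simp_all add: Arg_cnj_minus)
  qed
qed

lemma Arg_g:
  assumes "y \<in> sector b" "g y \<noteq> 0"
  shows "\<bar>Arg (g y)\<bar> \<le> b * pi"
  using assms Arg_g_upper[of y] Arg_g_lower[of y] bpi
  by (cases "y = 0"; cases "Arg y \<ge> 0") (auto simp: sector_def abs_le_iff)

lemma sector_nonpos: "y \<in> sector b \<Longrightarrow> y \<noteq> 0 \<Longrightarrow> y \<notin> \<real>\<^sub>\<le>\<^sub>0"
  using bpi by (auto simp: sector_def nonpos_Reals_def Arg_real)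

end

text \<open>In the application \<open>\<gamma>\<close> is \<open>Gamma (1 - b) / Gamma b\<close>,
  the modulus of \<open>C_stable (2 * b)\<close>, and \<open>cis (b * pi)\<close> is the power of
  \<open>\<i>\<close> in it.\<close>

locale stable_solution = stable_index +
  fixes Y :: "complex \<Rightarrow> complex" and \<gamma> :: real
  assumes \<gamma>: "\<gamma> > 0"
    and Y_hol: "Y holomorphic_on upper_half_plane"
    and Y_eq: "\<And>z. z \<in> upper_half_plane \<Longrightarrow>
        z powr of_real (2 * b) * Y z = cis (b * pi) * of_real \<gamma> * g (Y z)"
    and Y_inf: "(Y \<longlongrightarrow> 0) (inf at_infinity (principal upper_half_plane))"
begin

lemma Y_nz: "z \<in> upper_half_plane \<Longrightarrow> Y z \<noteq> 0"
  using Y_eq[of z] g_0 \<gamma> by auto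

lemma gY_nz: "z \<in> upper_half_plane \<Longrightarrow> g (Y z) \<noteq> 0"
  using Y_eq[of z] Y_nz[of z] upper_nz[of z] by auto

lemma isCont_Y: "z \<in> upper_half_plane \<Longrightarrow> isCont Y z"
  using holomorphic_on_imp_continuous_on[OF Y_hol] continuous_on_eq_continuous_at[OF open_upper_half_plane]
  by blast

text \<open>The difference of the arguments of the two sides of the equation for \<open>Y\<close>:
  always a multiple of \<open>2 pi\<close>, and continuous wherever \<open>Y\<close> lies in the
  sector, which keeps \<open>Y\<close> and \<open>g(Y)\<close> off the cut.\<close>

definition phase_defect :: "complex \<Rightarrow> real" where
  "phase_defect z = 2 * b * Arg z + Arg (Y z) - b * pi - Arg (g (Y z))"

lemma cis_phase_defect:
  assumes z: "z \<in> upper_half_plane"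
  shows "cis (phase_defect z) = 1"
proof -
  have "sgn (z powr of_real (2 * b) * Y z) = sgn (cis (b * pi) * of_real \<gamma> * g (Y z))"
    using Y_eq[OF z] by simp
  then have "cis (2 * b * Arg z) * cis (Arg (Y z)) = cis (b * pi) * cis (Arg (g (Y z)))"
    unfolding sgn_mult sgn_powr_real[OF upper_nz[OF z]] using z Y_nz gY_nz \<gamma>
    by (simp add: cis_Arg sgn_of_real)
  then show ?thesis
    by (simp add: phase_defect_def cis_mult cis_divide[symmetric] add.commute)
qed

lemma isCont_Arg_Y: "z \<in> upper_half_plane \<Longrightarrow> Y z \<in> sector b \<Longrightarrow> isCont (\<lambda>z. Arg (Y z)) z"
  by (intro isCont_o2[OF isCont_Y continuous_at_Arg] sector_nonpos Y_nz)

lemma isCont_phase_defect: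
  assumes z: "z \<in> upper_half_plane" "Y z \<in> sector b"
  shows "isCont phase_defect z"
proof -
  have "\<bar>Arg (g (Y z))\<bar> \<le> b * pi" using Arg_g[OF z(2) gY_nz[OF z(1)]] .
  then have "g (Y z) \<in> sector b" by (simp add: sector_def)
  from sector_nonpos[OF this gY_nz[OF z(1)]]
  have "isCont (\<lambda>z. Arg (g (Y z))) z"
    by (intro isCont_o2[OF isCont_o2[OF isCont_Y[OF z(1)] isCont_g] continuous_at_Arg])
  then show ?thesis unfolding phase_defect_def[abs_def]
    by (intro continuous_intros isCont_Arg_Y z continuous_at_Arg upper_nonpos)
qed

lemma Y_interior:
  assumes z: "z \<in> upper_half_plane"
  shows "\<bar>Arg (Y z)\<bar> < b * pi" "phase_defect z = 0"
proof -
  \<comment> \<open>This set is open and closed in the upper half-plane. The strict inequality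
    serves openness; carrying the zero defect along is what rules out the edges in the
    limit.\<close>
  define \<Omega> where "\<Omega> = {z \<in> upper_half_plane. \<bar>Arg (Y z)\<bar> < b * pi \<and> phase_defect z = 0}"
  have sec: "Y z \<in> sector b" if "z \<in> \<Omega>" for z using that by (auto simp: \<Omega>_def sector_def)
  have "open \<Omega>"
  proof (rule Topological_Spaces.openI)
    fix z assume z: "z \<in> \<Omega>"
    then have zU: "z \<in> upper_half_plane" by (simp add: \<Omega>_def)
    have "eventually (\<lambda>w. \<bar>Arg (Y w)\<bar> < b * pi) (nhds z)"
      using z by (intro order_tendstoD(2)[OF tendsto_rabs[OF isCont_tendsto_nhds[OF isCont_Arg_Y[OF zU sec[OF z]]]]])
        (simp add: \<Omega>_def)
    moreover have "eventually (\<lambda>w. \<bar>phase_defect w\<bar> < 2 * pi) (nhds z)"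
      using z by (intro order_tendstoD(2)[OF tendsto_rabs[OF isCont_tendsto_nhds[OF isCont_phase_defect[OF zU sec[OF z]]]]])
        (simp add: \<Omega>_def)
    moreover have "eventually (\<lambda>w. w \<in> upper_half_plane) (nhds z)"
      using zU open_upper_half_plane by (simp add: eventually_nhds_in_open)
    ultimately have "eventually (\<lambda>w. w \<in> \<Omega>) (nhds z)"
    proof eventually_elim
      case (elim w)
      then show ?case using cis_eq_1_small[OF cis_phase_defect] by (simp add: \<Omega>_def)
    qed
    then show "\<exists>T. open T \<and> z \<in> T \<and> T \<subseteq> \<Omega>"
      unfolding eventually_nhds by (metis subsetI)
  qed
  then have "openin (top_of_set upper_half_plane) \<Omega>"
    by (intro open_subset) (auto simp: \<Omega>_def)
  moreover have "closedin (top_of_set upper_half_plane) \<Omega>"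
    unfolding closedin_limpt
  proof (intro conjI allI impI)
    show "\<Omega> \<subseteq> upper_half_plane" by (auto simp: \<Omega>_def)
    fix z assume z: "z islimpt \<Omega> \<and> z \<in> upper_half_plane"
    then have zU: "z \<in> upper_half_plane" by blast
    from z obtain x where x: "\<And>n. x n \<in> \<Omega>" "x \<longlonglongrightarrow> z"
      unfolding islimpt_sequential by blast
    have "(\<lambda>n. Y (x n)) \<longlonglongrightarrow> Y z" by (rule isCont_tendsto_compose[OF isCont_Y[OF zU] x(2)])
    then have Ys: "Y z \<in> sector b"
      by (rule closed_sequentially[OF closed_sector[OF b], rotated]) (use sec x in auto)
    have "(\<lambda>n. phase_defect (x n)) \<longlonglongrightarrow> phase_defect z"
      by (rule isCont_tendsto_compose[OF isCont_phase_defect[OF zU Ys] x(2)])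
    moreover have "phase_defect (x n) = 0" for n using x(1)[of n] by (simp add: \<Omega>_def)
    ultimately have pd: "phase_defect z = 0" by (simp add: LIMSEQ_const_iff)
    have le: "\<bar>Arg (Y z)\<bar> \<le> b * pi" using Ys Y_nz[OF zU] by (simp add: sector_def)
    have A: "0 < b * Arg z" "b * Arg z < b * pi"
      using Arg_upper[OF zU] b by auto
    \<comment> \<open>On the upper edge zero defect reads
      \<open>2 b Arg z = Arg (g (Y z)) \<le> 0\<close>, on the lower edge
      \<open>2 b Arg z = 2 b pi + Arg (g (Y z)) \<ge> 2 b pi\<close>. Both contradict
      \<open>0 < Arg z < pi\<close>.\<close>
    have "Arg (Y z) \<noteq> b * pi"
    proof
      assume eq: "Arg (Y z) = b * pi"
      then have "Arg (g (Y z)) \<le> 0" using bpi gY_nz[OF zU] by (intro Arg_g_upper) auto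
      then show False using pd eq A unfolding phase_defect_def by simp
    qed
    moreover have "Arg (Y z) \<noteq> - (b * pi)"
    proof
      assume eq: "Arg (Y z) = - (b * pi)"
      then have "0 \<le> Arg (g (Y z))" using bpi gY_nz[OF zU] by (intro Arg_g_lower) auto
      then show False using pd eq A unfolding phase_defect_def by simp
    qed
    ultimately show "z \<in> \<Omega>" using le pd zU by (auto simp: \<Omega>_def)
  qed
  \<comment> \<open>On the imaginary axis \<open>z^(2b)\<close> has the same argument
    \<open>b pi\<close> as the constant, so \<open>Y z\<close> is a positive multiple of
    \<open>g (Y z)\<close>; far out the latter is close to \<open>g 0 > 0\<close>.\<close>
  moreover have "\<Omega> \<noteq> {}"
  proof -
    have "filterlim (\<lambda>n. \<i> * of_real (real (Suc n))) (inf at_infinity (principal upper_half_plane)) sequentially"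
      unfolding filterlim_inf filterlim_principal
    proof
      have "filterlim (\<lambda>n. real (Suc n)) at_top sequentially"
        by (rule filterlim_compose[OF filterlim_real_sequentially filterlim_Suc])
      then show "filterlim (\<lambda>n. \<i> * of_real (real (Suc n))) at_infinity sequentially"
        by (intro filterlim_norm_at_top_imp_at_infinity) (simp add: norm_mult del: of_nat_Suc)
    qed (simp add: upper_half_plane_simps)
    from filterlim_compose[OF Y_inf this] have "(\<lambda>n. Y (\<i> * of_real (real (Suc n)))) \<longlonglongrightarrow> 0" .
    from isCont_tendsto_compose[OF isCont_g this]
    have lim: "(\<lambda>n. g (Y (\<i> * of_real (real (Suc n))))) \<longlonglongrightarrow> g 0" .
    obtain G where G: "G > 0" "g 0 = of_real G" using g_pos[of 0] by auto
    have "g 0 \<notin> \<real>\<^sub>\<le>\<^sub>0" using G by (simp add: complex_nonpos_Reals_iff)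
    from tendsto_rabs[OF isCont_tendsto_compose[OF continuous_at_Arg[OF this] lim]]
    have "(\<lambda>n. \<bar>Arg (g (Y (\<i> * of_real (real (Suc n)))))\<bar>) \<longlonglongrightarrow> 0" using G by simp
    from order_tendstoD(2)[OF this bpi(1)]
    obtain n where n: "\<bar>Arg (g (Y (\<i> * of_real (real (Suc n)))))\<bar> < b * pi"
      by (meson eventually_sequentially order_refl)
    define z where "z = \<i> * of_real (real (Suc n))"
    have zU: "z \<in> upper_half_plane" by (simp add: z_def upper_half_plane_simps)
    have Az: "Arg z = pi / 2" unfolding z_def using Arg_times_of_real2[of "real (Suc n)" \<i>] by simp
    define x where "x = real (Suc n) powr (2 * b)"
    have x: "x > 0" by (simp add: x_def)
    have zp: "z powr of_real (2 * b) = of_real x * cis (b * pi)"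
      unfolding powr_real_polar[OF upper_nz[OF zU]] Az by (simp add: x_def z_def norm_mult del: of_nat_Suc)
    have "cis (b * pi) * (of_real x * Y z) = cis (b * pi) * (of_real \<gamma> * g (Y z))"
      using Y_eq[OF zU] unfolding zp by (simp add: mult_ac)
    then have "of_real x * Y z = of_real \<gamma> * g (Y z)" by simp
    then have "Arg (of_real x * Y z) = Arg (of_real \<gamma> * g (Y z))" by simp
    then have "Arg (Y z) = Arg (g (Y z))" using x \<gamma> by simp
    then have "z \<in> \<Omega>" using n zU Az by (simp add: \<Omega>_def phase_defect_def z_def)
    then show ?thesis by auto
  qed
  ultimately have "\<Omega> = upper_half_plane"
    using connected_upper_half_plane unfolding connected_clopen by blast
  then show "\<bar>Arg (Y z)\<bar> < b * pi" "phase_defect z = 0" using z by (auto simp: \<Omega>_def)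
qed

lemma Y_sector: "z \<in> upper_half_plane \<Longrightarrow> Y z \<in> sector b"
  using Y_interior[of z] by (simp add: sector_def)

text \<open>The reflected function \<open>V\<close> solves the same equation: the reflection changes
  \<open>z^(2b)\<close> by the factor \<open>cis (- 2 b pi)\<close>, which turns the conjugate
  constant back into the original one. Near infinity both solutions are small and
  \<open>y / g y\<close> is injective near 0, so they agree there, and everywhere by
  continuation.\<close>

lemma Y_symmetric:
  assumes z: "z \<in> upper_half_plane"
  shows "Y (- cnj z) = cnj (Y z)"
proof -
  define V where "V z = cnj (Y (- cnj z))" for z
  have V_hol: "V holomorphic_on upper_half_plane"
    using holomorphic_on_reflect[OF Y_hol open_upper_half_plane]
    by (simp add: V_def[abs_def] neg_cnj_upper)
  have V_eq: "z powr of_real (2 * b) * V z = cis (b * pi) * of_real \<gamma> * g (V z)"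
    if z: "z \<in> upper_half_plane" for z
  proof -
    have z': "- cnj z \<in> upper_half_plane" using z by (simp add: neg_cnj_upper)
    have Az: "Arg (- cnj z) = pi - Arg z"
      using Arg_upper[OF z] upper_nz[OF z] by (simp add: Arg_minus Arg_cnj complex_is_Real_iff)
         (use z in \<open>auto simp: upper_half_plane_simps\<close>)
    have "cnj ((- cnj z) powr of_real (2 * b)) = of_real (norm z powr (2 * b)) * cis (- (2 * b * Arg (- cnj z)))"
      using powr_real_polar[OF upper_nz[OF z'], of "2 * b"] by (simp add: cis_cnj)
    also have "- (2 * b * Arg (- cnj z)) = 2 * b * Arg z - 2 * (b * pi)"
      unfolding Az by (simp add: algebra_simps)
    also have "of_real (norm z powr (2 * b)) * cis (2 * b * Arg z - 2 * (b * pi)) =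
        z powr of_real (2 * b) * cis (- (2 * (b * pi)))"
      using powr_real_polar[OF upper_nz[OF z], of "2 * b"] by (simp add: cis_mult mult.assoc)
    finally have 1: "cnj ((- cnj z) powr of_real (2 * b)) = z powr of_real (2 * b) * cis (- (2 * (b * pi)))" .
    have "cnj ((- cnj z) powr of_real (2 * b) * Y (- cnj z)) = cnj (cis (b * pi) * of_real \<gamma> * g (Y (- cnj z)))"
      using Y_eq[OF z'] by simp
    then have "z powr of_real (2 * b) * cis (- (2 * (b * pi))) * V z = cis (- (b * pi)) * of_real \<gamma> * g (V z)"
      unfolding complex_cnj_mult 1 by (simp add: V_def g_cnj cis_cnj)
    then have "cis (2 * (b * pi)) * (z powr of_real (2 * b) * cis (- (2 * (b * pi))) * V z) =
        cis (2 * (b * pi)) * (cis (- (b * pi)) * of_real \<gamma> * g (V z))" by simp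
    then have "(cis (2 * (b * pi)) * cis (- (2 * (b * pi)))) * (z powr of_real (2 * b) * V z) =
        (cis (2 * (b * pi)) * cis (- (b * pi))) * (of_real \<gamma> * g (V z))"
      by (simp only: mult_ac)
    then show ?thesis by (simp add: cis_mult ac_simps)
  qed
  have V_inf: "(V \<longlongrightarrow> 0) (inf at_infinity (principal upper_half_plane))"
  proof -
    have "filterlim (\<lambda>z. - cnj z) (inf at_infinity (principal upper_half_plane)) (inf at_infinity (principal upper_half_plane))"
      unfolding filterlim_inf filterlim_principal
    proof
      have "filterlim (\<lambda>z. norm (- cnj z)) at_top (inf at_infinity (principal upper_half_plane))"
        using filterlim_mono[OF filterlim_norm_at_top order_refl inf_le1] by simp
      then show "filterlim (\<lambda>z. - cnj z) at_infinity (inf at_infinity (principal upper_half_plane))"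
        by (rule filterlim_norm_at_top_imp_at_infinity)
    qed (simp add: eventually_inf_principal neg_cnj_upper)
    from tendsto_cnj[OF filterlim_compose[OF Y_inf this]] show ?thesis by (simp add: V_def[abs_def])
  qed
  have g_open: "open {y. g y \<noteq> 0}"
    using stable_integral_continuous[of b "b - 1" 1 UNIV] b
    by (intro open_Collect_neq continuous_intros) auto
  have k_hol: "(\<lambda>y. y / g y) holomorphic_on {y. g y \<noteq> 0}"
    by (intro holomorphic_intros) auto
  have "((\<lambda>y. y / g y) has_field_derivative (1 * g 0 - 0 * deriv g 0) / (g 0 * g 0)) (at 0)"
    using g_0 by (intro DERIV_divide DERIV_ident holomorphic_derivI[of g UNIV]) (auto intro: holomorphic_intros)
  then have "deriv (\<lambda>y. y / g y) 0 \<noteq> 0"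
    using g_0 by (auto dest: DERIV_imp_deriv)
  then obtain r where r: "r > 0" "ball 0 r \<subseteq> {y. g y \<noteq> 0}" "inj_on (\<lambda>y. y / g y) (ball 0 r)"
    using has_complex_derivative_locally_injective[OF k_hol _ g_open] g_0 by auto
  have "eventually (\<lambda>z. z \<in> upper_half_plane \<longrightarrow> norm (Y z) < r \<and> norm (V z) < r) at_infinity"
    using tendstoD[OF Y_inf r(1)] tendstoD[OF V_inf r(1)] by (simp add: eventually_inf_principal eventually_conj_iff[symmetric])
       (auto elim: eventually_elim2)
  then obtain M where M: "\<And>z. norm z \<ge> M \<Longrightarrow> z \<in> upper_half_plane \<Longrightarrow> norm (Y z) < r \<and> norm (V z) < r"
    unfolding eventually_at_infinity by blast
  define W where "W = upper_half_plane \<inter> - cball 0 (max M 1)"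
  have eqW: "Y z = V z" if z: "z \<in> W" for z
  proof (rule inj_onD[OF r(3)])
    have zU: "z \<in> upper_half_plane" and zM: "norm z \<ge> M" using z by (auto simp: W_def)
    show in_ball: "Y z \<in> ball 0 r" "V z \<in> ball 0 r" using M[OF zM zU] by auto
    then have nz: "g (Y z) \<noteq> 0" "g (V z) \<noteq> 0" using r(2) by auto
    have zp: "z powr of_real (2 * b) \<noteq> 0" using upper_nz[OF zU] by simp
    have "Y z / g (Y z) = cis (b * pi) * of_real \<gamma> / z powr of_real (2 * b)"
      using Y_eq[OF zU] nz zp by (simp add: field_simps)
    moreover have "V z / g (V z) = cis (b * pi) * of_real \<gamma> / z powr of_real (2 * b)"
      using V_eq[OF zU] nz zp by (simp add: field_simps)
    ultimately show "Y z / g (Y z) = V z / g (V z)" by simp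
  qed
  have W: "open W" "W \<subseteq> upper_half_plane" "\<i> * of_real (max M 1 + 1) \<in> W"
    using open_upper_half_plane by (auto simp: W_def norm_mult upper_half_plane_simps intro!: open_Int)
  have "Y z - V z = 0"
  proof (rule analytic_continuation[OF _ open_upper_half_plane connected_upper_half_plane W(2) _ _ _ z])
    show "(\<lambda>z. Y z - V z) holomorphic_on upper_half_plane" by (intro holomorphic_intros Y_hol V_hol)
    show "\<i> * of_real (max M 1 + 1) islimpt W"
      using W by (intro interior_limit_point) (simp add: interior_open)
  qed (use W eqW in auto)
  then have "cnj (V z) = cnj (Y z)" by simp
  then show ?thesis by (simp add: V_def)
qed

end

section \<open>Boundary values\<close>

text \<open>Trapping by connectedness. It serves for the distance of \<open>Y\<close> to a candidate
  boundary value and for \<open>- norm (Y z)\<close> near 0.\<close>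

lemma connected_real_avoid:
  fixes f :: "'a :: topological_space \<Rightarrow> real"
  assumes "connected U" "continuous_on U f" "\<And>z. z \<in> U \<Longrightarrow> f z \<noteq> c" "z1 \<in> U" "f z1 < c" "z \<in> U"
  shows "f z < c"
proof (rule ccontr)
  assume "\<not> f z < c"
  then have "c \<in> f ` U"
    using connectedD_interval[OF connected_continuous_image[OF assms(2,1)], of "f z1" "f z" c] assms(4-6) by auto
  then show False using assms(3) by auto
qed

text \<open>Only limits along \<open>A\<close> are given. A point \<open>w\<close> of
  \<open>B\<close> near \<open>x\<close> is compared with a point \<open>z\<close> of
  \<open>A\<close> still closer to \<open>w\<close>, whose value is within \<open>e/2\<close> of
  both \<open>F w\<close> and \<open>F x\<close>.\<close>

lemma continuous_on_Un_of_limits: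
  fixes F :: "'a :: metric_space \<Rightarrow> 'b :: metric_space"
  assumes lim: "\<And>x. x \<in> A \<union> B \<Longrightarrow> (F \<longlongrightarrow> F x) (at x within A)" and B: "\<And>x. x \<in> B \<Longrightarrow> x islimpt A"
  shows "continuous_on (A \<union> B) F"
  unfolding continuous_on_iff
proof (intro ballI allI impI)
  fix x and e :: real assume x: "x \<in> A \<union> B" and e: "e > 0"
  obtain d where d: "d > 0" "\<And>z. z \<in> A \<Longrightarrow> 0 < dist z x \<Longrightarrow> dist z x < d \<Longrightarrow> dist (F z) (F x) < e/2"
    using lim[OF x] e unfolding Lim_within by (metis half_gt_zero)
  have dA: "dist (F z) (F x) < e/2" if "z \<in> A" "dist z x < d" for z
    using d(2)[OF that(1)] that(2) e by (cases "z = x") auto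
  have "dist (F w) (F x) < e" if w: "w \<in> A \<union> B" "dist w x < d" for w
  proof (cases "w \<in> A")
    case True
    then show ?thesis using dA[OF True w(2)] e by simp
  next
    case False
    then have "w \<in> B" using w by auto
    obtain d2 where d2: "d2 > 0" "\<And>z. z \<in> A \<Longrightarrow> 0 < dist z w \<Longrightarrow> dist z w < d2 \<Longrightarrow> dist (F z) (F w) < e/2"
      using lim[OF w(1)] e unfolding Lim_within by (metis half_gt_zero)
    have "min d2 (d - dist w x) > 0" using d2 w by simp
    then obtain z where z: "z \<in> A" "z \<noteq> w" "dist z w < min d2 (d - dist w x)"
      using B[OF \<open>w \<in> B\<close>] unfolding islimpt_approachable by blast
    have "dist z x < d" using dist_triangle[of z x w] z(3) by simp
    from dA[OF z(1) this] d2(2)[OF z(1)] z show ?thesis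
      using dist_triangle2[of "F w" "F x" "F z"] by (simp add: dist_commute)
  qed
  then show "\<exists>d>0. \<forall>x'\<in>A \<union> B. dist x' x < d \<longrightarrow> dist (F x') (F x) < e" using d(1) by blast
qed

lemma of_real_islimpt_upper: "complex_of_real t islimpt upper_half_plane"
  unfolding islimpt_approachable
proof (intro allI impI)
  fix e :: real assume e: "e > 0"
  show "\<exists>x'\<in>upper_half_plane. x' \<noteq> complex_of_real t \<and> dist x' (complex_of_real t) < e"
    by (rule bexI[of _ "Complex t (e/2)"])
       (use e in \<open>auto simp: upper_half_plane_simps dist_norm complex_eq_iff cmod_def\<close>)
qed

lemma nontrivial_at_upper: "at (complex_of_real t) within upper_half_plane \<noteq> bot"
  using of_real_islimpt_upper by (simp add: trivial_limit_within)

context stable_solution begin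

abbreviation "cc \<equiv> cis (b * pi) * of_real \<gamma>"

lemma norm_Y_eq:
  assumes "z \<in> upper_half_plane"
  shows "norm z powr (2 * b) * norm (Y z) = \<gamma> * norm (g (Y z))"
proof -
  have "norm (z powr of_real (2 * b) * Y z) = norm (cc * g (Y z))" using Y_eq[OF assms] by simp
  then show ?thesis using \<gamma> unfolding norm_mult powr_real_polar[OF upper_nz[OF assms]] by simp
qed

lemma Y_bounded_away: 
  assumes "r > 0"
  shows "\<exists>M>0. \<forall>z\<in>upper_half_plane. norm z \<ge> r \<longrightarrow> norm (Y z) \<le> M"
proof -
  obtain C where C: "C > 0" "\<And>y. y \<in> sector b \<Longrightarrow> norm (g y) \<le> C" using g_bounded by auto
  have "norm (Y z) \<le> \<gamma> * C / r powr (2 * b)" if z: "z \<in> upper_half_plane" "norm z \<ge> r" for z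
  proof -
    have "r powr (2 * b) * norm (Y z) \<le> norm z powr (2 * b) * norm (Y z)"
      using z assms b by (intro mult_right_mono powr_mono2) auto
    also have "\<dots> \<le> \<gamma> * C" unfolding norm_Y_eq[OF z(1)]
      using C(2)[OF Y_sector[OF z(1)]] \<gamma> by simp
    finally show ?thesis using assms by (simp add: field_simps)
  qed
  then show ?thesis using C \<gamma> assms by (intro exI[of _ "\<gamma> * C / r powr (2 * b)"]) auto
qed

lemma Y_limit_pos:
  assumes t: "t > 0"
  shows "\<exists>y\<in>sector b. (Y \<longlongrightarrow> y) (at (of_real t) within upper_half_plane) \<and>
     of_real (t powr (2 * b)) * y = cc * g y"
proof -
  define T where "T = complex_of_real t powr of_real (2 * b)"
  have T: "T = of_real (t powr (2 * b))" using t unfolding T_def by (intro powr_of_real) auto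
  have cont: "isCont (\<lambda>z. z powr of_real (2 * b)) (complex_of_real t)"
    using t by (intro continuous_intros) auto
  define w where "w n = Complex t (1 / real (Suc n))" for n
  have wU: "w n \<in> upper_half_plane" for n by (simp add: w_def upper_half_plane_simps)
  have "(\<lambda>n. 1 / real (Suc n)) \<longlonglongrightarrow> 0" by (rule LIMSEQ_Suc[OF lim_const_over_n[of 1, simplified]])
  then have "w \<longlonglongrightarrow> Complex t 0" unfolding w_def by (intro tendsto_Complex tendsto_const)
  then have w: "w \<longlonglongrightarrow> of_real t" by (simp add: complex_of_real_def)
  have t2: "t / 2 > 0" using t by simp
  from Y_bounded_away[OF t2] obtain M where M: "M > 0"
    "\<And>z. z \<in> upper_half_plane \<Longrightarrow> norm z \<ge> t/2 \<Longrightarrow> norm (Y z) \<le> M" by blast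
  have "norm (w n) \<ge> t/2" for n using abs_Re_le_cmod[of "w n"] t by (simp add: w_def)
  then have "\<forall>n. Y (w n) \<in> cball 0 M" using M(2)[OF wU] by simp
  then obtain y0 \<phi> where \<phi>: "strict_mono \<phi>" "((\<lambda>n. Y (w n)) \<circ> \<phi>) \<longlonglongrightarrow> y0"
    using compact_cball[of "0::complex" M] unfolding compact_def by metis
  then have y0: "(\<lambda>n. Y (w (\<phi> n))) \<longlonglongrightarrow> y0" by (simp add: o_def)
  have w\<phi>: "(\<lambda>n. w (\<phi> n)) \<longlonglongrightarrow> of_real t" using LIMSEQ_subseq_LIMSEQ[OF w \<phi>(1)] by (simp add: o_def)
  have sec: "y0 \<in> sector b"
    by (rule closed_sequentially[OF closed_sector[OF b] _ y0]) (rule Y_sector[OF wU])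
  \<comment> \<open>Its zeros are the possible boundary values at \<open>t\<close>. They are
    isolated, because \<open>E\<close> is entire and \<open>E 0 \<noteq> 0\<close>.\<close>
  define E where "E y = cc * g y - T * y" for y
  have "(\<lambda>n. cc * g (Y (w (\<phi> n)))) \<longlonglongrightarrow> cc * g y0"
    by (intro tendsto_intros isCont_tendsto_compose[OF isCont_g] y0)
  moreover have "(\<lambda>n. w (\<phi> n) powr of_real (2 * b) * Y (w (\<phi> n))) \<longlonglongrightarrow> T * y0"
    unfolding T_def by (intro tendsto_mult isCont_tendsto_compose[OF cont w\<phi>] y0)
  ultimately have eq: "T * y0 = cc * g y0"
    unfolding Y_eq[OF wU] using LIMSEQ_unique by blast
  then have E0: "E y0 = 0" by (simp add: E_def)
  have E_hol: "E holomorphic_on UNIV" unfolding E_def by (intro holomorphic_intros)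
  have "E 0 \<noteq> 0" using g_0 \<gamma> by (simp add: E_def)
  from isolated_zeros[OF E_hol open_UNIV connected_UNIV UNIV_I E0 UNIV_I this]
  obtain r where r: "r > 0" "\<And>z. z \<in> ball y0 r - {y0} \<Longrightarrow> E z \<noteq> 0" by metis
  have "(Y \<longlongrightarrow> y0) (at (of_real t) within upper_half_plane)"
    unfolding Lim_within
  proof (intro allI impI)
    fix e :: real assume e: "e > 0"
    \<comment> \<open>A circle inside the disc of isolation: \<open>E\<close> has no zero on it and
      so a positive minimum of modulus there.\<close>
    define e' where "e' = min e r / 2"
    have e': "e' > 0" "e' < e" "e' < r" using e r by (auto simp: e'_def)
    have "continuous_on (sphere y0 e') (\<lambda>y. norm (E y))"
      using E_hol by (intro continuous_intros holomorphic_on_imp_continuous_on) (rule holomorphic_on_subset, auto)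
    from continuous_attains_inf[OF compact_sphere _ this] e'
    obtain s where s: "s \<in> sphere y0 e'" "\<And>y. y \<in> sphere y0 e' \<Longrightarrow> norm (E s) \<le> norm (E y)" by auto
    have "E s \<noteq> 0" using s(1) e' by (intro r) (auto simp: dist_commute)
    then have m: "norm (E s) / M > 0" using M by simp
    have "eventually (\<lambda>z. dist (z powr of_real (2 * b)) T < norm (E s) / M) (nhds (of_real t))"
      using tendstoD[OF isCont_tendsto_nhds[OF cont] m] by (simp add: T_def)
    then obtain d where d: "d > 0" "\<And>z. dist z (of_real t) < d \<Longrightarrow> dist (z powr of_real (2 * b)) T < norm (E s) / M"
      unfolding eventually_nhds_metric by blast
    define \<delta> where "\<delta> = min d (t/2)"
    have \<delta>: "\<delta> > 0" using d t by (simp add: \<delta>_def)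
    define U where "U = upper_half_plane \<inter> ball (of_real t) \<delta>"
    have U: "connected U" unfolding U_def
      by (intro convex_connected convex_Int convex_upper_half_plane convex_ball)
    have contU: "continuous_on U (\<lambda>z. dist (Y z) y0)"
      using holomorphic_on_imp_continuous_on[OF Y_hol] unfolding U_def
      by (intro continuous_intros) (auto intro: continuous_on_subset)
    \<comment> \<open>Since \<open>E (Y z) = (z^(2b) - t^(2b)) * Y z\<close> and
      \<open>norm (Y z) \<le> M\<close>, near \<open>t\<close> this falls below the minimum on the
      circle, so \<open>Y\<close> cannot cross it.\<close>
    have avoid: "dist (Y z) y0 \<noteq> e'" if z: "z \<in> U" for z
    proof
      assume "dist (Y z) y0 = e'"
      then have "norm (E s) \<le> norm (E (Y z))" by (intro s) (simp add: dist_commute)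
      also have zU: "z \<in> upper_half_plane" and zd: "dist z (of_real t) < d" "dist z (of_real t) < t/2"
        using z by (auto simp: U_def \<delta>_def dist_commute)
      have "E (Y z) = (z powr of_real (2 * b) - T) * Y z"
        unfolding E_def Y_eq[OF zU, symmetric] by (simp add: algebra_simps)
      also have "norm \<dots> < norm (E s) / M * M"
      proof -
        have "norm z \<ge> t/2" using zd(2) norm_triangle_ineq2[of "of_real t" z] t
          by (simp add: dist_norm norm_minus_commute)
        then have "norm (Y z) \<le> M" using M zU by blast
        moreover have "norm (z powr of_real (2 * b) - T) < norm (E s) / M"
          using d(2)[OF zd(1)] by (simp add: dist_norm)
        ultimately have "norm (z powr of_real (2 * b) - T) * norm (Y z) < norm (E s) / M * M"
          using Y_nz[OF zU] m by (intro less_le_trans[OF mult_strict_right_mono mult_left_mono]) auto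
        then show ?thesis by (simp add: norm_mult)
      qed
      finally show False using M by simp
    qed
    have "eventually (\<lambda>n. dist (w (\<phi> n)) (of_real t) < \<delta>) sequentially" by (rule tendstoD[OF w\<phi> \<delta>])
    moreover have "eventually (\<lambda>n. dist (Y (w (\<phi> n))) y0 < e') sequentially" by (rule tendstoD[OF y0 e'(1)])
    ultimately have "eventually (\<lambda>n. dist (w (\<phi> n)) (of_real t) < \<delta> \<and> dist (Y (w (\<phi> n))) y0 < e') sequentially"
      by (rule eventually_conj)
    from eventually_happens'[OF sequentially_bot this]
    obtain n where n: "dist (w (\<phi> n)) (of_real t) < \<delta>" "dist (Y (w (\<phi> n))) y0 < e'" by blast
    have wn: "w (\<phi> n) \<in> U" using n wU by (simp add: U_def dist_commute)
    have "dist (Y z) y0 < e'" if "z \<in> U" for z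
      by (rule connected_real_avoid[OF U contU avoid wn n(2) that])
    then show "\<exists>d>0. \<forall>z\<in>upper_half_plane. 0 < dist z (of_real t) \<and> dist z (of_real t) < d \<longrightarrow> dist (Y z) y0 < e"
      using \<delta> e'(2) by (intro exI[of _ \<delta>]) (fastforce simp: U_def dist_commute)
  qed
  then show ?thesis using sec eq unfolding T by blast
qed

text \<open>\<open>Lim\<close> selects the boundary value; it is meaningful at the nonzero reals,
  where the limit is shown to exist.\<close>

definition Ye :: "complex \<Rightarrow> complex" where
  "Ye z = (if z \<in> upper_half_plane then Y z else Lim (at z within upper_half_plane) Y)"

lemma Ye_upper: "z \<in> upper_half_plane \<Longrightarrow> Ye z = Y z"
  by (simp add: Ye_def)

lemma Ye_eqI: "(Y \<longlongrightarrow> y) (at (of_real t) within upper_half_plane) \<Longrightarrow> Ye (of_real t) = y"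
  using tendsto_Lim[OF nontrivial_at_upper] by (simp add: Ye_def upper_half_plane_simps)

lemma Ye_pos:
  assumes "t > 0"
  shows "Ye (of_real t) \<in> sector b"
    and "(Y \<longlongrightarrow> Ye (of_real t)) (at (of_real t) within upper_half_plane)"
    and "of_real (t powr (2 * b)) * Ye (of_real t) = cc * g (Ye (of_real t))"
  using Y_limit_pos[OF assms] Ye_eqI by auto

text \<open>The cut of the power runs along the negative axis; the symmetry of \<open>Y\<close>
  transfers the limit from \<open>t\<close> to \<open>- t\<close> without using the equation
  there.\<close>

lemma Y_limit_neg:
  assumes "t > 0"
  shows "(Y \<longlongrightarrow> cnj (Ye (of_real t))) (at (of_real (- t)) within upper_half_plane)"
proof -
  have "filterlim (\<lambda>z. - cnj z) (at (of_real t) within upper_half_plane) (at (of_real (- t)) within upper_half_plane)"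
    unfolding filterlim_at
  proof
    have "((\<lambda>z. - cnj z) \<longlongrightarrow> - cnj (of_real (- t))) (at (of_real (- t)) within upper_half_plane)"
      by (intro tendsto_intros)
    then show "((\<lambda>z. - cnj z) \<longlongrightarrow> of_real t) (at (of_real (- t)) within upper_half_plane)" by simp
    show "eventually (\<lambda>z. - cnj z \<in> upper_half_plane \<and> - cnj z \<noteq> of_real t) (at (of_real (- t)) within upper_half_plane)"
      by (auto simp: eventually_at_filter upper_half_plane_simps complex_eq_iff)
  qed
  from tendsto_cnj[OF filterlim_compose[OF Ye_pos(2)[OF assms] this]]
  have "((\<lambda>z. cnj (Y (- cnj z))) \<longlongrightarrow> cnj (Ye (of_real t))) (at (of_real (- t)) within upper_half_plane)" .
  then show ?thesis
    by (rule Lim_transform_eventually) (auto simp: eventually_at_filter Y_symmetric)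
qed

lemma Ye_minus: "t \<noteq> 0 \<Longrightarrow> Ye (of_real (- t)) = cnj (Ye (of_real t))"
  using Ye_eqI[OF Y_limit_neg, of t] Ye_eqI[OF Y_limit_neg, of "- t"] by (cases "t > 0") auto

lemma Ye_limit:
  assumes "t \<noteq> 0"
  shows "(Y \<longlongrightarrow> Ye (of_real t)) (at (of_real t) within upper_half_plane)"
proof (cases "t > 0")
  case False
  then show ?thesis using Y_limit_neg[of "- t"] Ye_minus[of "- t"] assms by simp
qed (rule Ye_pos)

lemma continuous_on_Ye: "continuous_on (upper_half_plane \<union> (\<real> - {0})) Ye"
proof (rule continuous_on_Un_of_limits)
  fix x assume x: "x \<in> upper_half_plane \<union> (\<real> - {0})"
  have "(Y \<longlongrightarrow> Ye x) (at x within upper_half_plane)"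
  proof (cases "x \<in> upper_half_plane")
    case True
    then show ?thesis using tendsto_within_subset[OF isCont_Y[OF True, unfolded isCont_def] subset_UNIV]
      by (simp add: Ye_upper)
  next
    case False
    then obtain t where "x = of_real t" "t \<noteq> 0" using x by (auto elim!: Reals_cases)
    then show ?thesis using Ye_limit by simp
  qed
  then show "(Ye \<longlongrightarrow> Ye x) (at x within upper_half_plane)"
    by (rule Lim_transform_eventually) (auto simp: eventually_at_filter Ye_upper)
qed (auto elim!: Reals_cases intro: of_real_islimpt_upper)

lemma Ye_eq_pos: "t > 0 \<Longrightarrow> of_real (t powr (2 * b)) = cc * g (Ye (of_real t)) / Ye (of_real t)"
  and Ye_nz_pos: "t > 0 \<Longrightarrow> Ye (of_real t) \<noteq> 0"
proof -
  assume t: "t > 0"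
  show "Ye (of_real t) \<noteq> 0" using Ye_pos(3)[OF t] g_0 \<gamma> by auto
  then show "of_real (t powr (2 * b)) = cc * g (Ye (of_real t)) / Ye (of_real t)"
    using Ye_pos(3)[OF t] by (simp add: field_simps)
qed

lemma Ye_analytic_pos:
  assumes t: "t > 0" and crit: "g (Ye (of_real t)) \<noteq> Ye (of_real t) * deriv g (Ye (of_real t))"
  shows "analytic_at_within Ye (of_real t) (upper_half_plane \<union> (\<real> - {0}))"
proof -
  let ?S = "upper_half_plane \<union> (\<real> - {0})"
  define y0 where "y0 = Ye (of_real t)"
  have y0: "y0 \<noteq> 0" using Ye_nz_pos[OF t] by (simp add: y0_def)
  \<comment> \<open>The equation says \<open>k (Ye z) = z^(2b)\<close>. At
    \<open>y0 \<noteq> 0\<close> the derivative of \<open>k\<close> is a nonzero multiple of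
    \<open>y0 g' - g\<close>, so \<open>k\<close> is locally invertible off the critical
    points.\<close>
  define k where "k y = cc * g y / y" for y
  have k_hol: "k holomorphic_on - {0}" unfolding k_def by (intro holomorphic_intros) auto
  have gd: "(g has_field_derivative deriv g y0) (at y0)"
    by (rule holomorphic_derivI[of _ UNIV]) (auto intro!: holomorphic_intros)
  have "(k has_field_derivative (cc * deriv g y0 * y0 - cc * g y0 * 1) / (y0 * y0)) (at y0)"
    unfolding k_def using y0 by (intro DERIV_divide DERIV_cmult gd DERIV_ident)
  then have "deriv k y0 = cc * (y0 * deriv g y0 - g y0) / (y0 * y0)"
    by (simp add: DERIV_imp_deriv algebra_simps)
  then have kd: "deriv k y0 \<noteq> 0" using crit y0 \<gamma> by (simp add: y0_def)
  obtain r where r: "r > 0" "ball y0 r \<subseteq> - {0}" "open (k ` ball y0 r)" "inj_on k (ball y0 r)"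
    using has_complex_derivative_locally_invertible[OF k_hol _ _ kd] y0 by auto
  obtain j where j: "j holomorphic_on (k ` ball y0 r)" "\<And>z. z \<in> ball y0 r \<Longrightarrow> j (k z) = z"
    using holomorphic_has_inverse[OF holomorphic_on_subset[OF k_hol r(2)] open_ball r(4)] by metis
  have kt: "k y0 = of_real t powr of_real (2 * b)"
    using Ye_eq_pos[OF t] t by (simp add: k_def y0_def powr_of_real[of t "2*b", simplified])
  have cont: "isCont (\<lambda>z. z powr of_real (2 * b)) (complex_of_real t)"
    using t by (intro continuous_intros) auto
  have "eventually (\<lambda>z. z powr of_real (2 * b) \<in> k ` ball y0 r) (nhds (of_real t))"
  proof (rule topological_tendstoD[OF isCont_tendsto_nhds[OF cont] r(3)])
    show "of_real t powr of_real (2 * b) \<in> k ` ball y0 r"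
      unfolding kt[symmetric] using r(1) by (intro imageI) simp
  qed
  then obtain d1 where d1: "d1 > 0" "\<And>z. dist z (of_real t) < d1 \<Longrightarrow> z powr of_real (2 * b) \<in> k ` ball y0 r"
    unfolding eventually_nhds_metric by blast
  have "of_real t \<in> ?S" using t by auto
  then obtain d2 where d2: "d2 > 0" "\<And>z. z \<in> ?S \<Longrightarrow> dist z (of_real t) < d2 \<Longrightarrow> dist (Ye z) y0 < r"
    using continuous_on_Ye r(1) unfolding continuous_on_iff y0_def by blast
  \<comment> \<open>Within distance \<open>t\<close> of \<open>t\<close> the real part is positive,
    so the power is holomorphic; \<open>d1\<close> makes it a value of \<open>k\<close>, and
    \<open>d2\<close> keeps \<open>Ye z\<close> where \<open>j\<close> inverts
    \<open>k\<close>.\<close>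
  define d where "d = min t (min d1 d2)"
  have d: "d > 0" using t d1 d2 by (simp add: d_def)
  have pos: "Re z > 0" if "z \<in> ball (of_real t) d" for z
    using that abs_Re_le_cmod[of "of_real t - z"] by (simp add: d_def dist_norm) linarith
  show ?thesis unfolding analytic_at_within_def
  proof (intro exI conjI ballI)
    show "(\<lambda>z. j (z powr of_real (2 * b))) holomorphic_on ball (of_real t) d"
    proof (rule holomorphic_on_compose_gen[of _ _ j "k ` ball y0 r", unfolded o_def, OF _ j(1)])
      show "(\<lambda>z. z powr of_real (2 * b)) holomorphic_on ball (of_real t) d"
        using pos by (intro holomorphic_intros) (force simp: complex_nonpos_Reals_iff)
      show "(\<lambda>z. z powr of_real (2 * b)) ` ball (of_real t) d \<subseteq> k ` ball y0 r"
        using d1(2) by (auto simp: d_def dist_commute)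
    qed
    fix z assume z: "z \<in> ball (of_real t) d \<inter> ?S"
    have "z powr of_real (2 * b) = k (Ye z)"
    proof (cases "z \<in> upper_half_plane")
      case True
      then show ?thesis using Y_eq[OF True] Y_nz[OF True] by (simp add: k_def Ye_upper field_simps)
    next
      case False
      then obtain x where x: "z = of_real x" using z by (auto elim!: Reals_cases)
      then have "x > 0" using pos[of z] z by auto
      then show ?thesis using Ye_eq_pos[of x] by (simp add: x k_def powr_of_real[of x "2*b", simplified])
    qed
    moreover have "Ye z \<in> ball y0 r" using d2(2)[of z] z by (simp add: d_def dist_commute)
    ultimately show "j (z powr of_real (2 * b)) = Ye z" using j(2) by simp
  qed (rule d)
qed

lemma Ye_reflect:
  assumes "z \<in> upper_half_plane \<union> (\<real> - {0})"
  shows "Ye (- cnj z) = cnj (Ye z)"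
proof (cases "z \<in> upper_half_plane")
  case True
  then show ?thesis by (simp add: Ye_upper neg_cnj_upper Y_symmetric)
next
  case False
  then obtain x where "z = of_real x" "x \<noteq> 0" using assms by (auto elim!: Reals_cases)
  then show ?thesis using Ye_minus[of x] by simp
qed

lemma Ye_analytic_reflect:
  assumes "analytic_at_within Ye (of_real t) (upper_half_plane \<union> (\<real> - {0}))"
  shows "analytic_at_within Ye (of_real (- t)) (upper_half_plane \<union> (\<real> - {0}))"
proof -
  let ?S = "upper_half_plane \<union> (\<real> - {0})"
  obtain F r where F: "r > 0" "F holomorphic_on ball (of_real t) r" "\<And>z. z \<in> ball (of_real t) r \<inter> ?S \<Longrightarrow> F z = Ye z"
    using assms unfolding analytic_at_within_def by blast
  have ball: "- cnj z \<in> ball (of_real t) r \<longleftrightarrow> z \<in> ball (of_real (- t)) r" for z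
  proof -
    have "norm (of_real t - (- cnj z)) = norm (cnj (of_real t + z))" by simp
    also have "\<dots> = norm (of_real (- t) - z)" unfolding complex_mod_cnj
      by (metis minus_diff_eq norm_minus_cancel of_real_minus diff_minus_eq_add add.commute)
    finally show ?thesis by (simp add: dist_norm)
  qed
  have S: "- cnj z \<in> ?S" if "z \<in> ?S" for z
    using that by (auto simp: neg_cnj_upper elim!: Reals_cases)
  show ?thesis unfolding analytic_at_within_def
  proof (intro exI conjI ballI)
    show "(\<lambda>z. cnj (F (- cnj z))) holomorphic_on ball (of_real (- t)) r"
      using holomorphic_on_reflect[OF F(2) open_ball] unfolding ball Collect_mem_eq .
    fix z assume z: "z \<in> ball (of_real (- t)) r \<inter> ?S"
    then have "F (- cnj z) = Ye (- cnj z)" using S[of z] ball[of z] by (intro F(3)) blast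
    then show "cnj (F (- cnj z)) = Ye z" using Ye_reflect[of z] z by simp
  qed (rule F)
qed

section \<open>Behaviour of \<open>Y\<close> and of the transform at the origin\<close>

lemma Y_imaginary:
  assumes "s > 0"
  shows "\<exists>y>0. Y (\<i> * of_real s) = of_real y"
proof -
  define z where "z = \<i> * complex_of_real s"
  have z: "z \<in> upper_half_plane" using assms by (simp add: z_def upper_half_plane_simps)
  have "- cnj z = z" by (simp add: z_def)
  then have "cnj (Y z) = Y z" using Y_symmetric[OF z] by simp
  then have R: "Y z \<in> \<real>" by (simp add: Reals_cnj_iff)
  \<comment> \<open>The point is fixed by the reflection, so \<open>Y z\<close> is real; the sector
    excludes negative values.\<close>
  have "\<bar>Arg (Y z)\<bar> < pi" using Y_interior(1)[OF z] bpi(2) by linarith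
  then have "Re (Y z) \<ge> 0" using R by (auto simp: Arg_real split: if_splits)
  moreover have "Y z = of_real (Re (Y z))" using R by (simp add: of_real_Re)
  moreover have "Re (Y z) \<noteq> 0" using Y_nz[OF z] calculation(2) by auto
  ultimately show ?thesis unfolding z_def by (intro exI[of _ "Re (Y z)"]) (auto simp: z_def)
qed

lemma powr_small: "X > 0 \<Longrightarrow> \<exists>\<delta>>0. \<forall>s. 0 < s \<longrightarrow> s < \<delta> \<longrightarrow> s powr (2 * b) < X"
proof -
  assume X: "X > 0"
  have "s powr (2 * b) < X" if "0 < s" "s < X powr (1 / (2 * b))" for s
  proof -
    have "s powr (2 * b) < (X powr (1 / (2 * b))) powr (2 * b)" using that b by (intro powr_less_mono2) auto
    then show ?thesis using X b by (simp add: powr_powr)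
  qed
  then show ?thesis using X by (intro exI[of _ "X powr (1 / (2 * b))"]) auto
qed

text \<open>On a small half-disc \<open>norm (Y z)\<close> cannot equal \<open>R\<close>, so it
  stays on one side of \<open>R\<close>; the imaginary axis, where \<open>Y\<close> is positive,
  shows that it is the outer one. There \<open>norm (h y) \<le> 1/2\<close>, and
  \<open>b y g = 1 - h\<close> gives the bound.\<close>

lemma Y_large_near_0:
  "\<exists>\<delta>>0. \<forall>z\<in>upper_half_plane. norm z < \<delta> \<longrightarrow> 1/2 \<le> b * norm (Y z) * norm (g (Y z))"
proof -
  obtain R where R: "R > 0" "\<And>y. y \<in> sector b \<Longrightarrow> norm y \<ge> R \<Longrightarrow> norm (h y) \<le> 1/2"
    using tails_small by blast
  have big: "1/2 \<le> b * norm y * norm (g y)" if y: "y \<in> sector b" "norm y \<ge> R" for y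
  proof -
    have "norm (1::complex) - norm (h y) \<le> norm (1 - h y)" by (rule norm_triangle_ineq2)
    moreover have "1 - h y = of_real b * y * g y" by (simp add: h_eq)
    ultimately show ?thesis using R(2)[OF y] b by (simp add: norm_mult)
  qed
  have "continuous_on (of_real ` {0..R}) (\<lambda>y. norm (g y))"
    using b by (intro continuous_intros stable_integral_continuous) auto
  moreover have "compact (complex_of_real ` {0..R})"
    by (intro compact_continuous_image continuous_intros compact_Icc)
  ultimately obtain y1 where y1: "y1 \<in> {0..R}" "\<And>y. y \<in> {0..R} \<Longrightarrow> norm (g (of_real y1)) \<le> norm (g (of_real y))"
    using continuous_attains_inf[of "complex_of_real ` {0..R}" "\<lambda>y. norm (g y)"] R(1) by auto
  define m where "m = norm (g (of_real y1))"
  have m: "m > 0" using g_pos[of y1] y1 by (auto simp: m_def)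
  \<comment> \<open>\<open>\<delta>1\<close> excludes \<open>norm (Y z) = R\<close>, as then
    \<open>b R norm (g (Y z)) \<ge> 1/2\<close> forces
    \<open>norm z powr (2 * b) \<ge> \<gamma> / (2 b R^2)\<close>. \<open>\<delta>2\<close> excludes
    \<open>Y \<le> R\<close> on the imaginary axis, where \<open>norm (g (Y z)) \<ge> m\<close>
    would hold.\<close>
  obtain \<delta>1 where \<delta>1: "\<delta>1 > 0" "\<And>s. 0 < s \<Longrightarrow> s < \<delta>1 \<Longrightarrow> s powr (2 * b) < \<gamma> / (2 * b * R * R)"
    using powr_small[of "\<gamma> / (2 * b * R * R)"] R b \<gamma> by auto
  obtain \<delta>2 where \<delta>2: "\<delta>2 > 0" "\<And>s. 0 < s \<Longrightarrow> s < \<delta>2 \<Longrightarrow> s powr (2 * b) < \<gamma> * m / R"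
    using powr_small[of "\<gamma> * m / R"] R m \<gamma> by auto
  define \<delta> where "\<delta> = min \<delta>1 \<delta>2"
  have \<delta>: "\<delta> > 0" using \<delta>1 \<delta>2 by (simp add: \<delta>_def)
  define U where "U = upper_half_plane \<inter> ball 0 \<delta>"
  have U: "connected U" unfolding U_def
    by (intro convex_connected convex_Int convex_upper_half_plane convex_ball)
  have contU: "continuous_on U (\<lambda>z. - norm (Y z))"
    using holomorphic_on_imp_continuous_on[OF Y_hol] unfolding U_def
    by (intro continuous_intros) (auto intro: continuous_on_subset)
  have avoid: "- norm (Y z) \<noteq> - R" if z: "z \<in> U" for z
  proof
    assume "- norm (Y z) = - R"
    then have nY: "norm (Y z) = R" by simp
    have zU: "z \<in> upper_half_plane" "norm z < \<delta>1" using z by (auto simp: U_def \<delta>_def)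
    then have "norm z powr (2 * b) < \<gamma> / (2 * b * R * R)" using upper_nz by (intro \<delta>1) auto
    then have "norm z powr (2 * b) * norm (Y z) < \<gamma> / (2 * b * R * R) * R"
      unfolding nY using R(1) by (rule mult_strict_right_mono)
    also have "\<dots> = \<gamma> / (2 * b * R)" using R by simp
    finally have "\<gamma> * norm (g (Y z)) < \<gamma> / (2 * b * R)" unfolding norm_Y_eq[OF zU(1)] .
    then have "b * R * norm (g (Y z)) < 1 / 2" using \<gamma> R b by (simp add: field_simps)
    then show False using big[OF Y_sector[OF zU(1)]] nY by simp
  qed
  define s where "s = \<delta> / 2"
  have s: "0 < s" "s < \<delta>2" "s < \<delta>" using \<delta> \<delta>1 \<delta>2 by (auto simp: s_def \<delta>_def)
  have sU: "\<i> * of_real s \<in> U" using s by (simp add: U_def upper_half_plane_simps norm_mult)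
  have "- norm (Y (\<i> * of_real s)) < - R"
  proof (rule ccontr)
    assume *: "\<not> - norm (Y (\<i> * of_real s)) < - R"
    obtain y where y: "y > 0" "Y (\<i> * of_real s) = of_real y" using Y_imaginary[OF s(1)] by auto
    then have "y \<le> R" using * by simp
    then have "\<gamma> * m \<le> \<gamma> * norm (g (of_real y))" using y1(2)[of y] y(1) \<gamma> by (simp add: m_def)
    also have "\<dots> = s powr (2 * b) * y"
      using norm_Y_eq[of "\<i> * of_real s"] sU s(1) y by (simp add: U_def norm_mult)
    also have "\<dots> \<le> s powr (2 * b) * R" using \<open>y \<le> R\<close> by (intro mult_left_mono) auto
    also have "\<dots> < \<gamma> * m / R * R" using \<delta>2(2)[OF s(1,2)] R by (intro mult_strict_right_mono) auto
    also have "\<dots> = \<gamma> * m" using R by simp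
    finally show False by simp
  qed
  then have "norm (Y z) > R" if "z \<in> U" for z
    using connected_real_avoid[OF U contU avoid sU _ that] by simp
  then show ?thesis using big Y_sector \<delta> by (intro exI[of _ \<delta>]) (fastforce simp: U_def)
qed

text \<open>Near 0, \<open>norm z powr (2 * b) * norm (Y z)^2 = \<gamma> * norm (g (Y z)) * norm (Y
  z) \<ge> \<gamma> / (2 * b)\<close>, so
  \<open>norm (Y z) \<ge> \<kappa> * norm z powr (- b)\<close>. The decay exponent
  \<open>1 / b\<close> of \<open>h\<close> turns this into a multiple of \<open>norm z\<close>,
  which cancels \<open>1 / z\<close>.\<close>

lemma transform_bounded: "\<exists>B>0. \<forall>z\<in>upper_half_plane. norm (1 / z * h (Y z)) \<le> B"
proof -
  obtain \<delta> where \<delta>: "\<delta> > 0" "\<And>z. z \<in> upper_half_plane \<Longrightarrow> norm z < \<delta> \<Longrightarrow> 1/2 \<le> b * norm (Y z) * norm (g (Y z))"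
    using Y_large_near_0 by blast
  obtain C where C: "C > 0" "\<And>y. y \<in> sector b \<Longrightarrow> norm (h y) \<le> C"
    "\<And>y. y \<in> sector b \<Longrightarrow> y \<noteq> 0 \<Longrightarrow> norm (h y) \<le> C * norm y powr (- (1 / b))"
    using h_bounded by blast
  define \<kappa> where "\<kappa> = sqrt (\<gamma> / (2 * b))"
  have \<kappa>: "\<kappa> > 0" using \<gamma> b by (simp add: \<kappa>_def)
  define B where "B = max (C / \<delta>) (C * \<kappa> powr (- (1 / b)))"
  have "norm (1 / z * h (Y z)) \<le> B" if z: "z \<in> upper_half_plane" for z
  proof (cases "norm z < \<delta>")
    case False
    have "norm (h (Y z)) / norm z \<le> C / \<delta>"
      using False \<delta>(1) C(1) C(2)[OF Y_sector[OF z]] by (intro frac_le) auto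
    then show ?thesis by (simp add: norm_mult norm_divide B_def)
  next
    case True
    have z0: "norm z > 0" and Y0: "norm (Y z) > 0" using upper_nz[OF z] Y_nz[OF z] by auto
    have "\<gamma> / (2 * b) \<le> \<gamma> * norm (g (Y z)) * norm (Y z)"
      using \<delta>(2)[OF z True] \<gamma> b mult_left_mono[of "1/2" "b * norm (Y z) * norm (g (Y z))" "\<gamma> / b"]
      by (simp add: field_simps)
    also have "\<dots> = norm z powr (2 * b) * norm (Y z) * norm (Y z)" by (simp add: norm_Y_eq[OF z])
    also have "\<dots> = (norm z powr b * norm (Y z))\<^sup>2"
      using z0 by (simp add: power2_eq_square powr_add[symmetric] mult_ac)
    finally have "\<kappa> \<le> norm z powr b * norm (Y z)"
      unfolding \<kappa>_def by (intro real_le_lsqrt) simp_all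
    then have "\<kappa> * norm z powr (- b) \<le> norm (Y z)"
      using z0 by (simp add: powr_minus field_simps)
    then have "norm (Y z) powr (- (1 / b)) \<le> (\<kappa> * norm z powr (- b)) powr (- (1 / b))"
      using \<kappa> z0 b Y0 by (intro powr_mono2') auto
    also have "\<dots> = \<kappa> powr (- (1 / b)) * norm z"
      using \<kappa> z0 b by (simp add: powr_mult powr_powr)
    finally have "norm (h (Y z)) \<le> C * (\<kappa> powr (- (1 / b)) * norm z)"
      using C(3)[OF Y_sector[OF z] Y_nz[OF z]] C(1) by (meson mult_left_mono order_trans less_imp_le)
    then have "norm (h (Y z)) / norm z \<le> C * \<kappa> powr (- (1 / b))"
      using z0 by (simp add: field_simps)
    then show ?thesis by (simp add: norm_mult norm_divide B_def)
  qed
  moreover have "B > 0" using C \<delta> by (simp add: B_def less_max_iff_disj)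
  ultimately show ?thesis by blast
qed

end

section \<open>Inversion of the Stieltjes transform\<close>

text \<open>The smoothed step becomes a jump; at \<open>u = 0\<close> the convention
  \<open>sgn 0 = 0\<close> gives interval endpoints half weight.\<close>

lemma tendsto_arctan_scaled:
  "(\<lambda>n. arctan (u / (1 / real (Suc n)))) \<longlonglongrightarrow> sgn u * (pi / 2)"
proof -
  have inf: "filterlim (\<lambda>n. real (Suc n)) at_top sequentially"
    by (rule filterlim_compose[OF filterlim_real_sequentially filterlim_Suc])
  consider "u = 0" | "u > 0" | "u < 0" by linarith
  then show ?thesis
  proof cases
    case 2
    have "filterlim (\<lambda>n. u * real (Suc n)) at_top sequentially"
      by (rule filterlim_tendsto_pos_mult_at_top[OF tendsto_const 2 inf])
    from filterlim_compose[OF tendsto_arctan_at_top this] show ?thesis using 2 by simp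
  next
    case 3
    have "filterlim (\<lambda>n. u * real (Suc n)) at_bot sequentially"
      by (rule filterlim_tendsto_neg_mult_at_bot[OF tendsto_const 3 inf])
    from filterlim_compose[OF tendsto_arctan_at_bot this] show ?thesis using 3 by simp
  qed auto
qed

lemma Im_inverse_shift: "Im (1 / (Complex t e - complex_of_real x)) = - (e / ((t - x)\<^sup>2 + e\<^sup>2))"
  by (simp add: Im_divide)

lemma Im_stieltjes_transform:
  assumes "real_distribution \<mu>" and e: "e > 0"
  shows "Im (LINT x|\<mu>. 1 / (Complex t e - complex_of_real x)) = - (LINT x|\<mu>. e / ((t - x)\<^sup>2 + e\<^sup>2))"
proof -
  interpret real_distribution \<mu> by fact
  have [measurable_cong]: "sets \<mu> = sets borel" by simp
  have "integrable \<mu> (\<lambda>x. 1 / (Complex t e - complex_of_real x))"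
  proof (rule integrable_const_bound[of _ "1 / e"])
    show "AE x in \<mu>. norm (1 / (Complex t e - complex_of_real x)) \<le> 1 / e"
    proof (rule AE_I2)
      fix x
      have "norm (Complex t e - complex_of_real x) \<ge> e"
        using abs_Im_le_cmod[of "Complex t e - complex_of_real x"] e by simp
      then show "norm (1 / (Complex t e - complex_of_real x)) \<le> 1 / e"
        using e by (simp add: norm_divide frac_le)
    qed
  qed measurable
  then have "Im (LINT x|\<mu>. 1 / (Complex t e - complex_of_real x)) =
      (LINT x|\<mu>. Im (1 / (Complex t e - complex_of_real x)))"
    by (rule integral_Im[symmetric])
  then show ?thesis unfolding Im_inverse_shift by simp
qed

text \<open>The kernel \<open>e / ((t - x)^2 + e^2)\<close> is integrated over \<open>t\<close> in
  \<open>[a, b]\<close>, the order is exchanged, and \<open>e\<close> tends to 0. On the side of the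
  transform \<open>B\<close> dominates and the origin is a null set; on the side of
  \<open>\<mu>\<close> the arctangents differ by at most \<open>pi\<close>. Endpoints are counted by
  half, so atoms have to be excluded before intervals can be compared.\<close>

lemma stieltjes_inversion:
  fixes \<mu> :: "real measure" and \<rho> :: "real \<Rightarrow> real"
  assumes mu: "real_distribution \<mu>"
    and \<rho>_meas [measurable]: "\<rho> \<in> borel_measurable borel"
    and \<rho>_bnd: "\<And>t. 0 \<le> \<rho> t" "\<And>t. \<rho> t \<le> B'"
    and bnd: "\<And>z. Im z > 0 \<Longrightarrow> norm (LINT x|\<mu>. 1 / (z - complex_of_real x)) \<le> B"
    and lim: "\<And>t. t \<noteq> 0 \<Longrightarrow>
      (\<lambda>n. Im (LINT x|\<mu>. 1 / (Complex t (1 / real (Suc n)) - complex_of_real x))) \<longlonglongrightarrow> - (pi * \<rho> t)"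
  shows "\<mu> = density lborel (\<lambda>t. ennreal (\<rho> t))"
proof -
  interpret real_distribution \<mu> by (rule mu)
  have [measurable_cong]: "sets \<mu> = sets borel" by simp
  define S where "S z = (LINT x|\<mu>. 1 / (z - complex_of_real x))" for z
  define p where "p e t x = e / ((t - x)\<^sup>2 + e\<^sup>2)" for e t x :: real
  have p_meas [measurable]: "(\<lambda>x. p e t x) \<in> borel_measurable borel" for e t
    unfolding p_def by measurable
  have p_bnd: "norm (p e t x) \<le> 1 / e" if "e > 0" for e t x
  proof -
    have "e * e \<le> (t - x)\<^sup>2 + e\<^sup>2" by (simp add: power2_eq_square)
    moreover have "(t - x)\<^sup>2 + e\<^sup>2 > 0" using that by (simp add: add_nonneg_pos)
    ultimately show ?thesis using that by (simp add: p_def field_simps)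
  qed
  have S_Im: "Im (S (Complex t e)) = - (LINT x|\<mu>. p e t x)" if e: "e > 0" for t e
    unfolding S_def p_def by (rule Im_stieltjes_transform[OF mu e])
  define e where "e n = 1 / real (Suc n)" for n
  have e: "e n > 0" for n by (simp add: e_def)
  have int_\<rho>: "set_integrable lborel {a..b} \<rho>" for a b
    unfolding set_integrable_def
  proof (rule integrableI_bounded_set[where A = "{a..b}" and B = B'])
    show "AE x in lborel. x \<in> {a..b} \<longrightarrow> norm (indicator {a..b} x *\<^sub>R \<rho> x) \<le> B'"
      using \<rho>_bnd by auto
  qed (auto simp: emeasure_lborel_Icc_eq)
  define q where "q a b = (LINT t:{a..b}|lborel. \<rho> t)" for a b
  have key: "pi * q a b = (LINT x|\<mu>. (sgn (b - x) - sgn (a - x)) * (pi / 2))" if ab: "a \<le> b" for a b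
  proof -
    define N where "N = restrict_space lborel {a..b}"
    interpret N: finite_measure N
      by (rule finite_measureI) (simp add: N_def emeasure_restrict_space space_restrict_space ab emeasure_lborel_Icc_eq)
    interpret pair_sigma_finite \<mu> N ..
    interpret P: finite_measure "\<mu> \<Otimes>\<^sub>M N"
      by (rule finite_measure_pair_measure) (unfold_locales)
    have N_space: "space N = {a..b}" by (simp add: N_def space_restrict_space)
    have [measurable]: "f \<in> borel_measurable N" if "f \<in> borel_measurable borel" for f :: "real \<Rightarrow> real"
      unfolding N_def using that by (intro measurable_restrict_space1) simp
    have N_int: "(LINT t|N. f t) = (LINT t:{a..b}|lborel. f t)" for f :: "real \<Rightarrow> real"
      by (simp add: N_def integral_restrict_space set_lebesgue_integral_def)
    have id_N [measurable]: "(\<lambda>t. t) \<in> borel_measurable N" by measurable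
    have swap: "(LINT t|N. LINT x|\<mu>. p (e n) t x) = (LINT x|\<mu>. LINT t|N. p (e n) t x)" for n
    proof (rule Fubini_integral)
      show "integrable (\<mu> \<Otimes>\<^sub>M N) (\<lambda>(x, t). p (e n) t x)"
      proof (rule P.integrable_const_bound[of _ "1 / e n"])
        show "(\<lambda>(x, t). p (e n) t x) \<in> borel_measurable (\<mu> \<Otimes>\<^sub>M N)"
          unfolding p_def by measurable
      qed (use p_bnd[OF e] in auto)
    qed
    have inner: "(LINT t|N. p (e n) t x) = arctan ((b - x) / e n) - arctan ((a - x) / e n)" for n x
    proof -
      have "((\<lambda>t. arctan ((t - x) / e n)) has_vector_derivative p (e n) t x) (at t within {a..b})" for t
      proof -
        have "((\<lambda>t. arctan ((t - x) / e n)) has_real_derivative p (e n) t x) (at t)"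
          using e[of n] by (auto intro!: derivative_eq_intros simp: p_def power2_eq_square field_simps add_eq_0_iff)
        then show ?thesis
          using has_real_derivative_iff_has_vector_derivative has_vector_derivative_at_within by blast
      qed
      then have "(\<integral>t. indicator {a..b} t *\<^sub>R p (e n) t x \<partial>lborel) = arctan ((b - x) / e n) - arctan ((a - x) / e n)"
      proof (intro integral_FTC_Icc[OF ab])
        show "continuous_on {a..b} (\<lambda>t. p (e n) t x)"
          unfolding p_def using e[of n] by (intro continuous_intros) (simp add: add_nonneg_eq_0_iff)
      qed
      then show ?thesis unfolding N_int set_lebesgue_integral_def .
    qed
    have eq: "(LINT t|N. - Im (S (Complex t (e n)))) = (LINT x|\<mu>. arctan ((b - x) / e n) - arctan ((a - x) / e n))" for n
      using swap[of n] by (simp add: S_Im[OF e] inner)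
    have AE0: "AE t in N. t \<noteq> 0"
    proof -
      have "AE t in lborel. t \<noteq> (0::real)" by (rule AE_lborel_singleton)
      then show ?thesis unfolding N_def by (subst AE_restrict_space_iff) auto
    qed
    have "(\<lambda>n. LINT t|N. - Im (S (Complex t (e n)))) \<longlonglongrightarrow> (LINT t|N. pi * \<rho> t)"
    proof (rule integral_dominated_convergence[where w = "\<lambda>_. B"])
      show "AE t in N. (\<lambda>n. - Im (S (Complex t (e n)))) \<longlonglongrightarrow> pi * \<rho> t"
        using AE0
      proof eventually_elim
        case (elim t)
        from tendsto_minus[OF lim[OF elim]] show ?case by (simp add: S_def e_def)
      qed
      show "AE t in N. norm (- Im (S (Complex t (e n)))) \<le> B" for n
      proof (rule AE_I2)
        fix t
        have "\<bar>Im (S (Complex t (e n)))\<bar> \<le> norm (S (Complex t (e n)))" by (rule abs_Im_le_cmod)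
        also have "\<dots> \<le> B" unfolding S_def using e[of n] by (intro bnd) simp
        finally show "norm (- Im (S (Complex t (e n)))) \<le> B" by simp
      qed
      show "(\<lambda>t. - Im (S (Complex t (e n)))) \<in> borel_measurable N" for n
        unfolding S_Im[OF e] p_def by measurable
    qed (use N.integrable_const in auto)
    moreover have "(\<lambda>n. LINT x|\<mu>. arctan ((b - x) / e n) - arctan ((a - x) / e n)) \<longlonglongrightarrow>
        (LINT x|\<mu>. (sgn (b - x) - sgn (a - x)) * (pi / 2))"
    proof (rule integral_dominated_convergence[where w = "\<lambda>_. pi"])
      show "AE x in \<mu>. (\<lambda>n. arctan ((b - x) / e n) - arctan ((a - x) / e n)) \<longlonglongrightarrow> (sgn (b - x) - sgn (a - x)) * (pi / 2)"
        unfolding e_def left_diff_distrib by (intro AE_I2 tendsto_diff tendsto_arctan_scaled)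
      show "AE x in \<mu>. norm (arctan ((b - x) / e n) - arctan ((a - x) / e n)) \<le> pi" for n
      proof (rule AE_I2)
        fix x
        show "norm (arctan ((b - x) / e n) - arctan ((a - x) / e n)) \<le> pi"
          using arctan_lbound[of "(b - x) / e n"] arctan_ubound[of "(b - x) / e n"]
            arctan_lbound[of "(a - x) / e n"] arctan_ubound[of "(a - x) / e n"]
          unfolding real_norm_def by linarith
      qed
    qed auto
    ultimately have "(LINT t|N. pi * \<rho> t) = (LINT x|\<mu>. (sgn (b - x) - sgn (a - x)) * (pi / 2))"
      unfolding eq by (rule LIMSEQ_unique)
    then show ?thesis unfolding N_int q_def by simp
  qed
  have int_sgn: "integrable \<mu> (\<lambda>x. (sgn (b - x) - sgn (a - x)) * (pi / 2))" for a b
  proof (rule integrable_const_bound[of _ "2 * pi"])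
    show "AE x in \<mu>. norm ((sgn (b - x) - sgn (a - x)) * (pi / 2)) \<le> 2 * pi"
      by (intro AE_I2) (auto simp: sgn_if)
  qed measurable
  have int_ind: "integrable \<mu> (\<lambda>x. pi * indicator A x)" if "A \<in> sets borel" for A :: "real set"
    using that by (intro integrable_mult_right integrable_real_indicator) (auto simp: emeasure_eq_measure)
  have lower: "measure \<mu> {a<..<b} \<le> q a b" if "a \<le> b" for a b
  proof -
    have "pi * measure \<mu> {a<..<b} = (LINT x|\<mu>. pi * indicator {a<..<b} x)" by simp
    also have "\<dots> \<le> pi * q a b" unfolding key[OF that]
      using that by (intro integral_mono int_ind int_sgn) (auto simp: sgn_if indicator_def)
    finally show ?thesis by simp
  qed
  have upper: "q a b \<le> measure \<mu> {a..b}" if "a \<le> b" for a b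
  proof -
    have "pi * q a b \<le> (LINT x|\<mu>. pi * indicator {a..b} x)" unfolding key[OF that]
      using that by (intro integral_mono int_ind int_sgn) (auto simp: sgn_if indicator_def)
    also have "\<dots> = pi * measure \<mu> {a..b}" by simp
    finally show ?thesis by simp
  qed
  \<comment> \<open>The bounded density leaves mass at most \<open>2 * B' * d\<close> for the
    interval of radius \<open>d\<close> around \<open>c\<close>.\<close>
  have atom: "measure \<mu> {c} = 0" for c
  proof -
    have bd: "measure \<mu> {c} \<le> 2 * B' * d" if d: "d > 0" for d
    proof -
      have "measure \<mu> {c} \<le> measure \<mu> {c - d<..<c + d}" using d by (intro finite_measure_mono) auto
      also have "\<dots> \<le> q (c - d) (c + d)" using d by (intro lower) auto
      also have "\<dots> \<le> (LINT t:{c - d..c + d}|lborel. B')"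
      proof -
        have "integrable lborel (indicat_real {c - d..c + d})"
          by (intro integrable_real_indicator) (auto simp: emeasure_lborel_Icc_eq)
        then show ?thesis
          unfolding q_def by (intro set_integral_mono int_\<rho> \<rho>_bnd) (auto simp: set_integrable_def)
      qed
      also have "\<dots> = 2 * B' * d" using d by (simp add: set_lebesgue_integral_def)
      finally show ?thesis .
    qed
    have "measure \<mu> {c} \<le> 0"
    proof (rule field_le_epsilon)
      fix r :: real assume r: "r > 0"
      have B': "B' \<ge> 0" using order_trans[OF \<rho>_bnd(1,2)] .
      \<comment> \<open>The added 1 keeps the radius positive when \<open>B' = 0\<close>.\<close>
      then have "measure \<mu> {c} \<le> 2 * B' * (r / (2 * B' + 1))" using r by (intro bd) simp
      also have "\<dots> \<le> r" using r B' by (simp add: field_simps)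
      finally show "measure \<mu> {c} \<le> 0 + r" by simp
    qed
    then show ?thesis by (simp add: measure_le_0_iff)
  qed
  have eq: "measure \<mu> {a<..b} = q a b" if "a \<le> b" for a b
  proof -
    have "measure \<mu> {a<..b} \<le> measure \<mu> ({a<..<b} \<union> {b})" using that by (intro finite_measure_mono) auto
    also have "\<dots> \<le> measure \<mu> {a<..<b} + measure \<mu> {b}" by (rule measure_Un_le) auto
    finally have 1: "measure \<mu> {a<..b} \<le> q a b" using lower[OF that] atom[of b] by simp
    have "measure \<mu> {a..b} \<le> measure \<mu> ({a<..b} \<union> {a})" using that by (intro finite_measure_mono) auto
    also have "\<dots> \<le> measure \<mu> {a<..b} + measure \<mu> {a}" by (rule measure_Un_le) auto
    finally show ?thesis using 1 upper[OF that] atom[of a] by simp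
  qed
  show ?thesis
  proof (rule measure_eqI_generator_eq[where \<Omega> = UNIV and E = "range (\<lambda>(a, b). {a<..b::real})" and A = "\<lambda>i. {- real i<..real i}"])
    fix X assume "X \<in> range (\<lambda>(a, b). {a<..b::real})"
    then obtain a b where X: "X = {a<..b}" by auto
    show "emeasure \<mu> X = emeasure (density lborel (\<lambda>t. ennreal (\<rho> t))) X"
    proof (cases "a \<le> b")
      case True
      have "emeasure (density lborel (\<lambda>t. ennreal (\<rho> t))) X = (\<integral>\<^sup>+t. ennreal (\<rho> t) * indicator X t \<partial>lborel)"
        by (rule emeasure_density) (auto simp: X)
      also have "\<dots> = (\<integral>\<^sup>+t. ennreal (indicator {a..b} t * \<rho> t) \<partial>lborel)"
      proof (rule nn_integral_cong_AE)
        have "AE t in lborel. t \<noteq> a" by (rule AE_lborel_singleton)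
        then show "AE t in lborel. ennreal (\<rho> t) * indicator X t = ennreal (indicator {a..b} t * \<rho> t)"
          by eventually_elim (auto simp: X indicator_def)
      qed
      also have "\<dots> = ennreal (q a b)"
        unfolding q_def set_lebesgue_integral_def using int_\<rho>[of a b] \<rho>_bnd(1)
        by (subst nn_integral_eq_integral) (auto simp: set_integrable_def)
      also have "\<dots> = emeasure \<mu> X" using eq[OF True] by (simp add: X emeasure_eq_measure)
      finally show ?thesis ..
    qed (simp add: X)
  next
    show "(\<Union>i. {- real (i::nat)<..real i}) = UNIV" by (rule UN_Ioc_eq_UNIV)
  qed (auto simp: borel_sigma_sets_Ioc Int_stable_def emeasure_eq_measure)
qed

section \<open>The density\<close>

context stable_index begin

text \<open>An infinite bounded set has a limit point, so the equality extends to all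
  \<open>w\<close>. Derivatives at 0 then force \<open>c1 = c2\<close>, but \<open>c1\<close> lies
  in the open first quadrant and \<open>c2\<close> is plus or minus its conjugate.\<close>

lemma h_rotations_differ:
  assumes s: "s = 1 \<or> s = -1" and P: "infinite P" "bounded P"
    and eq: "\<And>w. w \<in> P \<Longrightarrow> h (cis (b * pi / 2) * w) = h (s * cis (- (b * pi / 2)) * w)"
  shows False
proof -
  define c1 where "c1 = cis (b * pi / 2)"
  define c2 where "c2 = s * cis (- (b * pi / 2))"
  define G where "G w = h (c1 * w) - h (c2 * w)" for w
  have G_hol: "G holomorphic_on UNIV" unfolding G_def by (intro holomorphic_intros)
  have "compact (closure P)" using P(2) by simp
  then obtain x where x: "x islimpt P"
    using Heine_Borel_imp_Bolzano_Weierstrass[OF _ P(1) closure_subset] by blast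
  have G0: "G w = 0" for w
  proof (rule analytic_continuation[OF G_hol open_UNIV connected_UNIV subset_UNIV UNIV_I x _ UNIV_I])
    show "G z = 0" if "z \<in> P" for z using eq[OF that] by (simp add: G_def c1_def c2_def)
  qed
  have d: "((\<lambda>w. h (c * w)) has_field_derivative - stable_integral b b 1 0 * c) (at 0)" for c
  proof -
    have "((*) c has_field_derivative c) (at 0)" by (auto intro!: derivative_eq_intros)
    moreover have "(h has_field_derivative - stable_integral b b 1 0) (at (c * 0))"
      using h_has_derivative[of 0] by simp
    ultimately show ?thesis by (intro DERIV_chain2[of h])
  qed
  have "(G has_field_derivative - stable_integral b b 1 0 * c1 - - stable_integral b b 1 0 * c2) (at 0)"
    unfolding G_def by (intro DERIV_diff d)
  moreover have "(G has_field_derivative 0) (at 0)" proof -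
    have "G = (\<lambda>_. 0)" using G0 by auto
    then show ?thesis by simp
  qed
  ultimately have "- stable_integral b b 1 0 * c1 - - stable_integral b b 1 0 * c2 = 0" by (rule DERIV_unique)
  moreover obtain x where "x > 0" "stable_integral b b 1 0 = complex_of_real x"
    using stable_integral_pos[of b b 0] b by auto
  ultimately have "c1 = c2" by simp
  then have "Re c1 = Re c2" "Im c1 = Im c2" by simp_all
  moreover have "b * pi / 2 < pi / 2" "0 < b * pi / 2" using b by auto
  then have "sin (b * pi / 2) > 0" "cos (b * pi / 2) > 0"
    using pi_gt_zero by (intro sin_gt_zero cos_gt_zero_pi; linarith)+
  ultimately show False using s unfolding c1_def c2_def by auto
qed

end

locale stable_transform = stable_solution +
  fixes \<mu> :: "real measure"
  assumes mu: "real_distribution \<mu>"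
    and transform: "\<And>z. z \<in> upper_half_plane \<Longrightarrow>
        (LINT x|\<mu>. 1 / (z - complex_of_real x)) = 1 / z * h (Y z)"
begin

text \<open>The value at the origin is a convention: a single point does not affect the measure, and
  0 respects nonnegativity and boundedness.\<close>

definition rho :: "real \<Rightarrow> real" where
  "rho t = (if t = 0 then 0 else - (1 / (pi * t)) * Im (h (Ye (of_real t))))"

lemma rho_eq: "t \<noteq> 0 \<Longrightarrow> rho t = - (1 / (pi * t)) * Im (h (Ye (of_real t)))"
  by (simp add: rho_def)

lemma rho_minus: "rho (- t) = rho t"
proof (cases "t = 0")
  case False
  have "h (Ye (of_real (- t))) = cnj (h (Ye (of_real t)))"
    unfolding Ye_minus[OF False] by (rule h_cnj)
  then show ?thesis using False by (simp add: rho_def)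
qed simp

lemma transform_tendsto:
  assumes t: "t \<noteq> 0"
  shows "(\<lambda>n. Im (LINT x|\<mu>. 1 / (Complex t (1 / real (Suc n)) - complex_of_real x))) \<longlonglongrightarrow> - (pi * rho t)"
proof -
  define w where "w n = Complex t (1 / real (Suc n))" for n
  have wU: "w n \<in> upper_half_plane" for n by (simp add: w_def upper_half_plane_simps)
  have "(\<lambda>n. 1 / real (Suc n)) \<longlonglongrightarrow> 0" by (rule LIMSEQ_Suc[OF lim_const_over_n[of 1, simplified]])
  then have "w \<longlonglongrightarrow> Complex t 0" unfolding w_def by (intro tendsto_Complex tendsto_const)
  then have w: "w \<longlonglongrightarrow> of_real t" by (simp add: complex_of_real_def)
  have "filterlim w (at (of_real t) within upper_half_plane) sequentially"
    unfolding filterlim_at using w wU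
    by (intro conjI always_eventually allI) (auto simp: w_def complex_eq_iff)
  from filterlim_compose[OF Ye_limit[OF t] this]
  have "(\<lambda>n. Y (w n)) \<longlonglongrightarrow> Ye (of_real t)" .
  then have "(\<lambda>n. Im (1 / w n * h (Y (w n)))) \<longlonglongrightarrow> Im (1 / of_real t * h (Ye (of_real t)))"
    using t by (intro tendsto_intros w isCont_tendsto_compose[OF isCont_h]) auto
  also have "Im (1 / of_real t * h (Ye (of_real t))) = - (pi * rho t)"
    using t by (simp add: rho_eq Im_divide_of_real)
  finally show ?thesis unfolding transform[OF wU, symmetric] by (simp add: w_def)
qed

text \<open>The sign comes from the positive kernel representing the imaginary part of the
  transform, and it passes to the boundary.\<close>

lemma rho_nonneg: "0 \<le> rho t"
proof (cases "t = 0")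
  case False
  have "Im (LINT x|\<mu>. 1 / (Complex t (1 / real (Suc n)) - complex_of_real x)) \<le> 0" for n
    unfolding Im_stieltjes_transform[OF mu, of "1 / real (Suc n)" t, simplified]
    by (subst Im_stieltjes_transform[OF mu]) (auto intro!: Bochner_Integration.integral_nonneg)
  then have "- (pi * rho t) \<le> 0" by (intro LIMSEQ_le_const2[OF transform_tendsto[OF False]]) auto
  then show ?thesis using zero_le_mult_iff[of pi "rho t"] pi_gt_zero by linarith
qed (simp add: rho_def)

lemma transform_norm_bounded:
  "\<exists>B>0. \<forall>z. Im z > 0 \<longrightarrow> norm (LINT x|\<mu>. 1 / (z - complex_of_real x)) \<le> B"
proof -
  obtain B where "B > 0" "\<And>z. z \<in> upper_half_plane \<Longrightarrow> norm (1 / z * h (Y z)) \<le> B"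
    using transform_bounded by blast
  then show ?thesis using transform by (intro exI[of _ B]) (metis upper_half_plane_simps)
qed

lemma rho_bounded: "\<exists>B. \<forall>t. rho t \<le> B"
proof -
  obtain B where B: "B > 0" "\<And>z. Im z > 0 \<Longrightarrow> norm (LINT x|\<mu>. 1 / (z - complex_of_real x)) \<le> B"
    using transform_norm_bounded by blast
  have "rho t \<le> B / pi" for t
  proof (cases "t = 0")
    case False
    have "- B \<le> Im (LINT x|\<mu>. 1 / (Complex t (1 / real (Suc n)) - complex_of_real x))" for n
      using abs_Im_le_cmod[of "LINT x|\<mu>. 1 / (Complex t (1 / real (Suc n)) - complex_of_real x)"]
        B(2)[of "Complex t (1 / real (Suc n))"] by simp
    then have "- B \<le> - (pi * rho t)" by (intro LIMSEQ_le_const[OF transform_tendsto[OF False]]) auto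
    then show ?thesis by (simp add: field_simps)
  qed (use B in \<open>simp add: rho_def\<close>)
  then show ?thesis by blast
qed

lemma rho_isCont:
  assumes t: "t \<noteq> 0"
  shows "isCont rho t"
proof -
  have "continuous_on (- {0}) (\<lambda>t. Ye (complex_of_real t))"
    by (rule continuous_on_compose2[OF continuous_on_Ye]) (auto intro!: continuous_intros)
  then have "isCont (\<lambda>t. Ye (complex_of_real t)) t"
    using t by (simp add: continuous_on_eq_continuous_at open_Compl)
  from isCont_Im[OF isCont_o2[OF this isCont_h]]
  have "isCont (\<lambda>t. - (1 / (pi * t)) * Im (h (Ye (complex_of_real t)))) t"
    using t by (intro continuous_intros) auto
  then show ?thesis
    by (rule isCont_cong[THEN iffD1, rotated])
       (use t in \<open>auto simp: rho_def eventually_nhds_metric intro!: exI[of _ "\<bar>t\<bar>"]\<close>)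
qed

lemma rho_measurable [measurable]: "rho \<in> borel_measurable borel"
proof -
  have "continuous_on (- {0}) rho"
    using rho_isCont by (auto intro: continuous_at_imp_continuous_on)
  \<comment> \<open>The indicator leaves \<open>rho\<close> unchanged because
    \<open>rho 0 = 0\<close>.\<close>
  then have "(\<lambda>t. indicator (- {0}) t *\<^sub>R rho t) \<in> borel_measurable borel"
    by (intro borel_measurable_continuous_on_indicator) auto
  also have "(\<lambda>t. indicator (- {0}) t *\<^sub>R rho t) = rho"
    by (auto simp: rho_def fun_eq_iff)
  finally show ?thesis .
qed

lemma mu_density: "\<mu> = density lborel (\<lambda>t. ennreal (rho t))"
proof -
  obtain B where B: "\<And>z. Im z > 0 \<Longrightarrow> norm (LINT x|\<mu>. 1 / (z - complex_of_real x)) \<le> B"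
    using transform_norm_bounded by blast
  obtain B' where B': "\<And>t. rho t \<le> B'" using rho_bounded by blast
  show ?thesis by (rule stieltjes_inversion[OF mu rho_measurable rho_nonneg B' B transform_tendsto])
qed

text \<open>The boundary equation expresses \<open>g y\<close> as a real multiple of
  \<open>cis (- (b * pi)) * y\<close>; in \<open>h = 1 - b y g\<close> this leaves a real multiple
  of \<open>cis (- (b * pi)) * y^2\<close>.\<close>

lemma Im_h_pos:
  assumes t: "t > 0"
  shows "Im (h (Ye (of_real t))) = - (b * t powr (2 * b) / \<gamma>) * Im (cis (- (b * pi)) * (Ye (of_real t))\<^sup>2)"
proof -
  define y where "y = Ye (of_real t)"
  have "of_real (t powr (2 * b)) * y = cis (b * pi) * of_real \<gamma> * g y"
    using Ye_pos(3)[OF t] by (simp add: y_def)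
  then have "cis (- (b * pi)) * (of_real (t powr (2 * b)) * y) = (cis (- (b * pi)) * cis (b * pi)) * (of_real \<gamma> * g y)"
    by (simp only: mult_ac)
  then have "of_real \<gamma> * g y = cis (- (b * pi)) * (of_real (t powr (2 * b)) * y)"
    by (simp add: cis_mult)
  then have g: "g y = of_real (t powr (2 * b) / \<gamma>) * (cis (- (b * pi)) * y)"
    using \<gamma> by (simp add: field_simps)
  have "h y = 1 - of_real (b * t powr (2 * b) / \<gamma>) * (cis (- (b * pi)) * y\<^sup>2)"
    unfolding h_eq g by (simp add: power2_eq_square)
  moreover have "Im (1 - of_real r * w) = - r * Im w" for r w by simp
  ultimately show ?thesis unfolding y_def[symmetric] by metis
qed

lemma rho_eq':
  assumes t: "t \<noteq> 0"
  shows "rho t = 2 * b * \<bar>t\<bar> powr (2 * b - 1) / (2 * \<gamma> * pi) * Im (cis (- (b * pi)) * (Ye (of_real \<bar>t\<bar>))\<^sup>2)"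
proof -
  have "rho t = rho \<bar>t\<bar>" using rho_minus[of t] by (cases "t \<ge> 0") auto
  moreover have "rho s = 2 * b * s powr (2 * b - 1) / (2 * \<gamma> * pi) * Im (cis (- (b * pi)) * (Ye (of_real s))\<^sup>2)"
    if s: "s > 0" for s
  proof -
    have "rho s = (1 / (pi * s)) * (b * s powr (2 * b) / \<gamma>) * Im (cis (- (b * pi)) * (Ye (of_real s))\<^sup>2)"
      unfolding rho_eq[OF less_imp_neq[OF s, symmetric]] Im_h_pos[OF s] by simp
    also have "(1 / (pi * s)) * (b * s powr (2 * b) / \<gamma>) = 2 * b * s powr (2 * b - 1) / (2 * \<gamma> * pi)"
      using s \<gamma> by (simp add: powr_diff field_simps)
    finally show ?thesis .
  qed
  ultimately show ?thesis using t by simp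
qed

lemma rho_real_analytic:
  assumes t: "t \<noteq> 0" and an: "analytic_at_within Ye (of_real t) (upper_half_plane \<union> (\<real> - {0}))"
  shows "real_analytic_at rho t"
proof -
  obtain F r where F: "r > 0" "F holomorphic_on ball (of_real t) r"
    "\<And>z. z \<in> ball (of_real t) r \<inter> (upper_half_plane \<union> (\<real> - {0})) \<Longrightarrow> F z = Ye z"
    using an unfolding analytic_at_within_def by blast
  \<comment> \<open>The bound by \<open>\<bar>t\<bar>\<close> keeps the origin, where
    \<open>\<Phi>\<close> would divide by 0, out of the disc.\<close>
  define d where "d = min r \<bar>t\<bar>"
  have d: "d > 0" using F t by (simp add: d_def)
  define \<Phi> where "\<Phi> z = h (F z) / z" for z
  have nz: "z \<noteq> 0" if "z \<in> ball (complex_of_real t) d" for z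
    using that by (auto simp: d_def)
  have \<Phi>_hol: "\<Phi> holomorphic_on ball (of_real t) d"
    unfolding \<Phi>_def using nz
    by (intro holomorphic_intros holomorphic_on_subset[OF F(2)]) (auto simp: d_def)
  define c where "c n = (deriv ^^ n) \<Phi> (of_real t) / fact n" for n
  \<comment> \<open>For real \<open>x\<close> the powers of \<open>x - t\<close> are real, so taking
    imaginary parts affects the Taylor coefficients alone.\<close>
  define a where "a n = - (1 / pi) * Im (c n)" for n
  have "(\<lambda>n. a n * (x - t) ^ n) sums rho x" if x: "\<bar>x - t\<bar> < d" for x
  proof -
    have xb: "complex_of_real x \<in> ball (of_real t) d"
      using x by (simp add: dist_norm norm_of_real abs_minus_commute flip: of_real_diff)
    have x0: "x \<noteq> 0" using nz[OF xb] by simp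
    have "(\<lambda>n. c n * (of_real x - of_real t) ^ n) sums \<Phi> (of_real x)"
      unfolding c_def by (rule holomorphic_power_series[OF \<Phi>_hol xb])
    then have "(\<lambda>n. Im (c n * (of_real x - of_real t) ^ n)) sums Im (\<Phi> (of_real x))"
      by (rule sums_Im)
    moreover have "Im (c n * (of_real x - of_real t) ^ n) = Im (c n) * (x - t) ^ n" for n
    proof -
      have "c n * (of_real x - of_real t) ^ n = c n * of_real ((x - t) ^ n)" by simp
      then show ?thesis by (metis Im_complex_of_real Re_complex_of_real add_0 mult_zero_right times_complex.sel(2) add.commute mult.commute)
    qed
    ultimately have "(\<lambda>n. - (1 / pi) * (Im (c n) * (x - t) ^ n)) sums (- (1 / pi) * Im (\<Phi> (of_real x)))"
      by (intro sums_mult) simp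
    moreover have "F (of_real x) = Ye (of_real x)"
      using xb x0 by (intro F(3)) (auto simp: d_def)
    then have "- (1 / pi) * Im (\<Phi> (of_real x)) = rho x"
      using x0 by (simp add: \<Phi>_def rho_eq Im_divide_of_real)
    ultimately show ?thesis by (simp add: a_def mult.assoc)
  qed
  then show ?thesis unfolding real_analytic_at_def using d by blast
qed

lemma rho_nonvanishing_pos:
  assumes uv: "0 \<le> u" "u < v"
  shows "\<exists>t\<in>{u<..<v}. rho t \<noteq> 0"
proof (rule ccontr)
  assume "\<not> ?thesis"
  then have zero: "\<And>t. u < t \<Longrightarrow> t < v \<Longrightarrow> rho t = 0" by auto
  \<comment> \<open>A compact middle third: it avoids 0, so \<open>W\<close> is continuous on it and
    has bounded image.\<close>
  define I where "I = {(2 * u + v) / 3 .. (u + 2 * v) / 3}"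
  have I: "u < t" "t < v" "t > 0" if "t \<in> I" for t using that uv by (auto simp: I_def)
  have "infinite I" unfolding I_def using uv by (intro infinite_Icc) simp
  \<comment> \<open>\<open>W^2\<close> is \<open>cis (- (b * pi)) * Ye^2\<close>, which is real
    where the density vanishes; hence \<open>W\<close> is real or purely imaginary there.\<close>
  define W where "W t = cis (- (b * pi / 2)) * Ye (of_real t)" for t
  have W_Ye: "cis (b * pi / 2) * W t = Ye (of_real t)" for t
    by (simp add: W_def mult.assoc[symmetric] cis_mult)
  \<comment> \<open>The boundary equation recovers \<open>t\<close> from \<open>Ye\<close>, so
    \<open>W\<close> takes infinitely many values.\<close>
  have "inj_on W I"
  proof (rule inj_onI)
    fix s t assume st: "s \<in> I" "t \<in> I" "W s = W t"
    then have "Ye (of_real s) = Ye (of_real t)" using W_Ye by metis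
    then have "complex_of_real (s powr (2 * b)) = of_real (t powr (2 * b))"
      using Ye_eq_pos[OF I(3)[OF st(1)]] Ye_eq_pos[OF I(3)[OF st(2)]] by simp
    then have "s powr (2 * b) = t powr (2 * b)" by (simp only: of_real_eq_iff)
    then have "(s powr (2 * b)) powr (1 / (2 * b)) = (t powr (2 * b)) powr (1 / (2 * b))" by simp
    then show "s = t" using I(3)[OF st(1)] I(3)[OF st(2)] b by (simp add: powr_powr)
  qed
  then have inf: "infinite (W ` I)" using \<open>infinite I\<close> by (simp add: finite_image_iff)
  have "continuous_on I (\<lambda>t. Ye (complex_of_real t))"
    using I(3) by (intro continuous_on_compose2[OF continuous_on_Ye] continuous_intros) force
  then have "continuous_on I W" unfolding W_def by (intro continuous_intros)
  then have bd: "bounded (W ` I)"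
    by (intro compact_imp_bounded compact_continuous_image) (auto simp: I_def)
  have alt: "Re (W t) = 0 \<or> Im (W t) = 0" if t: "t \<in> I" for t
  proof -
    have "rho t = 0" using zero I[OF t] by blast
    then have "Im (h (Ye (of_real t))) = 0" using I(3)[OF t] by (simp add: rho_eq)
    then have "Im (cis (- (b * pi)) * (Ye (of_real t))\<^sup>2) = 0"
      using Im_h_pos[OF I(3)[OF t]] I(3)[OF t] b \<gamma> by simp
    moreover have "cis (- (b * pi)) * (Ye (of_real t))\<^sup>2 = (W t)\<^sup>2"
      by (simp add: W_def power_mult_distrib power2_eq_square cis_mult mult_ac)
    ultimately have "Im ((W t)\<^sup>2) = 0" by simp
    then show ?thesis by (auto simp: power2_eq_square)
  qed
  have real: "h (Ye (of_real t)) = h (cnj (Ye (of_real t)))" if t: "t \<in> I" for t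
  proof -
    have "rho t = 0" using zero I[OF t] by blast
    then have "Im (h (Ye (of_real t))) = 0" using I(3)[OF t] by (simp add: rho_eq)
    then show ?thesis by (simp add: h_cnj complex_eq_iff)
  qed
  have cY: "cnj (Ye (of_real t)) = cis (- (b * pi / 2)) * cnj (W t)" for t
    unfolding W_Ye[symmetric] by (simp add: cis_cnj)
  \<comment> \<open>Real or purely imaginary values occur infinitely often; on them
    \<open>cnj (W t)\<close> is \<open>W t\<close> or \<open>- W t\<close>, which decides the sign
    \<open>s\<close>.\<close>
  let ?P = "{w \<in> W ` I. Im w = 0}" and ?Q = "{w \<in> W ` I. Re w = 0}"
  have "W ` I \<subseteq> ?P \<union> ?Q" using alt by auto
  from infinite_super[OF this inf] have "infinite ?P \<or> infinite ?Q"
    unfolding finite_Un de_Morgan_conj .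
  then show False
  proof
    assume P: "infinite ?P"
    show False
    proof (rule h_rotations_differ[of 1, OF _ P])
      show "bounded ?P" using bd by (rule bounded_subset) auto
      fix w assume "w \<in> ?P"
      then obtain t where t: "t \<in> I" "w = W t" "Im (W t) = 0" by auto
      then have "cnj (W t) = W t" by (simp add: complex_eq_iff)
      then show "h (cis (b * pi / 2) * w) = h (1 * cis (- (b * pi / 2)) * w)"
        using real[OF t(1)] unfolding cY t(2) W_Ye by simp
    qed simp
  next
    assume Q: "infinite ?Q"
    show False
    proof (rule h_rotations_differ[of "-1", OF _ Q])
      show "bounded ?Q" using bd by (rule bounded_subset) auto
      fix w assume "w \<in> ?Q"
      then obtain t where t: "t \<in> I" "w = W t" "Re (W t) = 0" by auto
      then have "cnj (W t) = - W t" by (simp add: complex_eq_iff)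
      then show "h (cis (b * pi / 2) * w) = h (-1 * cis (- (b * pi / 2)) * w)"
        using real[OF t(1)] unfolding cY t(2) W_Ye by simp
    qed simp
  qed
qed

lemma rho_nonvanishing:
  assumes "u < v"
  shows "\<exists>t\<in>{u<..<v}. rho t \<noteq> 0"
proof (cases "v > 0")
  case True
  obtain t where "t \<in> {max u 0<..<v}" "rho t \<noteq> 0"
    using rho_nonvanishing_pos[of "max u 0" v] True assms by auto
  then show ?thesis by (intro bexI[of _ t]) auto
next
  case False
  obtain t where "t \<in> {- v<..<- u}" "rho t \<noteq> 0"
    using rho_nonvanishing_pos[of "- v" "- u"] False assms by auto
  then show ?thesis by (intro bexI[of _ "- t"]) (auto simp: rho_minus)
qed

end

section \<open>Return from \<open>b\<close> to \<open>\<alpha> = 2 b\<close>\<close>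

theorem proposition1p1:
  fixes \<alpha> :: real and Y :: "complex \<Rightarrow> complex" and \<mu> :: "real measure"
  assumes alpha: "0 < \<alpha>" "\<alpha> < 2"
    and Y_analytic: "Y analytic_on upper_half_plane"
    and Y_eq: "\<And>z. z \<in> upper_half_plane \<Longrightarrow>
           z powr complex_of_real \<alpha> * Y z = C_stable \<alpha> * g_stable \<alpha> (Y z)"
    and Y_infinity: "(Y \<longlongrightarrow> 0) (inf at_infinity (principal upper_half_plane))"
    and mu: "real_distribution \<mu>"
    and mu_transform: "\<And>z. z \<in> upper_half_plane \<Longrightarrow>
           (LINT x|\<mu>. 1 / (z - complex_of_real x)) = 1 / z * h_stable \<alpha> (Y z)"
  shows
    "Y ` upper_half_plane \<subseteq> K_stable \<alpha>
   \<and> bounded (g_stable \<alpha> ` K_stable \<alpha>)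
   \<and> finite (D_stable \<alpha>)
   \<and> (\<exists>Ye.
        (\<forall>z \<in> upper_half_plane. Ye z = Y z)
      \<and> continuous_on (upper_half_plane \<union> (\<real> - {0})) Ye
      \<and> (\<forall>t. t \<notin> D_stable \<alpha> \<longrightarrow>
           analytic_at_within Ye (complex_of_real t) (upper_half_plane \<union> (\<real> - {0})))
      \<and> (\<exists>\<rho> :: real \<Rightarrow> real.
           \<rho> \<in> borel_measurable borel
         \<and> (\<forall>t. 0 \<le> \<rho> t)
         \<and> \<mu> = density lborel (\<lambda>t. ennreal (\<rho> t))
         \<and> (\<forall>t. \<rho> (- t) = \<rho> t)
         \<and> bounded (range \<rho>)
         \<and> (\<forall>t. t \<noteq> 0 \<longrightarrow>
              \<rho> t = - (1 / (pi * t)) * Im (h_stable \<alpha> (Ye (complex_of_real t)))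
            \<and> \<rho> t = \<alpha> * \<bar>t\<bar> powr (\<alpha> - 1) / (2 * cmod (C_stable \<alpha>) * pi)
                    * Im (inverse \<i> powr complex_of_real \<alpha> * (Ye (complex_of_real \<bar>t\<bar>))\<^sup>2))
         \<and> (\<forall>t. t \<noteq> 0 \<longrightarrow> isCont \<rho> t)
         \<and> (\<forall>t. t \<notin> D_stable \<alpha> \<longrightarrow> real_analytic_at \<rho> t)
         \<and> (\<forall>a b. a < b \<longrightarrow> (\<exists>t \<in> {a<..<b}. \<rho> t \<noteq> 0))))"
proof -
  define b where "b = \<alpha> / 2"
  have b: "0 < b" "b < 1" and \<alpha>: "\<alpha> = 2 * b" using alpha by (auto simp: b_def)
  define \<gamma> where "\<gamma> = Gamma (1 - b) / Gamma b"
  have \<gamma>: "\<gamma> > 0" using b by (simp add: \<gamma>_def Gamma_real_pos)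
  have gs: "g_stable \<alpha> = stable_integral b (b - 1) 1" and hs: "h_stable \<alpha> = stable_integral b 0 1"
    by (simp_all add: g_stable_eq h_stable_eq b_def)
  have K: "K_stable \<alpha> = sector b" using K_stable_eq_sector[OF alpha] by (simp add: b_def)
  have "\<i> powr complex_of_real \<alpha> = cis (b * pi)"
    using powr_real_polar[of \<i> \<alpha>] by (simp add: b_def)
  then have C: "C_stable \<alpha> = cis (b * pi) * of_real \<gamma>"
    by (simp add: C_stable_def \<gamma>_def b_def)
  interpret stable_solution b Y \<gamma>
  proof
    show "z powr of_real (2 * b) * Y z = cis (b * pi) * of_real \<gamma> * stable_integral b (b - 1) 1 (Y z)"
      if "z \<in> upper_half_plane" for z using Y_eq[OF that] unfolding C gs \<alpha>[symmetric] .
    show "Y holomorphic_on upper_half_plane" using Y_analytic by (rule analytic_imp_holomorphic)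
  qed (fact b \<gamma> Y_infinity)+
  interpret stable_transform b Y \<gamma> \<mu>
  proof (rule stable_transform.intro[OF stable_solution_axioms stable_transform_axioms.intro[OF mu]])
    show "(LINT x|\<mu>. 1 / (z - complex_of_real x)) = 1 / z * h (Y z)"
      if "z \<in> upper_half_plane" for z using mu_transform[OF that] unfolding hs .
  qed
  have cmod_C: "cmod (C_stable \<alpha>) = \<gamma>" using \<gamma> by (simp add: C norm_mult)
  have inv_i: "inverse \<i> powr complex_of_real \<alpha> = cis (- (b * pi))"
    using powr_real_polar[of "inverse \<i>" \<alpha>] by (simp add: b_def cis_conv_exp)
  have bounded_g: "bounded (g_stable \<alpha> ` K_stable \<alpha>)"
    using g_bounded unfolding gs K bounded_iff by blast
  have D: "finite (D_stable \<alpha>)" using finite_D_stable unfolding \<alpha> .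
  have analytic: "analytic_at_within Ye (complex_of_real t) (upper_half_plane \<union> (\<real> - {0}))"
    if t: "t \<notin> D_stable \<alpha>" for t
  proof -
    have t0: "t \<noteq> 0" using t by (auto simp: D_stable_def)
    define s where "s = \<bar>t\<bar>"
    have s: "s > 0" "t = s \<or> t = - s" using t0 by (auto simp: s_def)
    \<comment> \<open>Otherwise \<open>C g'(y) = C g(y) / y = s^\<alpha>\<close> for
      \<open>y = Ye s\<close> in the sector, which places \<open>t\<close> in
      \<open>D_stable \<alpha>\<close>.\<close>
    have "g (Ye (of_real s)) \<noteq> Ye (of_real s) * deriv g (Ye (of_real s))"
    proof
      assume crit: "g (Ye (of_real s)) = Ye (of_real s) * deriv g (Ye (of_real s))"
      have "complex_of_real (s powr \<alpha>) = C_stable \<alpha> * deriv g (Ye (of_real s))"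
        using Ye_eq_pos[OF s(1)] Ye_nz_pos[OF s(1)] unfolding crit \<alpha>[symmetric] C by simp
      then have "t \<in> D_stable \<alpha>"
        unfolding D_stable_def gs K using s crit Ye_pos(1)[OF s(1)] by blast
      then show False using t by simp
    qed
    from Ye_analytic_pos[OF s(1) this] show ?thesis
      using Ye_analytic_reflect[of s] s(2) by blast
  qed
  have rho: "rho t = - (1 / (pi * t)) * Im (h_stable \<alpha> (Ye (complex_of_real t)))"
    "rho t = \<alpha> * \<bar>t\<bar> powr (\<alpha> - 1) / (2 * cmod (C_stable \<alpha>) * pi)
        * Im (inverse \<i> powr complex_of_real \<alpha> * (Ye (complex_of_real \<bar>t\<bar>))\<^sup>2)" if "t \<noteq> 0" for t
    using rho_eq[OF that] rho_eq'[OF that] unfolding hs cmod_C inv_i \<alpha>[symmetric] by blast+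
  have bounded_rho: "bounded (range rho)"
  proof -
    obtain B where "\<And>t. rho t \<le> B" using rho_bounded by blast
    then show ?thesis by (intro boundedI[of _ B]) (auto simp: rho_nonneg)
  qed
  have analytic_rho: "real_analytic_at rho t" if t: "t \<notin> D_stable \<alpha>" for t
    using rho_real_analytic[OF _ analytic[OF t]] t by (auto simp: D_stable_def)
  show ?thesis
  proof (intro conjI exI[of _ Ye] exI[of _ rho] ballI allI impI)
    show "Y ` upper_half_plane \<subseteq> K_stable \<alpha>" using Y_sector unfolding K by blast
    show "\<exists>t\<in>{c<..<d}. rho t \<noteq> 0" if "c < d" for c d by (rule rho_nonvanishing[OF that])
  qed (fact bounded_g D continuous_on_Ye mu_density bounded_rho rho_measurable |
      rule Ye_upper analytic rho_nonneg rho_minus rho rho_isCont analytic_rho, assumption?)+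
qed

end
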